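(* Let $m\ge2$ be an integer. Then $$ \begin{aligned} \sum_{r=1}^{m-1}\Psi\!\left(\frac rm\right)\gamma_1\!\left(\frac rm\right)=\;&\left[\gamma(1-m)-m\ln m\right]\gamma_1+m\gamma^2\ln m\\ &+\left\{\frac{(m-1)(m-2)\pi^2}{12}-m(m-1)\ln^22+2m\ln2\cdot\ln m+\frac{3m}2\ln^2m\right\}\gamma\\ &-m(m-1)\ln^32+\frac m2\ln^3m-\left[m(m-2)\ln m+m(m-1)\ln\pi\right]\ln^22\\ &+\frac{3m}2\ln2\cdot\ln^2m+m\ln2\cdot\ln\pi\cdot\ln m-\frac{(m^2-1)\pi^2}{6}\ln2\pi+\frac{(m^2+2)\pi^2}{12}\ln m\\ &+m(\gamma+\ln2\pi m)\sum_{l=1}^{m-1}\ln^2\sin\frac{\pi l}{m}+\frac m2\sum_{l=1}^{m-1}\left\{\zeta''\!\left(0,\frac lm\right)+\zeta''\!\left(0,1-\frac lm\right)\right\}\ln\sin\frac{\pi l}{m}\\ &+\pi^2\sum_{l=1}^{m-1}l\,\ln\Gamma\!\left(\frac lm\right). \end{aligned} $$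
   Context: $\zeta(s,v)$ is the Hurwitz zeta function, $\zeta(s,v)=\sum_{n\ge0}(n+v)^{-s}$ for $\operatorname{Re}s>1$, continued meromorphically in $s$. The generalized Stieltjes constants $\gamma_n(v)$ are defined by the Laurent expansion at $s=1$: $\zeta(s,v)=\frac1{s-1}+\sum_{n\ge0}\frac{(-1)^n(s-1)^n}{n!}\gamma_n(v)$; the Stieltjes constants are $\gamma_n=\gamma_n(1)$, and $\gamma=\gamma_0$ is Euler's constant. $\Psi=\Gamma'/\Gamma$ is the Digamma function. $\zeta''(0,v)$ denotes the second derivative of $\zeta(s,v)$ with respect to $s$ at $s=0$. $\ln2\pi m=\ln(2\pi m)$, $\ln2\pi=\ln(2\pi)$, $\ln^kx=(\ln x)^k$, $\ln^2\sin x=(\ln\sin x)^2$. *)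

theory Defs
  imports "HOL-Complex_Analysis.Complex_Analysis"
begin

text \<open>
  The meromorphic continuation in \<open>s\<close> of the Hurwitz series, meant for \<open>Re v > 0\<close>.
  Meromorphic continuation determines a function only up to its values at poles and removable
  singularities; \<open>nicely_meromorphic_on\<close> fixes these (removable singularities are filled in and
  the value at a pole, here only at \<open>s = 1\<close>, is \<open>0\<close>), so by the identity theorem the
  description is unique.
\<close>
definition hurwitz_zeta :: "complex \<Rightarrow> complex \<Rightarrow> complex" where
  "hurwitz_zeta s v =
     (THE f. f nicely_meromorphic_on UNIV \<and>
             (\<forall>z. Re z > 1 \<longrightarrow> f z = (\<Sum>n. (of_nat n + v) powr (- z)))) s"

text \<open>
  In the Laurent expansion of \<open>\<lambda>s. hurwitz_zeta s v\<close> at \<open>s = 1\<close>, the coefficient of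
  \<open>(s - 1) ^ n\<close> for \<open>n \<ge> 0\<close> is \<open>(-1) ^ n / fact n\<close> times the generalized Stieltjes constant.
\<close>
definition stieltjes :: "nat \<Rightarrow> complex \<Rightarrow> complex" where
  "stieltjes n v =
     (-1) ^ n * fact n * fls_nth (laurent_expansion (\<lambda>s. hurwitz_zeta s v) 1) (int n)"

definition hurwitz_zeta_deriv2 :: "complex \<Rightarrow> complex \<Rightarrow> complex" where
  "hurwitz_zeta_deriv2 s v = (deriv ^^ 2) (\<lambda>z. hurwitz_zeta z v) s"

end

theory Submission
  imports Defs "HOL-Real_Asymp.Real_Asymp"
begin

text \<open>
  For \<open>\<omega> = exp (2 \<pi> i l / m)\<close> with \<open>0 < l < m\<close> and \<open>x = l / m\<close>, Hurwitz' functional equation expresses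
  \<open>\<Sum>k=1..m. \<omega>^k * \<zeta>(1 + u, k / m)\<close> through \<open>\<zeta>(-u, x)\<close> and \<open>\<zeta>(-u, 1 - x)\<close>. Its Taylor
  coefficients of order 0 and 1 at \<open>u = 0\<close> give the discrete Fourier transforms of \<open>\<Psi>(k / m)\<close> and
  \<open>\<gamma>\<^sub>1(k / m)\<close>, where \<open>\<zeta>(0, x) = 1 / 2 - x\<close>, Lerch's formula for \<open>\<zeta>'(0, x)\<close> and the reflection
  formula for \<open>\<Gamma>\<close> make everything but \<open>\<zeta>''(0, x) + \<zeta>''(0, 1 - x)\<close> explicit. The mode
  \<open>l = 0\<close> comes from \<open>\<Sum>k=1..m. \<zeta>(s, k / m) = m^s * \<zeta>(s)\<close>, and Parseval's identity yields the sum
  of the products; all terms that are odd under \<open>l \<mapsto> m - l\<close> cancel.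

  The functional equation is proved for real \<open>-1 < s < 0\<close>, where
  \<open>\<Gamma>(s) * (\<Sum>k=1..m. \<omega>^k * \<zeta>(s, k / m))\<close> is \<open>m^s\<close> times the Mellin transform of \<open>h(t) - h(0)\<close> with
  \<open>h(t) = 1 / (exp (t - 2 \<pi> i x) - 1)\<close>, by integrating the partial fraction expansion of the cotangent
  termwise; it extends to the half-plane \<open>Re s < 2\<close> by the identity theorem.
\<close>

section \<open>Mellin integrals over the positive reals\<close>

text \<open>Since only the arguments k / m occur, a finite sum over k takes the place of the
  periodic zeta function: under the Mellin integral the weights \<open>cis (2 * pi * x) ^ k\<close>
  form a geometric sum that collapses m kernels to one, and because they add up to 0 they also
  cancel the poles at s = 1. The strip -1 < Re s < 0 is where everything converges at once: after
  its value at 0 is subtracted, the kernel is O(t) at 0 and O(1) at infinity, and the Hurwitz series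
  at 1 - s converges absolutely. Real s reduces the remaining integrals to real Beta integrals, and
  a real segment is enough for the identity theorem. The obstacle is that the equation has to be
  expanded at s = 1, a pole. Hence the entire function (s - 1) * zeta(s, v) is used throughout, and
  near s = 1 + u the equation takes the form u * L u = A u * B u with B 0 = zeta(0, x) + zeta(0, 1 -
  x) = 0. The factor u shifts orders by one: the coefficients of L of order 0 and 1 draw on the
  first and second derivative of B, which is why zeta'' at 0 enters.\<close>

abbreviation pos_lborel :: "real measure" where
  "pos_lborel \<equiv> restrict_space lborel {0<..}"

abbreviation pos_integral :: "(real \<Rightarrow> 'a :: {banach, second_countable_topology}) \<Rightarrow> 'a" where
  "pos_integral \<equiv> integral\<^sup>L pos_lborel"

lemma measurable_pos_lborel:
  fixes f :: "real \<Rightarrow> 'a :: topological_space"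
  assumes "continuous_on {0<..} f"
  shows "f \<in> borel_measurable pos_lborel"
  using borel_measurable_continuous_on_restrict[OF assms]
  by (simp add: measurable_def space_restrict_space sets_restrict_space)

lemma integrable_pos_lborel_iff:
  fixes f :: "real \<Rightarrow> 'a :: {banach, second_countable_topology}"
  shows "integrable pos_lborel f \<longleftrightarrow> set_integrable lborel {0<..} f"
  by (simp add: set_integrable_def integrable_restrict_space)

lemma integral_pos_lborel:
  fixes f :: "real \<Rightarrow> 'a :: {banach, second_countable_topology}"
  shows "pos_integral f = set_lebesgue_integral lborel {0<..} f"
  by (simp add: set_lebesgue_integral_def integral_restrict_space)

lemma pos_lborel_cong:
  fixes f g :: "real \<Rightarrow> 'a :: {banach, second_countable_topology}"
  assumes "\<And>t. t > 0 \<Longrightarrow> f t = g t"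
  shows "integrable pos_lborel f \<longleftrightarrow> integrable pos_lborel g"
    and "pos_integral f = pos_integral g"
  by (rule Bochner_Integration.integrable_cong Bochner_Integration.integral_cong;
      use assms in \<open>simp add: space_restrict_space\<close>)+

lemma pos_lborel_bound:
  fixes f :: "real \<Rightarrow> 'a :: {banach, second_countable_topology}"
    and g :: "real \<Rightarrow> 'b :: {banach, second_countable_topology}"
  assumes "integrable pos_lborel g" "continuous_on {0<..} f" "\<And>t. t > 0 \<Longrightarrow> norm (f t) \<le> norm (g t)"
  shows "integrable pos_lborel f"
  by (rule Bochner_Integration.integrable_bound[OF assms(1) measurable_pos_lborel[OF assms(2)]])
     (auto simp: space_restrict_space intro!: AE_I2 assms)

lemma pos_lborel_scale:
  fixes f :: "real \<Rightarrow> 'a :: {banach, second_countable_topology}"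
  assumes c: "c > 0"
  shows "integrable pos_lborel (\<lambda>t. f (c * t)) \<longleftrightarrow> integrable pos_lborel f"
    and "pos_integral (\<lambda>t. f (c * t)) = (1 / c) *\<^sub>R pos_integral f"
proof -
  have *: "(\<lambda>x. indicator {0<..} x *\<^sub>R f (c * x)) = (\<lambda>x. indicator {0<..} (0 + c * x) *\<^sub>R f (0 + c * x))"
    using c by (auto simp: indicator_def zero_less_mult_iff)
  show "integrable pos_lborel (\<lambda>t. f (c * t)) \<longleftrightarrow> integrable pos_lborel f"
    unfolding integrable_pos_lborel_iff set_integrable_def *
    by (rule lborel_integrable_real_affine_iff) (use c in auto)
  show "pos_integral (\<lambda>t. f (c * t)) = (1 / c) *\<^sub>R pos_integral f"
    unfolding integral_pos_lborel set_lebesgue_integral_def *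
    by (subst (2) lborel_integral_real_affine[of c _ 0]) (use c in auto)
qed

lemma continuous_on_pos_powr [continuous_intros]:
  "continuous_on {0<..} (\<lambda>t. complex_of_real t powr z)"
  by (intro continuous_intros) (auto simp: complex_nonpos_Reals_iff)

section \<open>Euler's integral for Gamma, as a Lebesgue integral over the positive reals\<close>

lemma Gamma_mellin_1:
  assumes "Re z > 0"
  shows "integrable pos_lborel (\<lambda>t. of_real t powr (z - 1) * exp (- of_real t))"
    and "pos_integral (\<lambda>t. of_real t powr (z - 1) * exp (- of_real t)) = Gamma z"
proof -
  let ?f = "\<lambda>t. complex_of_real t powr (z - 1) / of_real (exp t)"
  let ?g = "\<lambda>t. complex_of_real t powr (z - 1) * exp (- of_real t)"
  have eq: "?f = ?g"
    by (auto simp: exp_minus divide_inverse simp flip: exp_of_real)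
  have m: "?g \<in> borel_measurable pos_lborel"
    by (intro measurable_pos_lborel continuous_intros)
  hence m': "(\<lambda>x. indicator {0<..} x *\<^sub>R ?g x) \<in> borel_measurable lborel"
    by (subst (asm) borel_measurable_restrict_space_iff) (auto simp: scaleR_conv_of_real)
  \<comment> \<open>Absolute integrability and Borel measurability carry the gauge integral over to
    \<open>lborel\<close>, where dominated convergence and termwise integration apply.\<close>
  have "?g absolutely_integrable_on {0<..}"
    using absolutely_integrable_Gamma_integral'[OF assms] eq by simp
  hence i: "set_integrable lborel {0<..} ?g"
    unfolding set_integrable_def using m' by (simp add: integrable_completion)
  thus "integrable pos_lborel ?g"
    by (simp add: integrable_pos_lborel_iff)
  have "(?g has_integral (pos_integral ?g)) {0<..}"
    unfolding integral_pos_lborel using set_borel_integral_eq_integral[OF i]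
    by (auto simp: has_integral_iff)
  moreover have "(?g has_integral Gamma z) {0<..}"
    using Gamma_integral_complex'[OF assms] eq by simp
  ultimately show "pos_integral ?g = Gamma z"
    by (rule has_integral_unique)
qed

lemma powr_mult_pos_real:
  "a > 0 \<Longrightarrow> t > 0 \<Longrightarrow>
     complex_of_real (a * t) powr z = of_real a powr z * of_real t powr z"
  by (simp add: powr_times_real)

lemma mellin_scale:
  fixes f :: "real \<Rightarrow> complex"
  assumes a: "a > 0" and i: "integrable pos_lborel (\<lambda>t. of_real t powr (z - 1) * f t)"
  shows "integrable pos_lborel (\<lambda>t. of_real t powr (z - 1) * f (a * t))"
    and "pos_integral (\<lambda>t. of_real t powr (z - 1) * f (a * t)) =
           of_real a powr (- z) * pos_integral (\<lambda>t. of_real t powr (z - 1) * f t)"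
proof -
  let ?f = "\<lambda>t. complex_of_real t powr (z - 1) * f t"
  have eq: "of_real t powr (z - 1) * f (a * t) = of_real a powr (1 - z) * ?f (a * t)"
    if "t > 0" for t
  proof -
    have "of_real a powr (1 - z) * of_real a powr (z - 1) = 1"
      using assms by (simp flip: powr_add)
    thus ?thesis using powr_mult_pos_real[OF a that, of "z - 1"]
      by (simp add: mult_ac)
  qed
  have "integrable pos_lborel (\<lambda>t. ?f (a * t))"
    by (subst pos_lborel_scale(1)) (use assms in auto)
  thus "integrable pos_lborel (\<lambda>t. of_real t powr (z - 1) * f (a * t))"
    by (subst pos_lborel_cong(1)[OF eq]) auto
  have "pos_integral (\<lambda>t. of_real t powr (z - 1) * f (a * t)) =
         of_real a powr (1 - z) * pos_integral (\<lambda>t. ?f (a * t))"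
    by (subst pos_lborel_cong(2)[OF eq]) auto
  also have "\<dots> = of_real a powr (1 - z) * (of_real (1 / a) * pos_integral ?f)"
    by (subst pos_lborel_scale(2)) (use assms in \<open>auto simp: scaleR_conv_of_real\<close>)
  also have "\<dots> = of_real a powr (- z) * pos_integral ?f"
    using assms by (simp add: powr_diff powr_minus field_simps)
  finally show "pos_integral (\<lambda>t. of_real t powr (z - 1) * f (a * t)) =
           of_real a powr (- z) * pos_integral ?f" .
qed

lemma Gamma_mellin:
  assumes "Re z > 0" "a > 0"
  shows "integrable pos_lborel (\<lambda>t. of_real t powr (z - 1) * exp (- of_real (a * t)))"
    and "pos_integral (\<lambda>t. of_real t powr (z - 1) * exp (- of_real (a * t))) =
           Gamma z * of_real a powr (- z)"
  using mellin_scale[OF assms(2) Gamma_mellin_1(1)[OF assms(1)]] Gamma_mellin_1(2)[OF assms(1)]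
  by simp_all

lemma Gamma_mellin_real:
  assumes "s > 0" "a > (0::real)"
  shows "integrable pos_lborel (\<lambda>t. t powr (s - 1) * exp (- (a * t)))"
  by (rule pos_lborel_bound[OF Gamma_mellin(1)[of "of_real s" a]])
     (use assms in \<open>auto intro!: continuous_intros simp: norm_mult norm_powr_real_powr\<close>)

lemma norm_pos_powr: "t > 0 \<Longrightarrow> norm (complex_of_real t powr z) = t powr Re z"
  by (simp add: norm_powr_real_powr)

text \<open>Differentiation under the integral sign from a local majorant of the integrand alone:
  Cauchy's inequality turns the majorant \<open>g\<close> into the majorant \<open>g t / r\<close>
  of the derivative, hence of the difference quotients, and dominated convergence applies.\<close>

lemma holomorphic_on_parameter_integral:
  fixes f :: "complex \<Rightarrow> 'b \<Rightarrow> complex"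
  assumes S: "open S"
    and holo: "\<And>t. t \<in> space M \<Longrightarrow> (\<lambda>s. f s t) holomorphic_on S"
    and meas: "\<And>s. s \<in> S \<Longrightarrow> f s \<in> borel_measurable M"
    and bound: "\<And>s. s \<in> S \<Longrightarrow> \<exists>r>0. \<exists>g. integrable M g \<and>
                  (\<forall>z\<in>ball s r. \<forall>t\<in>space M. norm (f z t) \<le> g t)"
  shows "(\<lambda>s. integral\<^sup>L M (f s)) holomorphic_on S"
proof -
  have "\<exists>D. ((\<lambda>s. integral\<^sup>L M (f s)) has_field_derivative D) (at s)" if s: "s \<in> S" for s
  proof -
    obtain r0 g where r0: "r0 > 0" and g: "integrable M g"
      and le0: "\<And>z t. z \<in> ball s r0 \<Longrightarrow> t \<in> space M \<Longrightarrow> norm (f z t) \<le> g t"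
      using bound[OF s] by blast
    obtain r1 where r1: "r1 > 0" "ball s r1 \<subseteq> S"
      using S s openE by blast
    \<comment> \<open>Halved, so that closed discs of radius \<open>r\<close> around points of
      \<open>ball s r\<close> stay inside \<open>ball s (2 * r)\<close>, where both domination and
      holomorphy hold.\<close>
    define r where "r = min r0 r1 / 2"
    have r: "r > 0" "ball s (2 * r) \<subseteq> S" using r0 r1 by (auto simp: r_def)
    have le: "norm (f z t) \<le> g t" if "z \<in> ball s (2*r)" "t \<in> space M" for z t
      using le0[OF _ that(2)] that(1) by (auto simp: r_def)
    have int: "integrable M (f z)" if "z \<in> ball s (2*r)" for z
      by (rule Bochner_Integration.integrable_bound[OF g meas])
         (use that r(2) le in \<open>force intro!: AE_I2\<close>)+
    have dle: "norm (deriv (\<lambda>s. f s t) z) \<le> g t / r" if z: "z \<in> ball s r" and t: "t \<in> space M" for z t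
    proof -
      have sub: "cball z r \<subseteq> ball s (2*r)"
      proof
        fix w assume "w \<in> cball z r"
        thus "w \<in> ball s (2*r)" using z dist_triangle[of s w z] by (auto simp: dist_commute)
      qed
      hence sub': "cball z r \<subseteq> S" using r by blast
      have h: "(\<lambda>s. f s t) holomorphic_on cball z r"
        by (rule holomorphic_on_subset[OF holo[OF t] sub'])
      have "norm ((deriv ^^ 1) (\<lambda>s. f s t) z) \<le> fact 1 * g t / r ^ 1"
        by (rule Cauchy_inequality)
           (use h r sub le[OF _ t] in \<open>auto simp: subset_iff dist_norm norm_minus_commute
             intro: holomorphic_on_subset holomorphic_on_imp_continuous_on\<close>)
      thus ?thesis by simp
    qed
    have lip: "norm (f z t - f s t) \<le> g t / r * norm (z - s)"
      if z: "z \<in> ball s r" and t: "t \<in> space M" for z t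
    proof (rule field_differentiable_bound[OF convex_ball[of s r]])
      show "((\<lambda>z. f z t) has_field_derivative deriv (\<lambda>s. f s t) w) (at w within ball s r)"
        if "w \<in> ball s r" for w
        by (rule DERIV_subset[of _ _ _ UNIV]; (rule holomorphic_derivI[OF holo[OF t] S])?)
           (use that r in auto)
    qed (use z r t dle in auto)
    define D where "D = integral\<^sup>L M (\<lambda>t. deriv (\<lambda>s. f s t) s)"
    define U where "U = ball s r"
    have U: "open U" "s \<in> U" using r by (auto simp: U_def)
    have conv: "(\<lambda>n. (f (X n) t - f s t) / (X n - s)) \<longlonglongrightarrow> deriv (\<lambda>s. f s t) s"
      if X: "\<forall>n. X n \<in> U - {s}" "X \<longlonglongrightarrow> s" and t: "t \<in> space M" for X :: "nat \<Rightarrow> complex" and t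
    proof -
      have "((\<lambda>z. f z t) has_field_derivative deriv (\<lambda>s. f s t) s) (at s within U)"
        by (rule DERIV_subset[of _ _ _ UNIV]; (rule holomorphic_derivI[OF holo[OF t] S s])?) auto
      hence "((\<lambda>z. (f z t - f s t) / (z - s)) \<longlongrightarrow> deriv (\<lambda>s. f s t) s) (at s within U)"
        by (simp add: has_field_derivative_iff)
      thus ?thesis using X unfolding tendsto_at_iff_sequentially by (auto simp: o_def)
    qed
    have US: "U \<subseteq> S" "U \<subseteq> ball s (2*r)" using r by (auto simp: U_def)
    have mquot: "(\<lambda>t. (f z t - f s t) / (z - s)) \<in> borel_measurable M" if "z \<in> U" for z
      using meas[of z] meas[OF s] that US by (auto intro!: borel_measurable_divide borel_measurable_diff)
    \<comment> \<open>A concrete sequence tending to \<open>s\<close> exhibits the derivative as a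
      pointwise limit of measurable quotients; the offset 2 keeps every term strictly inside the
      ball.\<close>
    define X0 where "X0 = (\<lambda>n. s + of_real (r / (real n + 2)))"
    have X0: "\<forall>n. X0 n \<in> U - {s}"
    proof safe
      fix n
      have "r / (real n + 2) < r / 1" by (rule divide_strict_left_mono) (use r in auto)
      thus "X0 n \<in> U" using r by (auto simp: X0_def U_def dist_norm simp del: of_real_divide)
    qed (use r in \<open>auto simp: X0_def simp del: of_real_divide\<close>)
    have "(\<lambda>n. r / (real n + 2)) \<longlonglongrightarrow> 0" by real_asymp
    hence "(\<lambda>n. s + of_real (r / (real n + 2))) \<longlonglongrightarrow> s + of_real 0"
      by (intro tendsto_intros)
    hence X0': "X0 \<longlonglongrightarrow> s" by (simp add: X0_def)
    have mD: "(\<lambda>t. deriv (\<lambda>s. f s t) s) \<in> borel_measurable M"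
      by (rule borel_measurable_LIMSEQ_metric[where f = "\<lambda>n t. (f (X0 n) t - f s t) / (X0 n - s)"])
         (use mquot conv X0 X0' in auto)
    have "((\<lambda>z. (integral\<^sup>L M (f z) - integral\<^sup>L M (f s)) / (z - s)) \<longlongrightarrow> D) (at s within U)"
      unfolding tendsto_at_iff_sequentially
    proof safe
      fix X assume X: "\<forall>i. X i \<in> U - {s}" "X \<longlonglongrightarrow> s"
      have "(\<lambda>n. integral\<^sup>L M (\<lambda>t. (f (X n) t - f s t) / (X n - s))) \<longlonglongrightarrow> D"
        unfolding D_def
      proof (rule integral_dominated_convergence[where w = "\<lambda>t. g t / r"])
        show "integrable M (\<lambda>t. g t / r)" using g by simp
        show "(\<lambda>t. (f (X n) t - f s t) / (X n - s)) \<in> borel_measurable M" for n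
          by (rule mquot) (use X in auto)
        show "AE t in M. (\<lambda>n. (f (X n) t - f s t) / (X n - s)) \<longlonglongrightarrow> deriv (\<lambda>s. f s t) s"
          by (intro AE_I2 conv X)
        show "AE t in M. norm ((f (X n) t - f s t) / (X n - s)) \<le> g t / r" for n
        proof (rule AE_I2)
          fix t assume t: "t \<in> space M"
          have "X n \<in> ball s r" "X n \<noteq> s" using X by (auto simp: U_def)
          thus "norm ((f (X n) t - f s t) / (X n - s)) \<le> g t / r"
            using lip[OF _ t, of "X n"] by (simp add: norm_divide divide_le_eq mult_ac)
        qed
      qed (fact mD)
      also have "(\<lambda>n. integral\<^sup>L M (\<lambda>t. (f (X n) t - f s t) / (X n - s))) =
            (\<lambda>n. (integral\<^sup>L M (f (X n)) - integral\<^sup>L M (f s)) / (X n - s))"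
      proof
        fix n
        have "X n \<in> ball s (2*r)" "s \<in> ball s (2*r)" using X US U by auto
        hence "integrable M (f (X n))" "integrable M (f s)" by (auto intro: int)
        thus "integral\<^sup>L M (\<lambda>t. (f (X n) t - f s t) / (X n - s)) =
            (integral\<^sup>L M (f (X n)) - integral\<^sup>L M (f s)) / (X n - s)" by simp
      qed
      finally show "((\<lambda>z. (integral\<^sup>L M (f z) - integral\<^sup>L M (f s)) / (z - s)) \<circ> X) \<longlonglongrightarrow> D"
        by (simp add: o_def)
    qed
    hence "((\<lambda>s. integral\<^sup>L M (f s)) has_field_derivative D) (at s within U)"
      by (simp add: has_field_derivative_iff)
    thus ?thesis using at_within_open[OF U(2) U(1)] by auto
  qed
  thus ?thesis
    using S by (auto simp: holomorphic_on_open)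
qed

text \<open>Multiplied by t^(s-1), the majorant is a Gamma integrand: vanishing of order
  \<open>b\<close> at 0 moves the half-plane of convergence to Re s > -b, and the exponential
  handles infinity.\<close>

lemma holomorphic_on_mellin:
  fixes g :: "real \<Rightarrow> complex"
  assumes cont: "continuous_on {0<..} g" and a: "a > 0"
    and bound: "\<And>t. t > 0 \<Longrightarrow> norm (g t) \<le> C * t powr b * exp (- (a * t))"
  shows "\<And>s. Re s > - b \<Longrightarrow> integrable pos_lborel (\<lambda>t. of_real t powr (s - 1) * g t)"
    and "(\<lambda>s. pos_integral (\<lambda>t. of_real t powr (s - 1) * g t)) holomorphic_on {s. Re s > - b}"
proof -
  have le: "norm (of_real t powr (s - 1) * g t) \<le> C * (t powr (Re s + b - 1) * exp (- (a * t)))"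
    if "t > 0" for t s
  proof -
    have "norm (of_real t powr (s - 1) * g t) \<le> t powr (Re s - 1) * (C * t powr b * exp (- (a * t)))"
      unfolding norm_mult using that bound[OF that]
      by (intro mult_mono) (auto simp: norm_pos_powr)
    also have "\<dots> = C * (t powr (Re s + b - 1) * exp (- (a * t)))"
      using that by (simp add: powr_add powr_diff)
    finally show ?thesis .
  qed
  have C: "C \<ge> 0"
  proof -
    have "0 \<le> C * exp (- a)" using bound[of 1] norm_ge_zero[of "g 1"] by (simp del: norm_ge_zero)
    thus ?thesis by (simp add: zero_le_mult_iff)
  qed
  show "integrable pos_lborel (\<lambda>t. of_real t powr (s - 1) * g t)" if "Re s > -b" for s
  proof (rule pos_lborel_bound)
    show "integrable pos_lborel (\<lambda>t. C * (t powr (Re s + b - 1) * exp (- (a * t))))"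
      using Gamma_mellin_real[of "Re s + b" a] that a by auto
    show "continuous_on {0<..} (\<lambda>t. complex_of_real t powr (s - 1) * g t)"
      by (intro continuous_intros cont)
  qed (use le[where s = s] C in auto)
  show "(\<lambda>s. pos_integral (\<lambda>t. of_real t powr (s - 1) * g t)) holomorphic_on {s. Re s > - b}"
  proof (rule holomorphic_on_parameter_integral)
    show "open {s. Re s > - b}" by (rule open_halfspace_Re_gt)
  next
    fix t assume "t \<in> space pos_lborel"
    thus "(\<lambda>s. complex_of_real t powr (s - 1) * g t) holomorphic_on {s. Re s > - b}"
      by (intro holomorphic_intros) (auto simp: space_restrict_space)
  next
    fix s assume "s \<in> {s. Re s > -b}"
    show "(\<lambda>t. complex_of_real t powr (s - 1) * g t) \<in> borel_measurable pos_lborel"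
      by (intro measurable_pos_lborel continuous_intros cont)
  next
    fix s assume "s \<in> {s. Re s > -b}"
    \<comment> \<open>Half the distance from \<open>s\<close> to the boundary: on
      \<open>ball s r\<close> the exponent \<open>Re z + b\<close> stays between r and 3 r, so the
      power of t is dominated by the sum of the two extreme powers, one for small t and one for
      large t.\<close>
    define r where "r = (Re s + b) / 2"
    have r: "r > 0" "Re s + b = 2 * r" using \<open>s \<in> _\<close> by (auto simp: r_def)
    define G where "G = (\<lambda>t. C * (t powr (r - 1) * exp (- (a * t)) + t powr (3 * r - 1) * exp (- (a * t))))"
    have "integrable pos_lborel G"
      unfolding G_def using Gamma_mellin_real[of r a] Gamma_mellin_real[of "3*r" a] r a by auto
    moreover have "norm (of_real t powr (z - 1) * g t) \<le> G t" if "z \<in> ball s r" "t > 0" for z t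
    proof -
      have "\<bar>Re z - Re s\<bar> < r" using that abs_Re_le_cmod[of "z - s"]
        by (auto simp: dist_norm norm_minus_commute)
      hence z: "r < Re z + b" "Re z + b < 3 * r" using r by auto
      have "t powr (Re z + b - 1) \<le> t powr (r - 1) + t powr (3 * r - 1)"
      proof (cases "t \<ge> 1")
        case True
        hence "t powr (Re z + b - 1) \<le> t powr (3 * r - 1)" using z by (intro powr_mono) auto
        thus ?thesis by (simp add: add_increasing)
      next
        case False
        hence "t powr (Re z + b - 1) \<le> t powr (r - 1)" using z that by (intro powr_mono') auto
        thus ?thesis by (simp add: add_increasing2)
      qed
      hence "C * (t powr (Re z + b - 1) * exp (-(a*t))) \<le> C * ((t powr (r - 1) + t powr (3 * r - 1)) * exp (-(a*t)))"
        using C by (intro mult_left_mono mult_right_mono) auto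
      thus ?thesis using le[OF that(2), of z] by (simp add: G_def algebra_simps)
    qed
    ultimately show "\<exists>r>0. \<exists>G. integrable pos_lborel G \<and>
          (\<forall>z\<in>ball s r. \<forall>t\<in>space pos_lborel. norm (complex_of_real t powr (z - 1) * g t) \<le> G t)"
      using r by (intro exI[of _ r] conjI exI[of _ G]) (auto simp: space_restrict_space)
  qed
qed

section \<open>The kernel of the Hurwitz integral without its pole, and its Taylor polynomials at
  0\<close>

definition binet_kernel :: "complex \<Rightarrow> complex" where
  "binet_kernel z = 1 / (1 - exp (- z)) - 1 / z"

lemma holomorphic_split_off_constant:
  assumes "f holomorphic_on S" "open S" "(0::complex) \<in> S"
  obtains g where "g holomorphic_on S" "\<And>z. z \<in> S \<Longrightarrow> f z = f 0 + z * g z"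
proof (rule that)
  show "(\<lambda>z. if z = 0 then deriv f 0 else (f z - f 0) / (z - 0)) holomorphic_on S"
    by (rule pole_lemma_open[OF assms(1,2)])
qed auto

text \<open>The zeros of 1 - exp (-z) are the multiples of 2 pi i, and 2 pi > 1.\<close>

lemma exp_neg_neq_1:
  assumes "z \<in> ball 0 1 - {0::complex}"
  shows "exp (- z) \<noteq> 1"
proof
  assume "exp (- z) = 1"
  then obtain k :: int where k: "Im z = of_int (2 * k) * pi" "Re z = 0"
  proof -
    from \<open>exp (- z) = 1\<close> obtain n :: int where n: "Re (- z) = 0" "Im (- z) = of_int (2 * n) * pi"
      unfolding exp_eq_1 by blast
    show ?thesis by (rule that[of "- n"]) (use n in auto)
  qed
  hence "k \<noteq> 0" using assms by (auto simp: complex_eq_iff)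
  hence "1 \<le> \<bar>of_int k :: real\<bar>" by linarith
  hence "1 * (2 * pi) \<le> \<bar>of_int k\<bar> * (2 * pi)" by (intro mult_right_mono) auto
  hence "2 * pi \<le> \<bar>Im z\<bar>" using k by (simp add: abs_mult)
  also have "\<dots> < 1" using assms abs_Im_le_cmod[of z] by auto
  finally show False using pi_gt3 by simp
qed

text \<open>Writing 1 - exp (-z) = z * e z with e 0 = 1 and then 1 - e z = z * d z shows that the
  kernel is d / e away from 0; each further coefficient is the value at 0 of the current remainder.
  The point 0 is excluded because division by zero makes \<open>binet_kernel 0\<close> equal to 0
  instead of the limit 1/2.\<close>

lemma binet_kernel_taylor_ball:
  "\<exists>b g. g holomorphic_on ball 0 1 \<and>
         (\<forall>z\<in>ball 0 1 - {0}. binet_kernel z = (\<Sum>j<N. b j * z ^ j) + z ^ N * g z)"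
proof (induction N)
  case 0
  have "(\<lambda>z. 1 - exp (- z)) holomorphic_on ball 0 (1::real)" by (intro holomorphic_intros)
  then obtain e where e: "e holomorphic_on ball 0 1"
    "\<And>z::complex. z \<in> ball 0 1 \<Longrightarrow> 1 - exp (- z) = z * e z"
    using holomorphic_split_off_constant[of "\<lambda>z. 1 - exp (- z)" "ball 0 1"] by auto
  \<comment> \<open>\<open>e 0\<close> is the derivative at 0 of z * e z, a function that coincides
    with 1 - exp (-z) near 0.\<close>
  have e0: "e 0 = 1"
  proof -
    have "((\<lambda>z. z * e z) has_field_derivative (e 0 + 0 * deriv e 0)) (at (0::complex))"
      by (rule derivative_eq_intros holomorphic_derivI[OF e(1)] refl | simp)+
    moreover have "((\<lambda>z. z * e z) has_field_derivative 1) (at (0::complex))"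
    proof (rule DERIV_cong_ev[THEN iffD1])
      show "eventually (\<lambda>z. 1 - exp (- z) = z * e z) (nhds (0::complex))"
        using eventually_nhds_in_open[of "ball 0 1" "0::complex"] by (auto elim!: eventually_mono simp: e(2))
      show "((\<lambda>z. 1 - exp (- z)) has_field_derivative 1) (at (0::complex))"
        by (auto intro!: derivative_eq_intros)
    qed auto
    ultimately show ?thesis using DERIV_unique by fastforce
  qed
  have en: "e z \<noteq> 0" if "z \<in> ball 0 1" for z
    using e(2)[OF that] e0 exp_neg_neq_1[of z] that by (cases "z = 0") auto
  have "(\<lambda>z. 1 - e z) holomorphic_on ball 0 1" by (intro holomorphic_intros e)
  then obtain d where d: "d holomorphic_on ball 0 1" "\<And>z. z \<in> ball 0 1 \<Longrightarrow> 1 - e z = z * d z"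
    using holomorphic_split_off_constant[of "\<lambda>z. 1 - e z" "ball 0 1"] e0 by auto
  have "(\<lambda>z. d z / e z) holomorphic_on ball 0 1"
    by (intro holomorphic_intros d e) (use en in auto)
  moreover have "binet_kernel z = d z / e z" if "z \<in> ball 0 1 - {0}" for z
  proof -
    have "binet_kernel z = 1 / (z * e z) - 1 / z"
      using e(2)[of z] that by (simp add: binet_kernel_def)
    also have "\<dots> = (1 - e z) / (z * e z)" using en[of z] that by (simp add: field_simps)
    also have "\<dots> = d z / e z" using d(2)[of z] that by simp
    finally show ?thesis .
  qed
  ultimately show ?case by (intro exI[of _ "\<lambda>_. 0"] exI[of _ "\<lambda>z. d z / e z"]) auto
next
  case (Suc N)
  then obtain b g where g: "g holomorphic_on ball 0 1"
    "\<And>z. z \<in> ball 0 1 - {0} \<Longrightarrow> binet_kernel z = (\<Sum>j<N. b j * z ^ j) + z ^ N * g z" by blast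
  obtain h where h: "h holomorphic_on ball 0 1" "\<And>z. z \<in> ball 0 1 \<Longrightarrow> g z = g 0 + z * h z"
    using holomorphic_split_off_constant[OF g(1)] by auto
  have "binet_kernel z = (\<Sum>j<Suc N. (b(N := g 0)) j * z ^ j) + z ^ Suc N * h z"
    if "z \<in> ball 0 1 - {0}" for z
    using g(2)[OF that] h(2)[of z] that by (simp add: algebra_simps)
  thus ?case using h(1) by blast
qed

lemma continuous_on_binet_kernel: "continuous_on {0<..} (\<lambda>t. binet_kernel (of_real t))"
  unfolding binet_kernel_def
proof (intro continuous_intros ballI)
  fix t :: real assume "t \<in> {0<..}"
  hence "exp (- t) \<noteq> 1" by simp
  hence "complex_of_real (exp (- t)) \<noteq> 1" by (simp only: of_real_eq_1_iff not_False_eq_True)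
  thus "1 - exp (- complex_of_real t) \<noteq> 0" by (simp flip: exp_of_real)
qed auto

text \<open>The local estimate becomes global: for t <= 1/2 the holomorphic remainder is bounded on
  a compact disc, and for t > 1/2 the kernel is bounded while every lower power of t is at most (2
  t)^N.\<close>

lemma binet_kernel_taylor:
  "\<exists>b C. \<forall>t>0. norm (binet_kernel (of_real t) - (\<Sum>j<N. b j * of_real t ^ j)) \<le> C * t ^ N"
proof -
  obtain b g where g: "g holomorphic_on ball 0 1"
    "\<And>z. z \<in> ball 0 1 - {0} \<Longrightarrow> binet_kernel z = (\<Sum>j<N. b j * z ^ j) + z ^ N * g z"
    using binet_kernel_taylor_ball[of N] by blast
  have "continuous_on (cball 0 (1/2)) g"
    by (rule holomorphic_on_imp_continuous_on[OF holomorphic_on_subset[OF g(1)]]) auto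
  hence "compact (g ` cball 0 (1/2))" by (intro compact_continuous_image) auto
  then obtain K where K: "\<And>z. z \<in> cball 0 (1/2) \<Longrightarrow> norm (g z) \<le> K"
    using compact_imp_bounded bounded_iff by (metis imageI)
  \<comment> \<open>For t > 1/2 the summands bound 1 / (1 - exp (-t)), 1 / t and the coefficients of
    the polynomial; 2 ^ N appears because 1 and t ^ j are replaced by (2 t)^N.\<close>
  define D where "D = (1 / (1 - exp (-1/2)) + 2 + (\<Sum>j<N. norm (b j))) * 2 ^ N"
  have "norm (binet_kernel (of_real t) - (\<Sum>j<N. b j * of_real t ^ j)) \<le> max K D * t ^ N" if t: "t > 0" for t
  proof (cases "t \<le> 1/2")
    case True
    hence "binet_kernel (of_real t) - (\<Sum>j<N. b j * of_real t ^ j) = of_real t ^ N * g (of_real t)"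
      using g(2)[of "of_real t"] t by auto
    moreover have "norm (g (of_real t)) \<le> K" using K[of "of_real t"] True t by auto
    ultimately show ?thesis using t by (auto simp: norm_mult norm_power mult_ac intro!: mult_left_mono)
  next
    case False
    have e: "exp (- t) < 1" "exp (-t) \<le> exp (-1/2)" using False t by auto
    have e': "exp (-1/2 :: real) < 1" by simp
    have s: "t ^ j \<le> (2 * t) ^ N" if "j < N" for j
    proof -
      have "t ^ j \<le> (2 * t) ^ j" using t by (intro power_mono) auto
      also have "\<dots> \<le> (2 * t) ^ N" using False that by (intro power_increasing) auto
      finally show ?thesis .
    qed
    have one: "1 \<le> (2 * t) ^ N" using False by (intro one_le_power) auto
    have "norm (binet_kernel (of_real t) - (\<Sum>j<N. b j * of_real t ^ j))
        \<le> norm (1 / (1 - exp (- complex_of_real t))) + norm (1 / complex_of_real t) + (\<Sum>j<N. norm (b j * of_real t ^ j))"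
      unfolding binet_kernel_def
      by (intro order.trans[OF norm_triangle_ineq4] add_mono norm_sum order_refl)
    also have "1 / (1 - exp (- complex_of_real t)) = of_real (1 / (1 - exp (-t)))"
      by (simp flip: exp_of_real)
    also have "norm (of_real (1 / (1 - exp (-t))) :: complex) = 1 / (1 - exp (-t))"
      unfolding norm_of_real using e by auto
    also have "\<dots> \<le> 1 / (1 - exp (-1/2))" using e e' by (intro divide_left_mono mult_pos_pos) auto
    also have "norm (1 / complex_of_real t) \<le> 2" using False by (simp add: norm_divide field_simps)
    also have "(\<Sum>j<N. norm (b j * of_real t ^ j)) \<le> (\<Sum>j<N. norm (b j) * (2 * t) ^ N)"
      using s t by (intro sum_mono) (auto simp: norm_mult norm_power intro!: mult_left_mono)
    also have "1 / (1 - exp (-1/2)) + 2 + \<dots> \<le> (1 / (1 - exp (-1/2)) + 2) * (2 * t) ^ N + \<dots>"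
    proof (rule add_right_mono)
      have "0 \<le> 1 / (1 - exp (-1/2)) + (2::real)" using e' by (intro add_nonneg_nonneg) auto
      from mult_left_mono[OF one this]
      show "1 / (1 - exp (-1/2)) + 2 \<le> (1 / (1 - exp (-1/2)) + 2) * (2 * t) ^ N" by simp
    qed
    also have "\<dots> = D * t ^ N" unfolding D_def
      by (simp add: algebra_simps sum_distrib_left sum_distrib_right power_mult_distrib)
    also have "\<dots> \<le> max K D * t ^ N" using t by (intro mult_right_mono) auto
    finally show ?thesis by simp
  qed
  thus ?thesis by blast
qed

text \<open>The bound C * t forces the constant coefficient to be the limit of the kernel at 0 from
  the right, which is 1/2.\<close>

lemma binet_kernel_bound:
  obtains C where "C > 0" "\<And>t. t > 0 \<Longrightarrow> norm (binet_kernel (of_real t) - 1 / 2) \<le> C * t"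
proof -
  obtain b C where C: "\<And>t. t > 0 \<Longrightarrow> norm (binet_kernel (of_real t) - b) \<le> C * t"
    using binet_kernel_taylor[of 1] by auto
  have "((\<lambda>t. C * t) \<longlongrightarrow> 0) (at_right (0::real))" by real_asymp
  hence "((\<lambda>t. binet_kernel (of_real t) - b) \<longlongrightarrow> 0) (at_right 0)"
    by (rule Lim_null_comparison[rotated]) (use C in \<open>auto simp: eventually_at_filter\<close>)
  hence "((\<lambda>t. binet_kernel (of_real t)) \<longlongrightarrow> b) (at_right 0)"
    by (simp add: Lim_null[symmetric])
  moreover have "((\<lambda>t. complex_of_real (1 / (1 - exp (-t)) - 1 / t)) \<longlongrightarrow> of_real (1/2)) (at_right 0)"
    by (intro tendsto_of_real) real_asymp
  hence "((\<lambda>t. binet_kernel (of_real t)) \<longlongrightarrow> 1/2) (at_right 0)"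
    by (simp add: binet_kernel_def exp_of_real[symmetric])
  ultimately have "b = 1/2" by (intro tendsto_unique[of "at_right (0::real)"]) auto
  moreover have "C * t \<le> max 1 C * t" if "t > 0" for t using that by auto
  ultimately show ?thesis using C that[of "max 1 C"] by (meson order.trans less_max_iff_disj zero_less_one)
qed

section \<open>The Hurwitz series as a Mellin integral\<close>

lemma Gamma_mellin_real_value:
  assumes "s > 0" "a > (0::real)"
  shows "pos_integral (\<lambda>t. t powr (s - 1) * exp (- (a * t))) = Gamma s * a powr (- s)"
proof -
  have "complex_of_real (pos_integral (\<lambda>t. t powr (s - 1) * exp (- (a * t)))) =
        pos_integral (\<lambda>t. of_real (t powr (s - 1) * exp (- (a * t))))"
    by (rule integral_complex_of_real[symmetric])
  also have "\<dots> = pos_integral (\<lambda>t. of_real t powr (of_real s - 1) * exp (- of_real (a * t)))"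
    by (rule pos_lborel_cong) (auto simp: powr_of_real[symmetric] simp flip: exp_of_real)
  also have "\<dots> = of_real (Gamma s * a powr (- s))"
    using assms by (subst Gamma_mellin(2)) (auto simp: Gamma_complex_of_real powr_of_real[symmetric])
  finally show ?thesis by (simp only: of_real_eq_iff)
qed

lemma summable_shifted_powr:
  assumes "\<sigma> > 1" "v > (0::real)"
  shows "summable (\<lambda>n. (real n + v) powr (- \<sigma>))"
proof (rule summable_comparison_test_ev)
  show "summable (\<lambda>n. real n powr (- \<sigma>))"
    using assms by (subst summable_real_powr_iff) auto
  show "eventually (\<lambda>n. norm ((real n + v) powr (- \<sigma>)) \<le> real n powr (- \<sigma>)) sequentially"
    using eventually_gt_at_top[of 0] by eventually_elim (use assms in \<open>auto intro!: powr_mono2'\<close>)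
qed

text \<open>The kernel is a geometric series in exp (-t) and can be integrated termwise, since the
  norms integrate to \<open>Gamma (Re s)\<close> times a convergent real series. The entire function
  \<open>rGamma\<close> prepares the continuation to the left.\<close>

lemma hurwitz_series_mellin:
  assumes s: "Re s > 1" and v: "v > 0"
  shows "integrable pos_lborel
           (\<lambda>t. of_real t powr (s - 1) * (exp (- of_real (v * t)) / (1 - exp (- of_real t))))"
    and "(\<lambda>n. (of_nat n + of_real v) powr (- s)) sums
           (rGamma s * pos_integral
             (\<lambda>t. of_real t powr (s - 1) * (exp (- of_real (v * t)) / (1 - exp (- of_real t)))))"
proof -
  define f where "f = (\<lambda>n t. complex_of_real t powr (s - 1) * exp (- of_real ((real n + v) * t)))"
  let ?F = "\<lambda>t. complex_of_real t powr (s - 1) * (exp (- of_real (v * t)) / (1 - exp (- of_real t)))"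
  have nf: "norm (f n t) = t powr (Re s - 1) * exp (- ((real n + v) * t))" if "t > 0" for n t
    using that by (simp add: f_def norm_mult norm_pos_powr)
  have fs: "(\<lambda>n. f n t) sums ?F t" and fs': "summable (\<lambda>n. norm (f n t))" if t: "t > 0" for t
  proof -
    let ?q = "exp (- complex_of_real t)"
    have q: "norm ?q < 1" using t by simp
    have eq: "(\<lambda>n. f n t) = (\<lambda>n. complex_of_real t powr (s - 1) * exp (- of_real (v * t)) * ?q ^ n)"
    proof
      fix n
      have "exp (- complex_of_real ((real n + v) * t)) = exp (- of_real (v * t)) * ?q ^ n"
        unfolding exp_of_nat_mult[symmetric] exp_add[symmetric] by (simp add: algebra_simps)
      thus "f n t = complex_of_real t powr (s - 1) * exp (- of_real (v * t)) * ?q ^ n"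
        by (simp add: f_def)
    qed
    have "(\<lambda>n. complex_of_real t powr (s - 1) * exp (- of_real (v * t)) * ?q ^ n) sums
         (complex_of_real t powr (s - 1) * exp (- of_real (v * t)) * (1 / (1 - ?q)))"
      by (intro sums_mult geometric_sums q)
    thus "(\<lambda>n. f n t) sums ?F t" unfolding eq by simp
    show "summable (\<lambda>n. norm (f n t))"
      unfolding fun_cong[OF eq] norm_mult norm_power by (intro summable_mult summable_geometric) (use q in auto)
  qed
  have i: "integrable pos_lborel (f n)" for n
    unfolding f_def using Gamma_mellin(1)[of s "real n + v"] s v by auto
  have v1: "pos_integral (f n) = Gamma s * (of_nat n + of_real v) powr (- s)" for n
    unfolding f_def using Gamma_mellin(2)[of s "real n + v"] s v by auto
  have v2: "pos_integral (\<lambda>t. norm (f n t)) = Gamma (Re s) * (real n + v) powr (- Re s)" for n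
    using Gamma_mellin_real_value[of "Re s" "real n + v"] s v by (subst pos_lborel_cong(2)[OF nf]) auto
  have AE: "AE t in pos_lborel. summable (\<lambda>n. norm (f n t))"
    by (rule AE_I2) (auto simp: space_restrict_space fs')
  have sm: "summable (\<lambda>n. pos_integral (\<lambda>t. norm (f n t)))"
    unfolding v2 by (intro summable_mult summable_shifted_powr s v)
  have "integrable pos_lborel (\<lambda>t. \<Sum>n. f n t)"
    by (rule integrable_suminf[OF i AE sm])
  also have "?this \<longleftrightarrow> integrable pos_lborel ?F"
    by (rule pos_lborel_cong) (use fs sums_iff in blast)
  finally show "integrable pos_lborel ?F" .
  have "(\<lambda>n. pos_integral (f n)) sums pos_integral (\<lambda>t. \<Sum>n. f n t)"
    by (rule sums_integral[OF i AE sm])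
  also have "pos_integral (\<lambda>t. \<Sum>n. f n t) = pos_integral ?F"
    by (rule pos_lborel_cong) (use fs sums_iff in blast)
  finally have "(\<lambda>n. rGamma s * pos_integral (f n)) sums (rGamma s * pos_integral ?F)"
    by (rule sums_mult)
  moreover have "s \<notin> \<int>\<^sub>\<le>\<^sub>0" using s by (auto elim!: nonpos_Ints_cases)
  hence "rGamma s * (Gamma s * x) = x" for x
    by (simp add: rGamma_inverse_Gamma Gamma_eq_zero_iff)
  ultimately show "(\<lambda>n. (of_nat n + of_real v) powr (- s)) sums (rGamma s * pos_integral ?F)"
    by (simp only: v1)
qed

section \<open>Analytic continuation of the Hurwitz zeta function\<close>

lemma Re_gt_not_nonpos_Int: "Re s > 0 \<Longrightarrow> s \<notin> \<int>\<^sub>\<le>\<^sub>0"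
  by (auto elim!: nonpos_Ints_cases)

lemma holomorphic_pochhammer [holomorphic_intros]:
  "f holomorphic_on A \<Longrightarrow> (\<lambda>s::complex. pochhammer (f s) n) holomorphic_on A"
  by (induction n) (auto simp: pochhammer_Suc intro!: holomorphic_intros)

text \<open>
  Subtracting a Taylor polynomial of the kernel from the Mellin integral for \<open>(s - 1) * \<zeta>(s,v)\<close>
  extends the half-plane of convergence to \<open>Re s > - N\<close>.
\<close>
definition hurwitz_strip :: "nat \<Rightarrow> (nat \<Rightarrow> complex) \<Rightarrow> real \<Rightarrow> complex \<Rightarrow> complex" where
  "hurwitz_strip N b v s =
     of_real v powr (1 - s) + (s - 1) *
       ((\<Sum>j<N. b j * pochhammer s j * of_real v powr (- s - of_nat j)) +
        rGamma s * pos_integral (\<lambda>t. of_real t powr (s - 1) *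
          (exp (- of_real (v * t)) * (binet_kernel (of_real t) - (\<Sum>j<N. b j * of_real t ^ j)))))"

text \<open>The powers split off from the kernel integrate to Gamma (s - 1) and Gamma (s + j); times
  \<open>rGamma s\<close> these become 1 / (s - 1) and \<open>pochhammer s j\<close>, which make
  sense everywhere once the factor s - 1 cancels the pole. The remainder is O(t ^ N) with
  exponential decay.\<close>

lemma hurwitz_strip:
  assumes v: "v > 0"
    and b: "\<And>t. t > 0 \<Longrightarrow> norm (binet_kernel (of_real t) - (\<Sum>j<N. b j * of_real t ^ j)) \<le> C * t ^ N"
  shows "\<And>s. Re s > - real N \<Longrightarrow> integrable pos_lborel (\<lambda>t. of_real t powr (s - 1) *
          (exp (- of_real (v * t)) * (binet_kernel (of_real t) - (\<Sum>j<N. b j * of_real t ^ j))))"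
    and "hurwitz_strip N b v holomorphic_on {s. Re s > - real N}"
    and "\<And>s. Re s > 1 \<Longrightarrow>
           hurwitz_strip N b v s = (s - 1) * (\<Sum>n. (of_nat n + of_real v) powr (- s))"
proof -
  define g where "g = (\<lambda>t. exp (- complex_of_real (v * t)) *
                    (binet_kernel (of_real t) - (\<Sum>j<N. b j * of_real t ^ j)))"
  have c: "continuous_on {0<..} g" unfolding g_def
    by (intro continuous_intros continuous_on_binet_kernel)
  have gb: "norm (g t) \<le> C * t powr real N * exp (- (v * t))" if "t > 0" for t
    using mult_right_mono[OF b[OF that], of "exp (- (v * t))"] that
    by (simp add: g_def norm_mult powr_realpow mult_ac)
  note mellin = holomorphic_on_mellin[OF c v gb]
  show int: "integrable pos_lborel (\<lambda>t. of_real t powr (s - 1) * 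
          (exp (- of_real (v * t)) * (binet_kernel (of_real t) - (\<Sum>j<N. b j * of_real t ^ j))))"
    if "Re s > - real N" for s
    using mellin(1)[of s] that by (simp add: g_def)
  show "hurwitz_strip N b v holomorphic_on {s. Re s > - real N}"
    unfolding hurwitz_strip_def using mellin(2) v
    by (intro holomorphic_intros) (auto simp: g_def)
  fix s assume s: "Re s > 1"
  let ?F = "\<lambda>t. complex_of_real t powr (s - 1) * (exp (- of_real (v * t)) / (1 - exp (- of_real t)))"
  define h where "h = (\<lambda>j t. complex_of_real t powr (s + of_nat j - 1) * exp (- of_real (v * t)))"
  define h' where "h' = (\<lambda>t. complex_of_real t powr (s - 1 - 1) * exp (- of_real (v * t)))"
  have i1: "integrable pos_lborel (h j)" "pos_integral (h j) = Gamma (s + of_nat j) * of_real v powr (- s - of_nat j)" for j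
    using Gamma_mellin[of "s + of_nat j" v] s v by (auto simp: h_def)
  have i2: "integrable pos_lborel h'" "pos_integral h' = Gamma (s - 1) * of_real v powr (1 - s)"
    using Gamma_mellin[of "s - 1" v] s v by (auto simp: h'_def)
  have i3: "integrable pos_lborel (\<lambda>t. complex_of_real t powr (s - 1) * g t)"
    using mellin(1)[of s] s by simp
  have "?F t = h' t + (\<Sum>j<N. b j * h j t) + complex_of_real t powr (s - 1) * g t" if t: "t > 0" for t
  proof -
    have h: "h j t = complex_of_real t powr (s - 1) * (exp (- of_real (v * t)) * of_real t ^ j)" for j
      using t powr_add[of "complex_of_real t" "s - 1" "of_nat j"] 
      by (simp add: h_def algebra_simps powr_nat)
    have h': "h' t = complex_of_real t powr (s - 1) * (exp (- of_real (v * t)) * (1 / of_real t))"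
      using t powr_diff[of "complex_of_real t" "s - 1" 1] by (simp add: h'_def)
    have "1 / (1 - exp (- complex_of_real t)) = binet_kernel (of_real t) + 1 / of_real t"
      by (simp add: binet_kernel_def)
    hence "?F t = complex_of_real t powr (s - 1) * (exp (- of_real (v * t)) * (binet_kernel (of_real t) + 1 / of_real t))"
      by (metis mult.right_neutral times_divide_eq_right)
    also have "\<dots> = h' t + (\<Sum>j<N. b j * h j t) + complex_of_real t powr (s - 1) * g t"
      unfolding h h' g_def by (simp add: ring_distribs sum_distrib_left mult_ac)
    finally show ?thesis .
  qed
  hence "pos_integral ?F = pos_integral
           (\<lambda>t. h' t + (\<Sum>j<N. b j * h j t) + complex_of_real t powr (s - 1) * g t)"
    by (rule pos_lborel_cong)
  also have "\<dots> = Gamma (s - 1) * of_real v powr (1 - s) +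
       (\<Sum>j<N. b j * (Gamma (s + of_nat j) * of_real v powr (- s - of_nat j))) +
       pos_integral (\<lambda>t. complex_of_real t powr (s - 1) * g t)"
    using i1 i2 i3 by (subst Bochner_Integration.integral_add Bochner_Integration.integral_sum;
        (intro Bochner_Integration.integrable_add Bochner_Integration.integrable_sum)?; simp)+
  finally have F: "rGamma s * pos_integral ?F = rGamma s * Gamma (s - 1) * of_real v powr (1 - s) +
       (\<Sum>j<N. b j * (rGamma s * Gamma (s + of_nat j) * of_real v powr (- s - of_nat j))) +
       rGamma s * pos_integral (\<lambda>t. complex_of_real t powr (s - 1) * g t)"
    by (simp add: algebra_simps sum_distrib_left)
  have nz: "s \<notin> \<int>\<^sub>\<le>\<^sub>0" "s - 1 \<notin> \<int>\<^sub>\<le>\<^sub>0" using s by (simp_all add: Re_gt_not_nonpos_Int)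
  have "rGamma s * Gamma (s + of_nat j) = pochhammer s j" for j
    using pochhammer_Gamma[OF nz(1), of j] by (simp add: rGamma_inverse_Gamma field_simps)
  moreover have "rGamma s * Gamma (s - 1) = 1 / (s - 1)"
  proof -
    have "Gamma s = (s - 1) * Gamma (s - 1)" using Gamma_plus1[OF nz(2)] by simp
    moreover have "Gamma (s - 1) \<noteq> 0" "s - 1 \<noteq> 0" using nz s by (auto simp: Gamma_eq_zero_iff)
    ultimately show ?thesis unfolding rGamma_inverse_Gamma by (simp only: divide_simps) simp
  qed
  ultimately have "(s - 1) * (\<Sum>n. (of_nat n + of_real v) powr (- s)) =
      (s - 1) * (1 / (s - 1) * of_real v powr (1 - s) +
       (\<Sum>j<N. b j * (pochhammer s j * of_real v powr (- s - of_nat j))) +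
       rGamma s * pos_integral (\<lambda>t. complex_of_real t powr (s - 1) * g t))"
    using hurwitz_series_mellin(2)[OF s v] F by (simp add: sums_iff)
  also have "\<dots> = hurwitz_strip N b v s"
  proof -
    have "(s - 1) * (1 / (s - 1) * X + Y + Z) = X + (s - 1) * (Y + Z)" for X Y Z
      using s by (auto simp: distrib_left)
    thus ?thesis by (simp only: hurwitz_strip_def g_def mult.assoc)
  qed
  finally show "hurwitz_strip N b v s = (s - 1) * (\<Sum>n. (of_nat n + of_real v) powr (- s))" ..
qed

lemma identity_Re_gt:
  assumes "f holomorphic_on {s. Re s > c}" "g holomorphic_on {s. Re s > c}" "c \<le> 1"
    and "\<And>s. Re s > 1 \<Longrightarrow> f s = g s" "Re z > c"
  shows "f z = g z"
proof (rule analytic_continuation_open[where f = f and g = g and s = "{s. Re s > 1}" and s' = "{s. Re s > c}"])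
  show "{s. Re s > 1} \<noteq> {}" by (auto intro!: exI[of _ 2])
  show "connected {s. Re s > c}" by (rule convex_connected[OF convex_halfspace_Re_gt])
qed (use assms in \<open>auto simp: open_halfspace_Re_gt\<close>)

lemma identity_UNIV_Re_gt:
  assumes "f holomorphic_on UNIV" "g holomorphic_on UNIV" "\<And>s. Re s > 1 \<Longrightarrow> f s = g s"
  shows "f z = g z"
proof (rule analytic_continuation_open[where f = f and g = g and s = "{s. Re s > 1}" and s' = UNIV])
  show "{s. Re s > 1} \<noteq> {}" by (auto intro!: exI[of _ 2])
qed (use assms in \<open>auto simp: open_halfspace_Re_gt\<close>)

text \<open>The continuations for different N agree with the series on Re s > 1, hence with each
  other wherever both exist, so they glue.\<close>

lemma ex_hurwitz_entire:
  assumes v: "v > 0"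
  shows "\<exists>E. E holomorphic_on UNIV \<and>
             (\<forall>s. Re s > 1 \<longrightarrow> E s = (s - 1) * (\<Sum>n. (of_nat n + complex_of_real v) powr (- s)))"
proof -
  have "\<forall>N. \<exists>b. hurwitz_strip N b v holomorphic_on {s. Re s > - real N} \<and>
     (\<forall>s. Re s > 1 \<longrightarrow> hurwitz_strip N b v s = (s - 1) * (\<Sum>n. (of_nat n + of_real v) powr (- s)))"
  proof
    fix N
    obtain b C where "\<And>t. t > 0 \<Longrightarrow> norm (binet_kernel (of_real t) - (\<Sum>j<N. b j * of_real t ^ j)) \<le> C * t ^ N"
      using binet_kernel_taylor by blast
    from hurwitz_strip(2,3)[OF v this]
    show "\<exists>b. hurwitz_strip N b v holomorphic_on {s. Re s > - real N} \<and>
      (\<forall>s. Re s > 1 \<longrightarrow> hurwitz_strip N b v s = (s - 1) * (\<Sum>n. (of_nat n + of_real v) powr (- s)))"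
      by blast
  qed
  then obtain b where b: "\<And>N. hurwitz_strip N (b N) v holomorphic_on {s. Re s > - real N}"
    "\<And>N s. Re s > 1 \<Longrightarrow> hurwitz_strip N (b N) v s = (s - 1) * (\<Sum>n. (of_nat n + of_real v) powr (- s))"
    by metis
  define F where "F = (\<lambda>N. hurwitz_strip N (b N) v)"
  \<comment> \<open>An index whose half-plane contains s and which grows by at most 1 on a unit
    ball, so that on \<open>ball z 1\<close> the single function \<open>F (k z + 1)\<close>
    represents \<open>E\<close>.\<close>
  define k where "k = (\<lambda>s. nat \<lceil>\<bar>Re s\<bar>\<rceil> + 1)"
  define E where "E = (\<lambda>s. F (k s) s)"
  have k: "Re s > - real (k s)" for s unfolding k_def by linarith
  have eq: "E s = F M s" if "k s \<le> M" for M s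
  proof -
    have "F (k s) s = F M s"
    proof (rule identity_Re_gt[of "F (k s)" "- real (k s)" "F M" s])
      show "F M holomorphic_on {z. - real (k s) < Re z}"
        unfolding F_def by (rule holomorphic_on_subset[OF b(1)]) (use that in auto)
    qed (use b k in \<open>auto simp: F_def\<close>)
    thus ?thesis by (simp add: E_def)
  qed
  have "E holomorphic_on UNIV"
  proof -
    have "E holomorphic_on ball z 1" for z
    proof -
      have "E w = F (k z + 1) w" if "w \<in> ball z 1" for w
      proof (rule eq)
        have "\<bar>Re w - Re z\<bar> < 1" using that abs_Re_le_cmod[of "w - z"]
          by (auto simp: dist_norm norm_minus_commute)
        thus "k w \<le> k z + 1" unfolding k_def by linarith
      qed
      moreover have "F (k z + 1) holomorphic_on ball z 1"
        unfolding F_def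
      proof (rule holomorphic_on_subset[OF b(1)], safe)
        fix w assume "w \<in> ball z 1"
        hence "\<bar>Re w - Re z\<bar> < 1" using abs_Re_le_cmod[of "w - z"]
          by (auto simp: dist_norm norm_minus_commute)
        thus "Re w > - real (k z + 1)" using k[of z] by simp
      qed
      ultimately show "E holomorphic_on ball z 1" using holomorphic_transform by metis
    qed
    hence "E holomorphic_on (\<Union>z. ball z 1)" by (rule holomorphic_on_UN_open) auto
    moreover have "(\<Union>z::complex. ball z 1) = UNIV" by (auto intro: centre_in_ball[THEN iffD2, OF zero_less_one])
    ultimately show ?thesis by simp
  qed
  moreover have "E s = (s - 1) * (\<Sum>n. (of_nat n + of_real v) powr (- s))" if "Re s > 1" for s
    unfolding E_def F_def using b(2) that by blast
  ultimately show ?thesis by blast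
qed

text \<open>This is (s - 1) * zeta(s, v) with the pole at 1 cancelled; the identity theorem makes
  the choice by \<open>SOME\<close> unique. Identities between such entire functions need checking
  on Re s > 1 only.\<close>

definition hurwitz_entire :: "real \<Rightarrow> complex \<Rightarrow> complex" where
  "hurwitz_entire v = (SOME E. E holomorphic_on UNIV \<and>
     (\<forall>s. Re s > 1 \<longrightarrow> E s = (s - 1) * (\<Sum>n. (of_nat n + complex_of_real v) powr (- s))))"

lemma
  assumes "v > 0"
  shows holomorphic_hurwitz_entire_UNIV: "hurwitz_entire v holomorphic_on UNIV"
    and hurwitz_entire_Re_gt_1:
      "Re s > 1 \<Longrightarrow> hurwitz_entire v s = (s - 1) * (\<Sum>n. (of_nat n + of_real v) powr (- s))"
  using someI_ex[OF ex_hurwitz_entire[OF assms]] unfolding hurwitz_entire_def[symmetric] by auto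

lemma holomorphic_hurwitz_entire [holomorphic_intros]:
  assumes "f holomorphic_on A" "v > 0"
  shows "(\<lambda>s. hurwitz_entire v (f s)) holomorphic_on A"
  using holomorphic_on_compose_gen[OF assms(1) holomorphic_hurwitz_entire_UNIV[OF assms(2)]]
  by (auto simp: o_def)

text \<open>The remainder integral for N = 1: the strip Re s > -1 already contains both points of
  interest, s = 0 and s = 1.\<close>

definition binet_integral :: "real \<Rightarrow> complex \<Rightarrow> complex" where
  "binet_integral v s = pos_integral (\<lambda>t. of_real t powr (s - 1) *
          (exp (- of_real (v * t)) * (binet_kernel (of_real t) - 1 / 2)))"

lemma
  assumes v: "v > 0"
  shows integrable_binet: "Re s > - 1 \<Longrightarrow> integrable pos_lborel (\<lambda>t. of_real t powr (s - 1) *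
          (exp (- of_real (v * t)) * (binet_kernel (of_real t) - 1 / 2)))"
    and hurwitz_entire_binet: "Re s > - 1 \<Longrightarrow> hurwitz_entire v s = of_real v powr (1 - s) +
           (s - 1) * (of_real v powr (- s) / 2 + rGamma s * binet_integral v s)"
    and holomorphic_binet_integral: "binet_integral v holomorphic_on {s. Re s > - 1}"
proof -
  obtain C where "\<And>t. t > 0 \<Longrightarrow> norm (binet_kernel (of_real t) - 1 / 2) \<le> C * t"
    using binet_kernel_bound by metis
  hence C: "\<And>t. t > 0 \<Longrightarrow> norm (binet_kernel (of_real t) - (\<Sum>j<1. (1/2) * of_real t ^ j)) \<le> C * t ^ 1"
    by simp
  note strip = hurwitz_strip[OF v, where N = 1 and b = "\<lambda>_. 1/2", OF C]
  show "integrable pos_lborel (\<lambda>t. of_real t powr (s - 1) *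
          (exp (- of_real (v * t)) * (binet_kernel (of_real t) - 1 / 2)))" if "Re s > -1"
    using strip(1)[of s] that by simp
  have "hurwitz_entire v s = hurwitz_strip 1 (\<lambda>_. 1/2) v s" if "Re s > -1"
    by (rule identity_Re_gt[of _ "-1"])
       (use strip v that in \<open>auto intro!: holomorphic_intros simp: hurwitz_entire_Re_gt_1\<close>)
  thus "hurwitz_entire v s = of_real v powr (1 - s) +
           (s - 1) * (of_real v powr (- s) / 2 + rGamma s * binet_integral v s)" if "Re s > -1"
    using that by (simp add: hurwitz_strip_def binet_integral_def)
  have c: "continuous_on {0<..} (\<lambda>t. exp (- complex_of_real (v * t)) * (binet_kernel (of_real t) - 1 / 2))"
    by (intro continuous_intros continuous_on_binet_kernel)
  have gb: "norm (exp (- complex_of_real (v * t)) * (binet_kernel (of_real t) - 1 / 2))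
      \<le> C * t powr 1 * exp (- (v * t))" if "t > 0" for t
    using mult_right_mono[OF C[OF that], of "exp (- (v * t))"] that
    by (simp add: norm_mult powr_realpow mult_ac)
  show "binet_integral v holomorphic_on {s. Re s > - 1}"
    unfolding binet_integral_def by (rule holomorphic_on_mellin(2)[OF c v gb])
qed

lemma has_field_derivative_pos_powr [derivative_intros]:
  assumes "v > 0" "(f has_field_derivative f') (at s within A)"
  shows "((\<lambda>s. complex_of_real v powr f s) has_field_derivative
          (of_real (ln v) * f' * of_real v powr f s)) (at s within A)"
proof -
  have "((\<lambda>s. exp (f s * of_real (ln v))) has_field_derivative
          (of_real (ln v) * f' * exp (f s * of_real (ln v)))) (at s within A)"
    by (rule derivative_eq_intros assms refl | simp)+
  thus ?thesis using assms(1) by (simp add: powr_def Ln_of_real)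
qed

lemma hurwitz_entire_1 [simp]: "v > 0 \<Longrightarrow> hurwitz_entire v 1 = 1"
  by (subst hurwitz_entire_binet) auto

section \<open>Uniqueness of the continuation and the link to \<open>hurwitz_zeta\<close>\<close>

lemma remove_sings_nicely_meromorphic_eq:
  assumes "f nicely_meromorphic_on A" "z \<in> A"
  shows "remove_sings f z = f z"
  using assms by (auto simp: nicely_meromorphic_on_def)

text \<open>Agreement on an open set makes the meromorphic difference vanish off a sparse set. The
  remaining values agree too, since each is a value of \<open>remove_sings\<close> and thus depends
  only on a punctured neighbourhood.\<close>

lemma nicely_meromorphic_on_eqI:
  assumes f: "f nicely_meromorphic_on UNIV" and g: "g nicely_meromorphic_on UNIV"
    and U: "open U" "w0 \<in> U" "\<And>z. z \<in> U \<Longrightarrow> f z = g z"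
  shows "f = g"
proof
  fix z
  have "(\<lambda>z. f z - g z) meromorphic_on UNIV"
    using f g by (auto simp: nicely_meromorphic_on_def intro!: meromorphic_intros)
  hence "eventually (\<lambda>z. f z - g z = 0) (cosparse UNIV) \<or> eventually (\<lambda>z. f z - g z \<noteq> 0) (cosparse UNIV)"
    by (rule meromorphic_imp_constant_or_avoid) auto
  moreover have "\<not> eventually (\<lambda>z. f z - g z \<noteq> 0) (cosparse UNIV)"
  proof
    assume "eventually (\<lambda>z. f z - g z \<noteq> 0) (cosparse UNIV)"
    hence "eventually (\<lambda>z. f z - g z \<noteq> 0) (at w0)"
      by (rule eventually_cosparse_imp_eventually_at) auto
    moreover have "eventually (\<lambda>z. z \<in> U) (at w0)"
      using U by (intro eventually_at_in_open') auto
    ultimately have "eventually (\<lambda>z. False) (at w0)"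
      by eventually_elim (use U in auto)
    thus False by simp
  qed
  ultimately have "eventually (\<lambda>z. f z - g z = 0) (cosparse UNIV)" by blast
  hence "eventually (\<lambda>w. f w - g w = 0) (at z)"
    by (rule eventually_cosparse_imp_eventually_at) auto
  hence "eventually (\<lambda>w. f w = g w) (at z)" by simp
  hence "remove_sings f z = remove_sings g z" by (rule remove_sings_cong) auto
  thus "f z = g z"
    using f g by (simp add: remove_sings_nicely_meromorphic_eq)
qed

text \<open>Valid even at s = 1: division by zero gives 0 there, exactly the value that
  \<open>nicely_meromorphic_on\<close> prescribes at a pole, so the quotient meets the description
  behind \<open>THE\<close>.\<close>

lemma hurwitz_zeta_conv_entire:
  assumes v: "v > 0"
  shows "hurwitz_zeta s (of_real v) = hurwitz_entire v s / (s - 1)"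
proof -
  define f where "f = (\<lambda>s. hurwitz_entire v s / (s - 1))"
  have f: "f nicely_meromorphic_on UNIV"
  proof (rule nicely_meromorphic_onI_open[where pts = "{1}"])
    have h: "f holomorphic_on UNIV - {1}" unfolding f_def
      using v by (auto intro!: holomorphic_intros)
    thus a: "f analytic_on UNIV - {1}" by (subst analytic_on_open) auto
    show "is_pole f z \<and> f z = 0" if "z \<in> {1}" for z
    proof -
      have "(hurwitz_entire v) \<midarrow>1\<rightarrow> hurwitz_entire v 1"
        using holomorphic_on_imp_continuous_on[OF holomorphic_hurwitz_entire_UNIV[OF v]]
        by (simp add: continuous_on_eq_continuous_at isCont_def)
      hence "filterlim f at_infinity (at 1)"
        unfolding f_def using v
        by (intro filterlim_divide_at_infinity) (auto intro!: filterlim_atI tendsto_eq_intros simp: eventually_at_filter)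
      thus ?thesis using that by (simp add: is_pole_def f_def)
    qed
    show "isolated_singularity_at f z" for z
      unfolding isolated_singularity_at_def
    proof (cases "z = 1")
      case True
      thus "\<exists>r>0. f analytic_on ball z r - {z}"
        using a by (intro exI[of _ 1]) (auto intro: analytic_on_subset)
    next
      case False
      have "f analytic_on ball z (dist z 1) - {z}"
        by (rule analytic_on_subset[OF a]) auto
      thus "\<exists>r>0. f analytic_on ball z r - {z}" using False by (intro exI[of _ "dist z 1"]) auto
    qed
  qed auto
  have fs: "f z = (\<Sum>n. (of_nat n + of_real v) powr (- z))" if "Re z > 1" for z
  proof -
    have "z \<noteq> 1" using that by auto
    thus ?thesis using hurwitz_entire_Re_gt_1[OF v that] by (simp add: f_def)
  qed
  have "(THE f. f nicely_meromorphic_on UNIV \<and>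
             (\<forall>z. Re z > 1 \<longrightarrow> f z = (\<Sum>n. (of_nat n + complex_of_real v) powr (- z)))) = f"
  proof (rule the_equality)
    fix g assume g: "g nicely_meromorphic_on UNIV \<and>
             (\<forall>z. Re z > 1 \<longrightarrow> g z = (\<Sum>n. (of_nat n + complex_of_real v) powr (- z)))"
    show "g = f"
      by (rule nicely_meromorphic_on_eqI[where U = "{z. Re z > 1}" and ?w0.0 = 2])
         (use g f fs in \<open>auto simp: open_halfspace_Re_gt\<close>)
  qed (use f fs in auto)
  thus ?thesis by (simp add: hurwitz_zeta_def f_def)
qed

section \<open>Difference equation, multiplication formula and the derivative at s = 1\<close>

lemma summable_hurwitz:
  assumes "Re s > 1" "v > 0"
  shows "summable (\<lambda>n. (of_nat n + complex_of_real v) powr (- s))"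
  using hurwitz_series_mellin(2)[OF assms] by (rule sums_summable)

lemma hurwitz_entire_plus_1:
  assumes v: "v > 0"
  shows "hurwitz_entire v s = (s - 1) * of_real v powr (- s) + hurwitz_entire (v + 1) s"
proof (rule identity_UNIV_Re_gt[where z = s])
  fix s :: complex assume s: "Re s > 1"
  have "(\<Sum>n. (of_nat (Suc n) + complex_of_real v) powr (- s)) =
        (\<Sum>n. (of_nat n + complex_of_real v) powr (- s)) - (of_nat 0 + complex_of_real v) powr (- s)"
    by (rule suminf_split_head[OF summable_hurwitz[OF s v]])
  thus "hurwitz_entire v s = (s - 1) * of_real v powr (- s) + hurwitz_entire (v + 1) s"
    using v s by (simp add: hurwitz_entire_Re_gt_1 add_ac distrib_left flip: distrib_left)
qed (use v in \<open>auto intro!: holomorphic_intros\<close>)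

text \<open>The Riemann zeta series is grouped into blocks of length m through j + 1 = m * (n + k /
  m) with k from 1 to m; the upper end k = m is the argument 1.\<close>

lemma sum_hurwitz_entire:
  assumes m: "m > 0"
  shows "(\<Sum>k=1..m. hurwitz_entire (real k / real m) s) = of_nat m powr s * hurwitz_entire 1 s"
proof (rule identity_UNIV_Re_gt[where z = s])
  fix s :: complex assume s: "Re s > 1"
  define f where "f = (\<lambda>j. complex_of_real (real j + 1) powr (- s))"
  have "f sums (\<Sum>j. f j)"
    using summable_hurwitz[OF s, of 1] unfolding f_def by (intro summable_sums) simp
  hence 1: "(\<lambda>n. sum f {n*m..<n*m+m}) sums (\<Sum>j. f j)" using m by (rule sums_group)
  have "sum f {n*m..<n*m+m} = of_nat m powr (- s) * (\<Sum>k=1..m. (of_nat n + complex_of_real (real k / real m)) powr (- s))" for n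
  proof -
    have "sum f {n*m..<n*m+m} = (\<Sum>k=1..m. f (n*m+k-1))"
      by (rule sum.reindex_bij_witness[of _ "\<lambda>k. n*m+k-1" "\<lambda>j. j + 1 - n*m"]) auto
    also have "\<dots> = (\<Sum>k=1..m. of_nat m powr (- s) * (of_nat n + complex_of_real (real k / real m)) powr (- s))"
    proof (rule sum.cong[OF refl])
      fix k assume k: "k \<in> {1..m}"
      have "real (n*m+k-1) + 1 = real m * (real n + real k / real m)"
        using k m by (simp add: of_nat_diff field_simps)
      hence "f (n*m+k-1) = complex_of_real (real m * (real n + real k / real m)) powr (- s)"
        by (simp only: f_def)
      also have "\<dots> = of_real (real m) powr (- s) * of_real (real n + real k / real m) powr (- s)"
        using m k by (intro powr_mult_pos_real) (auto intro!: add_nonneg_pos)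
      finally show "f (n*m+k-1) = of_nat m powr (- s) * (of_nat n + complex_of_real (real k / real m)) powr (- s)"
        by simp
    qed
    finally show ?thesis by (simp only: sum_distrib_left)
  qed
  with 1 have 2: "(\<lambda>n. of_nat m powr (- s) * (\<Sum>k=1..m. (of_nat n + complex_of_real (real k / real m)) powr (- s)))
       sums (\<Sum>j. f j)" by simp
  have 3: "(\<lambda>n. of_nat m powr (- s) * (\<Sum>k=1..m. (of_nat n + complex_of_real (real k / real m)) powr (- s)))
       sums (of_nat m powr (- s) * (\<Sum>k=1..m. \<Sum>n. (of_nat n + complex_of_real (real k / real m)) powr (- s)))"
    by (intro sums_mult sums_sum summable_sums summable_hurwitz s) (use m in auto)
  have "(\<Sum>k=1..m. hurwitz_entire (real k / real m) s) =
        (s - 1) * (\<Sum>k=1..m. \<Sum>n. (of_nat n + complex_of_real (real k / real m)) powr (- s))"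
    unfolding sum_distrib_left by (intro sum.cong refl hurwitz_entire_Re_gt_1) (use s m in auto)
  also have "\<dots> = of_nat m powr s * ((s - 1) * (of_nat m powr (- s) * (\<Sum>k=1..m. \<Sum>n. (of_nat n + complex_of_real (real k / real m)) powr (- s))))"
    using m by (simp add: powr_minus field_simps)
  also have "of_nat m powr (- s) * (\<Sum>k=1..m. \<Sum>n. (of_nat n + complex_of_real (real k / real m)) powr (- s)) = (\<Sum>j. f j)"
    by (rule sums_unique2[OF 3 2])
  also have "(s - 1) * \<dots> = hurwitz_entire 1 s"
    using hurwitz_entire_Re_gt_1[OF _ s, of 1] by (simp add: f_def)
  finally show "(\<Sum>k=1..m. hurwitz_entire (real k / real m) s) = of_nat m powr s * hurwitz_entire 1 s" .
qed (use m in \<open>auto intro!: holomorphic_intros\<close>)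

text \<open>\<open>C\<close> stems from the kernel alone and is the same for all v and s, so the
  bound may be used as v tends to infinity.\<close>

lemma norm_binet_integral_le:
  obtains C where "C > 0" "\<And>v s. v > 0 \<Longrightarrow> Re s > -1 \<Longrightarrow>
     norm (binet_integral v s) \<le> C * (Gamma (Re s + 1) * v powr (- Re s - 1))"
proof -
  obtain C where C: "C > 0" "\<And>t. t > 0 \<Longrightarrow> norm (binet_kernel (of_real t) - 1 / 2) \<le> C * t"
    using binet_kernel_bound by metis
  have "norm (binet_integral v s) \<le> C * (Gamma (Re s + 1) * v powr (- Re s - 1))"
    if v: "v > 0" and s: "Re s > -1" for v s
  proof -
    have i: "integrable pos_lborel (\<lambda>t. t powr (Re s + 1 - 1) * exp (- (v * t)))"
      using Gamma_mellin_real[of "Re s + 1" v] v s by simp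
    have "norm (binet_integral v s) \<le>
        pos_integral (\<lambda>t. norm (of_real t powr (s - 1) *
          (exp (- of_real (v * t)) * (binet_kernel (of_real t) - 1 / 2))))"
      unfolding binet_integral_def by (rule integral_norm_bound)
    also have "\<dots> \<le> pos_integral (\<lambda>t. C * (t powr (Re s + 1 - 1) * exp (- (v * t))))"
    proof (rule integral_mono)
      show "integrable pos_lborel (\<lambda>t. norm (of_real t powr (s - 1) *
          (exp (- of_real (v * t)) * (binet_kernel (of_real t) - 1 / 2))))"
        by (intro integrable_norm integrable_binet v s)
      fix t assume "t \<in> space pos_lborel"
      hence t: "t > 0" by (simp add: space_restrict_space)
      have "norm (of_real t powr (s - 1) * (exp (- of_real (v * t)) * (binet_kernel (of_real t) - 1 / 2)))
          \<le> t powr (Re s - 1) * (exp (- (v * t)) * (C * t))"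
        unfolding norm_mult using t C(2)[OF t] by (intro mult_mono) (auto simp: norm_pos_powr)
      also have "\<dots> = C * (t powr (Re s + 1 - 1) * exp (- (v * t)))"
        using t by (simp add: powr_diff)
      finally show "norm (of_real t powr (s - 1) * (exp (- of_real (v * t)) * (binet_kernel (of_real t) - 1 / 2)))
          \<le> C * (t powr (Re s + 1 - 1) * exp (- (v * t)))" .
    qed (use i in auto)
    also have "\<dots> = C * (Gamma (Re s + 1) * v powr (- Re s - 1))"
      using Gamma_mellin_real_value[of "Re s + 1" v] v s by simp
    finally show ?thesis .
  qed
  with C(1) show ?thesis using that by blast
qed

text \<open>This decay is the boundary condition at infinity that singles out, among the solutions
  of a difference equation in v, the digamma function at s = 1 and ln Gamma at s = 0.\<close>

lemma binet_integral_tendsto_0: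
  assumes "Re s > -1" "v > 0"
  shows "(\<lambda>n. binet_integral (v + real n) s) \<longlonglongrightarrow> 0"
proof -
  obtain C where C: "\<And>v s. v > 0 \<Longrightarrow> Re s > -1 \<Longrightarrow>
     norm (binet_integral v s) \<le> C * (Gamma (Re s + 1) * v powr (- Re s - 1))"
    using norm_binet_integral_le by metis
  define a where "a = Re s + 1"
  have a: "a > 0" using assms by (simp add: a_def)
  have "(\<lambda>n. C * (Gamma (Re s + 1) * (v + real n) powr (- a))) \<longlonglongrightarrow> 0"
    using a by (intro tendsto_mult_right_zero tendsto_neg_powr filterlim_tendsto_add_at_top[OF tendsto_const filterlim_real_sequentially]) auto
  thus ?thesis
    by (rule Lim_null_comparison[rotated])
       (use C assms in \<open>auto intro!: always_eventually simp: a_def add_pos_nonneg\<close>)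
qed

lemma hurwitz_entire_deriv_1_binet:
  assumes v: "v > 0"
  shows "(hurwitz_entire v has_field_derivative
          of_real (1 / (2 * v) - ln v) + binet_integral v 1) (at 1)"
proof (rule has_field_derivative_transform_within_open[where S = "{s. Re s > -1}"])
  have "(binet_integral v has_field_derivative deriv (binet_integral v) 1) (at 1)"
    by (rule holomorphic_derivI[OF holomorphic_binet_integral[OF v]]) (auto simp: open_halfspace_Re_gt)
  note D = this
  show "((\<lambda>s. of_real v powr (1 - s) +
           (s - 1) * (of_real v powr (- s) / 2 + rGamma s * binet_integral v s)) has_field_derivative
          of_real (1 / (2 * v) - ln v) + binet_integral v 1) (at 1)"
    by (rule derivative_eq_intros D refl v | (use v in \<open>simp add: powr_minus field_simps\<close>))+
qed (use v in \<open>auto simp: hurwitz_entire_binet open_halfspace_Re_gt\<close>)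

text \<open>The derivative P satisfies P v = P (v + 1) + 1 / v. Iterating n times and using that P
  (v + n) + ln n tends to 0 produces the limit formula for the digamma function.\<close>

lemma hurwitz_entire_deriv_1:
  assumes v: "v > 0"
  shows "(hurwitz_entire v has_field_derivative - Digamma (of_real v)) (at 1)"
proof -
  define P where "P = (\<lambda>v. deriv (hurwitz_entire v) 1)"
  have hd: "(hurwitz_entire v has_field_derivative P v) (at 1)" if "v > 0" for v
    unfolding P_def by (rule holomorphic_derivI[OF holomorphic_hurwitz_entire_UNIV[OF that]]) auto
  have P: "P v = of_real (1 / (2 * v) - ln v) + binet_integral v 1" if "v > 0" for v
    using hd[OF that] hurwitz_entire_deriv_1_binet[OF that] by (rule DERIV_unique)
  have rec: "P v = P (v + 1) + inverse (of_real v)" if v: "v > 0" for v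
  proof -
    have "((\<lambda>s. (s - 1) * of_real v powr (- s) + hurwitz_entire (v + 1) s) has_field_derivative
           inverse (of_real v) + P (v + 1)) (at 1)"
      by (rule derivative_eq_intros refl v hd[of "v + 1"] | (use v in \<open>simp add: powr_minus\<close>))+
    hence "(hurwitz_entire v has_field_derivative inverse (of_real v) + P (v + 1)) (at 1)"
      by (simp add: hurwitz_entire_plus_1[OF v, abs_def])
    thus ?thesis using DERIV_unique[OF hd[OF v]] by simp
  qed
  have recn: "P v = P (v + real n) + (\<Sum>k<n. inverse (of_real v + of_nat k))" for n
  proof (induction n)
    case (Suc n)
    thus ?case using rec[of "v + real n"] v by (simp add: add_ac add_pos_nonneg)
  qed auto
  have "(\<lambda>n. ln (real n) - ln (v + real n) + 1 / (2 * (v + real n))) \<longlonglongrightarrow> 0" using v by real_asymp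
  hence "(\<lambda>n. complex_of_real (ln (real n) - ln (v + real n) + 1 / (2 * (v + real n))) + binet_integral (v + real n) 1)
          \<longlonglongrightarrow> of_real 0 + 0"
    using v by (intro tendsto_intros binet_integral_tendsto_0) auto
  also have "(\<lambda>n. complex_of_real (ln (real n) - ln (v + real n) + 1 / (2 * (v + real n))) + binet_integral (v + real n) 1)
       = (\<lambda>n. P v + (of_real (ln (real n)) - (\<Sum>k<n. inverse (of_real v + of_nat k))))"
  proof
    fix n
    have "v + real n > 0" using v by simp
    thus "complex_of_real (ln (real n) - ln (v + real n) + 1 / (2 * (v + real n))) + binet_integral (v + real n) 1
       = P v + (of_real (ln (real n)) - (\<Sum>k<n. inverse (of_real v + of_nat k)))"
      by (subst recn[of n]) (simp add: P)
  qed
  finally have "(\<lambda>n. P v + (of_real (ln (real n)) - (\<Sum>k<n. inverse (of_real v + of_nat k)))) \<longlonglongrightarrow> 0"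
    by simp
  moreover have "(\<lambda>n. P v + (of_real (ln (real n)) - (\<Sum>k<n. inverse (of_real v + of_nat k)))) \<longlonglongrightarrow> P v + Digamma (of_real v)"
    using v by (intro tendsto_intros Digamma_LIMSEQ) auto
  ultimately have "P v + Digamma (of_real v) = 0" by (metis LIMSEQ_unique)
  thus ?thesis using hd[OF v] by (metis add_eq_0_iff2)
qed

section \<open>Lerch's formula\<close>

lemma hurwitz_zeta_binet:
  assumes v: "v > 0" and s: "Re s > -1" "s \<noteq> 1"
  shows "hurwitz_zeta s (of_real v) =
           of_real v powr (1 - s) / (s - 1) + of_real v powr (- s) / 2 + rGamma s * binet_integral v s"
  using s hurwitz_entire_binet[OF v s(1)]
  by (simp add: hurwitz_zeta_conv_entire[OF v] add_divide_distrib)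

lemma hurwitz_zeta_0:
  assumes "v > 0"
  shows "hurwitz_zeta 0 (of_real v) = 1 / 2 - of_real v"
  using assms by (subst hurwitz_zeta_binet) auto

lemma holomorphic_hurwitz_zeta [holomorphic_intros]:
  assumes "f holomorphic_on A" "v > 0" "\<And>x. x \<in> A \<Longrightarrow> f x \<noteq> 1"
  shows "(\<lambda>s. hurwitz_zeta (f s) (of_real v)) holomorphic_on A"
  unfolding hurwitz_zeta_conv_entire[OF assms(2)]
  by (intro holomorphic_intros assms) (use assms(3) in auto)

lemma sum_hurwitz_zeta:
  assumes m: "m > 0"
  shows "(\<Sum>k=1..m. hurwitz_zeta s (of_real (real k / real m))) = of_nat m powr s * hurwitz_zeta s 1"
proof -
  have "(\<Sum>k=1..m. hurwitz_zeta s (of_real (real k / real m))) =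
        (\<Sum>k=1..m. hurwitz_entire (real k / real m) s / (s - 1))"
    by (intro sum.cong refl hurwitz_zeta_conv_entire) (use m in auto)
  also have "\<dots> = of_nat m powr s * hurwitz_zeta s 1"
    using sum_hurwitz_entire[OF m, of s] hurwitz_zeta_conv_entire[of 1 s]
    by (simp flip: sum_divide_distrib)
  finally show ?thesis .
qed

text \<open>\<open>rGamma\<close> vanishes at 0 with derivative 1, so its product with the integral
  contributes just \<open>binet_integral v 0\<close>.\<close>

lemma hurwitz_zeta_deriv_0_binet:
  assumes v: "v > 0"
  shows "((\<lambda>s. hurwitz_zeta s (of_real v)) has_field_derivative
          of_real ((v - 1 / 2) * ln v - v) + binet_integral v 0) (at 0)"
proof (rule has_field_derivative_transform_within_open[where S = "{s. Re s > -1} - {1}"])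
  have D: "(binet_integral v has_field_derivative deriv (binet_integral v) 0) (at 0)"
    by (rule holomorphic_derivI[OF holomorphic_binet_integral[OF v]]) (auto simp: open_halfspace_Re_gt)
  have "(rGamma has_field_derivative (- 1) ^ 0 * fact 0) (at (- of_nat 0 :: complex))"
    by (rule has_field_derivative_rGamma_nonpos_int)
  hence G: "(rGamma has_field_derivative 1) (at (0 :: complex))" by simp
  show "((\<lambda>s. of_real v powr (1 - s) / (s - 1) + of_real v powr (- s) / 2 + rGamma s * binet_integral v s)
          has_field_derivative of_real ((v - 1 / 2) * ln v - v) + binet_integral v 0) (at 0)"
  proof -
    have "((\<lambda>s. rGamma s * binet_integral v s) has_field_derivative binet_integral v 0) (at 0)"
      using DERIV_mult[OF G D] by simp
    moreover have "((\<lambda>s. complex_of_real v powr (1 - s) / (s - 1) + of_real v powr (- s) / 2) has_field_derivative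
            of_real ((v - 1 / 2) * ln v - v)) (at 0)"
      by (rule derivative_eq_intros refl v | (use v in \<open>simp add: field_simps\<close>))+
    ultimately show ?thesis by (rule DERIV_add[rotated])
  qed
  show "open ({s. Re s > -1} - {1})" by (intro open_Diff open_halfspace_Re_gt) auto
qed (use v in \<open>auto simp: hurwitz_zeta_binet\<close>)

lemma hurwitz_zeta_plus_1:
  assumes v: "v > 0" and s: "s \<noteq> 1"
  shows "hurwitz_zeta s (of_real v) = of_real v powr (- s) + hurwitz_zeta s (of_real (v + 1))"
  using s v hurwitz_entire_plus_1[OF v, of s]
  by (simp only: hurwitz_zeta_conv_entire zero_less_one add_pos_pos) (simp add: add_divide_distrib)

text \<open>L v = zeta'(0, v) obeys L (v + 1) = L v + ln v with known behaviour for large v, and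
  comparison with the series of ln Gamma gives L v - L 1. The constant comes from v = 1/2, where the
  multiplication formula for m = 2 and Gamma (1/2) = sqrt pi apply.\<close>

theorem lerch_formula:
  assumes v: "v > 0"
  shows "((\<lambda>s. hurwitz_zeta s (of_real v)) has_field_derivative
          of_real (ln (Gamma v) - ln (2 * pi) / 2)) (at 0)"
proof -
  define L where "L = (\<lambda>v. deriv (\<lambda>s. hurwitz_zeta s (of_real v)) 0)"
  have L: "L v = of_real ((v - 1 / 2) * ln v - v) + binet_integral v 0"
    and hd: "((\<lambda>s. hurwitz_zeta s (of_real v)) has_field_derivative L v) (at 0)" if "v > 0" for v
    using hurwitz_zeta_deriv_0_binet[OF that] by (simp_all add: L_def DERIV_imp_deriv)
  have rec: "L v = L (v + 1) - of_real (ln v)" if v: "v > 0" for v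
  proof -
    have "((\<lambda>s. of_real v powr (- s) + hurwitz_zeta s (of_real (v + 1))) has_field_derivative
           - of_real (ln v) + L (v + 1)) (at 0)"
      by (rule derivative_eq_intros refl v hd[of "v + 1"] | (use v in simp))+
    hence "((\<lambda>s. hurwitz_zeta s (of_real v)) has_field_derivative - of_real (ln v) + L (v + 1)) (at 0)"
      by (rule has_field_derivative_transform_within_open[where S = "-{1}"])
         (auto simp: hurwitz_zeta_plus_1[OF v])
    thus ?thesis using DERIV_unique[OF hd[OF v]] by simp
  qed
  have recn: "L v = L (v + real n) - of_real (\<Sum>k<n. ln (v + real k))" if v: "v > 0" for v n
  proof (induction n)
    case (Suc n)
    thus ?case using rec[of "v + real n"] v by (simp add: add_ac add_pos_nonneg)
  qed auto
  have diff: "L v = L 1 + of_real (ln (Gamma v))" if v: "v > 0" for v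
  proof -
    \<comment> \<open>The elementary parts of \<open>L (v + real (Suc n))\<close> and
      \<open>L (1 + real (Suc n))\<close>, corrected by the terms v * ln n and - ln (n + 1) by which
      \<open>ln_Gamma_series v n\<close> differs from the two sums of logarithms of the
      recursion.\<close>
    define e where "e = (\<lambda>n. (v + real n + 1/2) * ln (v + real n + 1) - (v + real n + 1)
         - ((real n + 3/2) * ln (real n + 2) - (real n + 2)) - v * ln (real n) + ln (real n + 1))"
    have e: "e \<longlonglongrightarrow> 0" unfolding e_def using v by real_asymp
    have B: "(\<lambda>n. binet_integral (w + real (Suc n)) 0) \<longlonglongrightarrow> 0" if "w > 0" for w
      by (rule LIMSEQ_Suc[OF binet_integral_tendsto_0]) (use that in auto)
    have "(\<lambda>n. of_real (ln_Gamma_series v n + e n) + (binet_integral (v + real (Suc n)) 0 - binet_integral (1 + real (Suc n)) 0))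
           \<longlonglongrightarrow> of_real (ln_Gamma v + 0) + (0 - 0)"
      by (intro tendsto_intros e ln_Gamma_real_LIMSEQ B v zero_less_one)
    also have "(\<lambda>n. of_real (ln_Gamma_series v n + e n) + (binet_integral (v + real (Suc n)) 0 - binet_integral (1 + real (Suc n)) 0))
        = (\<lambda>n. L v - L 1)"
    proof
      fix n
      have "(\<Sum>k=1..n. ln (v / real k + 1)) = (\<Sum>k=1..n. ln (v + real k)) - (\<Sum>k=1..n. ln (real k))"
        unfolding sum_subtractf[symmetric]
      proof (rule sum.cong[OF refl])
        fix k assume "k \<in> {1..n}"
        hence "v / real k + 1 = (v + real k) / real k" "v + real k > 0" "real k > 0"
          using v by (auto simp: field_simps)
        thus "ln (v / real k + 1) = ln (v + real k) - ln (real k)" by (simp add: ln_div)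
      qed
      also have "(\<Sum>k=1..n. ln (v + real k)) = (\<Sum>k<Suc n. ln (v + real k)) - ln v"
        by (subst sum.lessThan_Suc_shift) (simp add: sum.atLeast1_atMost_eq)
      also have "(\<Sum>k=1..n. ln (real k)) = (\<Sum>k<Suc n. ln (1 + real k)) - ln (real n + 1)"
        by (simp add: sum.atLeast1_atMost_eq add_ac)
      finally have "ln_Gamma_series v n = v * ln (real n) - (\<Sum>k<Suc n. ln (v + real k)) + (\<Sum>k<Suc n. ln (1 + real k)) - ln (real n + 1)"
        by (simp add: ln_Gamma_series_def)
      hence "complex_of_real (ln_Gamma_series v n + e n) = 
          of_real ((v + real n + 1/2) * ln (v + real n + 1) - (v + real n + 1)
         - ((real n + 3/2) * ln (real n + 2) - (real n + 2))) - of_real (\<Sum>k<Suc n. ln (v + real k)) + of_real (\<Sum>k<Suc n. ln (1 + real k))"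
        by (simp add: e_def)
      thus "of_real (ln_Gamma_series v n + e n) + (binet_integral (v + real (Suc n)) 0 - binet_integral (1 + real (Suc n)) 0) = L v - L 1"
        using v by (subst (1 2) recn[of _ "Suc n"])
          (auto simp: L add_pos_nonneg add_ac algebra_simps simp del: sum.lessThan_Suc of_real_sum)
    qed
    finally have "(\<lambda>n::nat. L v - L 1) \<longlonglongrightarrow> of_real (ln_Gamma v)" by simp
    hence "L v - L 1 = of_real (ln_Gamma v)" by (simp add: LIMSEQ_const_iff)
    thus ?thesis using v by (simp add: ln_Gamma_real_pos algebra_simps)
  qed
  \<comment> \<open>Differentiate zeta(s, 1/2) + zeta(s, 1) = 2^s * zeta(s, 1) at 0:
    \<open>L 1\<close> cancels and zeta(0, 1) = -1/2 remains.\<close>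
  have "L (1/2) = - of_real (ln 2 / 2)"
  proof -
    have "((\<lambda>s. hurwitz_zeta s (of_real (1/2)) + hurwitz_zeta s (of_real 1)) has_field_derivative
           L (1/2) + L 1) (at 0)"
      by (intro derivative_intros hd) auto
    moreover have "((\<lambda>s. of_real 2 powr s * hurwitz_zeta s (of_real 1)) has_field_derivative
           of_real (ln 2) * hurwitz_zeta 0 (of_real 1) + L 1) (at 0)"
      by (rule derivative_eq_intros refl hd[of 1] | simp)+
    moreover have "hurwitz_zeta s (of_real (1/2)) + hurwitz_zeta s (of_real 1) = of_real 2 powr s * hurwitz_zeta s (of_real 1)" for s
      using sum_hurwitz_zeta[of 2 s] by (simp add: numeral_2_eq_2)
    ultimately have "L (1/2) + L 1 = of_real (ln 2) * hurwitz_zeta 0 (of_real 1) + L 1"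
      using DERIV_unique by fastforce
    thus ?thesis by (subst (asm) hurwitz_zeta_0) auto
  qed
  hence "L 1 = - of_real (ln 2 / 2) - of_real (ln (Gamma (1/2)))"
    using diff[of "1/2"] by (simp add: algebra_simps)
  also have "\<dots> = - of_real (ln (2 * pi) / 2)"
    by (simp add: Gamma_one_half_real ln_sqrt ln_mult add_divide_distrib)
  finally have "L v = of_real (ln (Gamma v) - ln (2 * pi) / 2)"
    using diff[OF v] by simp
  thus ?thesis using hd[OF v] by simp
qed

section \<open>Mellin transforms in the strip to the left of the imaginary axis\<close>

lemma absolutely_integrable_pos_iff:
  fixes f :: "real \<Rightarrow> real"
  assumes c: "continuous_on {0<..} f"
  shows "f absolutely_integrable_on {0<..} \<and> integral {0<..} f = b \<longleftrightarrow>
         integrable pos_lborel f \<and> pos_integral f = b"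
proof -
  have m: "(\<lambda>x. indicator {0<..} x *\<^sub>R f x) \<in> borel_measurable lborel"
    using measurable_pos_lborel[OF c]
    by (subst (asm) borel_measurable_restrict_space_iff) auto
  have "f absolutely_integrable_on {0<..} \<longleftrightarrow> integrable pos_lborel f"
    unfolding integrable_pos_lborel_iff set_integrable_def using m
    by (subst integrable_completion) auto
  moreover have "pos_integral f = integral {0<..} f" if "integrable pos_lborel f"
    using that unfolding integrable_pos_lborel_iff integral_pos_lborel
    by (rule set_borel_integral_eq_integral)
  ultimately show ?thesis by auto
qed

text \<open>The substitution w = y / (1 - y) maps (0, 1) onto the positive reals and turns the
  integral into \<open>Beta q (1 - q)\<close>, which the reflection formula for Gamma
  evaluates.\<close>

lemma beta_pos_integral:
  assumes q: "0 < q" "q < (1::real)"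
  shows "integrable pos_lborel (\<lambda>w. w powr (q - 1) / (1 + w))"
    and "pos_integral (\<lambda>w. w powr (q - 1) / (1 + w)) = pi / sin (pi * q)"
proof -
  let ?f = "\<lambda>w::real. w powr (q - 1) / (1 + w)"
  let ?g = "\<lambda>y::real. y / (1 - y)"
  let ?b = "\<lambda>y::real. y powr (q - 1) * (1 - y) powr (1 - q - 1)"
  have im: "?g ` {0<..<1} = {0<..}"
  proof safe
    fix w :: real assume "w > 0"
    thus "w \<in> ?g ` {0<..<1}" by (intro image_eqI[of _ _ "w / (1 + w)"]) (auto simp: field_simps)
  qed auto
  have inj: "inj_on ?g {0<..<1}" by (auto simp: inj_on_def field_simps)
  have der: "(?g has_field_derivative 1 / (1 - y) ^ 2) (at y within {0<..<1})" if "y \<in> {0<..<1}" for y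
    using that by (auto intro!: derivative_eq_intros simp: power2_eq_square)
  have eq: "\<bar>1 / (1 - y) ^ 2\<bar> * ?f (?g y) = ?b y" if "y \<in> {0<..<1}" for y
  proof -
    have y: "y > 0" "1 - y > 0" using that by auto
    have "1 + ?g y = 1 / (1 - y)" using y by (simp add: field_simps)
    moreover have "?g y powr (q - 1) = y powr (q - 1) * ((1 - y) * (1 - y) powr (- q))"
      using y by (simp add: powr_divide powr_diff powr_minus field_simps)
    ultimately show ?thesis using y by (simp add: power2_eq_square)
  qed
  have "(?b has_integral Beta q (1 - q)) {0..1}"
    using q by (intro has_integral_Beta_real) auto
  hence "(?b has_integral Beta q (1 - q)) {0<..<1}"
    by (subst (asm) has_integral_Icc_iff_Ioo) auto
  hence "?b absolutely_integrable_on {0<..<1} \<and> integral {0<..<1} ?b = Beta q (1 - q)"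
    by (auto simp: has_integral_iff intro!: nonnegative_absolutely_integrable_1)
  hence "(\<lambda>y. \<bar>1 / (1 - y) ^ 2\<bar> * ?f (?g y)) absolutely_integrable_on {0<..<1} \<and>
         integral {0<..<1} (\<lambda>y. \<bar>1 / (1 - y) ^ 2\<bar> * ?f (?g y)) = Beta q (1 - q)"
    using eq by (metis (no_types, lifting) integral_cong set_integrable_cong)
  hence "?f absolutely_integrable_on (?g ` {0<..<1}) \<and> integral (?g ` {0<..<1}) ?f = Beta q (1 - q)"
    by (subst (asm) has_absolute_integral_change_of_variables_1') (use der inj in auto)
  hence "integrable pos_lborel ?f \<and> pos_integral ?f = Beta q (1 - q)"
    unfolding im by (subst (asm) absolutely_integrable_pos_iff) (auto intro!: continuous_intros)
  moreover have "Beta q (1 - q) = pi / sin (pi * q)"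
  proof -
    have "complex_of_real (Gamma q * Gamma (1 - q)) = of_real (pi / sin (pi * q))"
      using Gamma_reflection_complex[of "of_real q"] 
        Gamma_complex_of_real[of q] Gamma_complex_of_real[of "1 - q"]
      by (simp add: sin_of_real flip: of_real_mult)
    hence "Gamma q * Gamma (1 - q) = pi / sin (pi * q)" by (simp only: of_real_eq_iff)
    thus ?thesis by (simp add: Beta_def)
  qed
  ultimately show "integrable pos_lborel ?f" "pos_integral ?f = pi / sin (pi * q)" by auto
qed

text \<open>Substitute w = u^2 with q = p / 2. The cases p = s + 1 and p = s + 2 will evaluate the
  Mellin transform of \<open>cauchy_kernel\<close>.\<close>

lemma beta_pos_integral_square:
  assumes p: "0 < p" "p < (2::real)"
  shows "integrable pos_lborel (\<lambda>u. u powr (p - 1) / (1 + u ^ 2))"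
    and "pos_integral (\<lambda>u. u powr (p - 1) / (1 + u ^ 2)) = pi / (2 * sin (pi * p / 2))"
proof -
  let ?f = "\<lambda>w::real. w powr (p / 2 - 1) / (1 + w)"
  let ?g = "\<lambda>u::real. u powr (p - 1) / (1 + u ^ 2)"
  have im: "(\<lambda>u. u ^ 2) ` {0<..} = {0::real<..}"
  proof safe
    fix w :: real assume "w > 0"
    thus "w \<in> (\<lambda>u. u ^ 2) ` {0<..}" by (intro image_eqI[of _ _ "sqrt w"]) auto
  qed auto
  have inj: "inj_on (\<lambda>u::real. u ^ 2) {0<..}" by (auto simp: inj_on_def)
  have der: "((\<lambda>u. u ^ 2) has_field_derivative 2 * u) (at u within {0<..})" for u :: real
    by (auto intro!: derivative_eq_intros)
  have eq: "\<bar>2 * u\<bar> * ?f (u ^ 2) = 2 * ?g u" if "u > 0" for u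
  proof -
    have "(u ^ 2) powr (p / 2 - 1) = u powr (p - 2)"
    proof -
      have "u ^ 2 = u powr 2" using that powr_realpow[of u 2] by simp
      hence "(u ^ 2) powr (p / 2 - 1) = u powr (2 * (p / 2 - 1))" by (simp only: powr_powr)
      also have "2 * (p / 2 - 1) = p - 2" by (simp add: field_simps)
      finally show ?thesis .
    qed
    moreover have "u * u powr (p - 2) = u powr (p - 1)"
      using powr_mult_base[of u "p - 2"] that by simp
    ultimately show ?thesis using that by simp
  qed
  have "?f absolutely_integrable_on {0<..} \<and> integral {0<..} ?f = pi / sin (pi * (p / 2))"
    by (subst absolutely_integrable_pos_iff)
       (use beta_pos_integral[of "p / 2"] p in \<open>auto intro!: continuous_intros\<close>)
  hence "(\<lambda>u. \<bar>2 * u\<bar> * ?f (u ^ 2)) absolutely_integrable_on {0<..} \<and>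
         integral {0<..} (\<lambda>u. \<bar>2 * u\<bar> * ?f (u ^ 2)) = pi / sin (pi * (p / 2))"
    by (subst has_absolute_integral_change_of_variables_1'[OF _ der inj]) (auto simp: im)
  hence "integrable pos_lborel (\<lambda>u. \<bar>2 * u\<bar> * ?f (u ^ 2)) \<and>
         pos_integral (\<lambda>u. \<bar>2 * u\<bar> * ?f (u ^ 2)) = pi / sin (pi * (p / 2))"
  proof (subst (asm) absolutely_integrable_pos_iff)
    show "continuous_on {0<..} (\<lambda>u. \<bar>2 * u\<bar> * ?f (u ^ 2))"
    proof (intro continuous_intros ballI)
      fix x :: real assume "x \<in> {0<..}"
      have "1 + x ^ 2 > 0" by (rule add_pos_nonneg) auto
      thus "1 + x ^ 2 \<noteq> 0" by simp
    qed auto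
  qed
  hence i: "integrable pos_lborel (\<lambda>u. 2 * ?g u)"
    and v: "pos_integral (\<lambda>u. 2 * ?g u) = pi / sin (pi * (p / 2))"
    using pos_lborel_cong[OF eq] by auto
  have "integrable pos_lborel (\<lambda>u. 1 / 2 * (2 * ?g u))"
    by (rule integrable_mult_right) (use i in auto)
  thus "integrable pos_lborel ?g" by simp
  show "pos_integral ?g = pi / (2 * sin (pi * p / 2))"
    using v unfolding integral_mult_right_zero by simp
qed

text \<open>The weight t / (1 + t) expresses O(t) at 0 and O(1) at infinity in one bound, and makes
  the majorant a Beta integrand.\<close>

lemma integrable_mellin_strip:
  fixes f :: "real \<Rightarrow> complex"
  assumes z: "-1 < Re z" "Re z < 0" and c: "continuous_on {0<..} f"
    and b: "\<And>t. t > 0 \<Longrightarrow> norm (f t) \<le> C * (t / (1 + t))"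
  shows "integrable pos_lborel (\<lambda>t. of_real t powr (z - 1) * f t)"
proof (rule pos_lborel_bound)
  show "integrable pos_lborel (\<lambda>t. C * (t powr (Re z + 1 - 1) / (1 + t)))"
    by (rule integrable_mult_right) (use beta_pos_integral(1)[of "Re z + 1"] z in auto)
  fix t :: real assume t: "t > 0"
  have "norm (of_real t powr (z - 1) * f t) \<le> t powr (Re z - 1) * (C * (t / (1 + t)))"
    unfolding norm_mult using t b[OF t] by (intro mult_mono) (auto simp: norm_pos_powr)
  also have "\<dots> = C * (t powr (Re z + 1 - 1) / (1 + t))"
    using t by (simp add: powr_diff)
  also have "\<dots> \<le> norm \<dots>" unfolding real_norm_def by (rule abs_ge_self)
  finally show "norm (of_real t powr (z - 1) * f t) \<le> norm (C * (t powr (Re z + 1 - 1) / (1 + t)))" .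
qed (intro continuous_intros c)

lemma pos_lborel_FTC_0:
  fixes f F :: "real \<Rightarrow> complex"
  assumes F: "\<And>t. t > 0 \<Longrightarrow> (F has_vector_derivative f t) (at t)"
    and c: "continuous_on {0<..} f" and i: "integrable pos_lborel f"
    and "(F \<longlongrightarrow> 0) (at_right 0)" "(F \<longlongrightarrow> 0) at_top"
  shows "pos_integral f = 0"
proof -
  have "(LBINT x=ereal 0..\<infinity>. f x) = 0 - 0"
  proof (rule interval_integral_FTC_integrable)
    show "isCont f x" if "ereal 0 < ereal x" for x
      using c that by (auto simp: continuous_on_eq_continuous_at)
    show "set_integrable lborel (einterval (ereal 0) \<infinity>) f"
      using i by (simp add: integrable_pos_lborel_iff)
    show "((F \<circ> real_of_ereal) \<longlongrightarrow> 0) (at_right (ereal 0))"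
         "((F \<circ> real_of_ereal) \<longlongrightarrow> 0) (at_left \<infinity>)"
      using assms by (simp_all only: ereal_tendsto_simps)
  qed (use F in auto)
  thus ?thesis by (simp add: integral_pos_lborel interval_integral_to_infinity_eq)
qed

text \<open>The boundary term vanishes at both ends because 0 < \<sigma> + 1 < 1. The exponent
  \<open>w\<close> is kept apart from \<sigma>, since it is used both as z and as z - 1 with
  \<sigma> = Re z.\<close>

lemma mellin_by_parts:
  fixes g g' :: "complex \<Rightarrow> complex"
  assumes \<sigma>: "-1 < \<sigma>" "\<sigma> < 0"
    and g: "\<And>s. (g has_field_derivative g' s) (at s)" and g': "continuous_on UNIV g'"
    and b: "\<And>t. t > 0 \<Longrightarrow> norm (of_real t powr w * g (of_real t)) \<le> C * (t powr (\<sigma> + 1) / (1 + t))"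
    and i: "integrable pos_lborel (\<lambda>t. of_real t powr (w - 1) * g (of_real t))"
    and i': "integrable pos_lborel (\<lambda>t. of_real t powr w * g' (of_real t))"
  shows "w * pos_integral (\<lambda>t. of_real t powr (w - 1) * g (of_real t)) =
         - pos_integral (\<lambda>t. of_real t powr w * g' (of_real t))"
proof -
  have cg: "continuous_on UNIV g"
    using g by (meson DERIV_isCont continuous_at_imp_continuous_on)
  have "pos_integral (\<lambda>t. w * (of_real t powr (w - 1) * g (of_real t)) + of_real t powr w * g' (of_real t)) = 0"
  proof (rule pos_lborel_FTC_0[where F = "\<lambda>t. of_real t powr w * g (of_real t)"])
    fix t :: real assume t: "t > 0"
    have "((\<lambda>s. s powr w) has_field_derivative w * of_real t powr (w - 1)) (at (of_real t))"
      using t by (intro has_field_derivative_powr) (auto simp: complex_nonpos_Reals_iff)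
    from DERIV_mult[OF this g]
    have "((\<lambda>s. s powr w * g s) has_field_derivative
             w * (of_real t powr (w - 1) * g (of_real t)) + of_real t powr w * g' (of_real t)) (at (of_real t))"
      by (simp add: algebra_simps)
    thus "((\<lambda>t. of_real t powr w * g (of_real t)) has_vector_derivative
             w * (of_real t powr (w - 1) * g (of_real t)) + of_real t powr w * g' (of_real t)) (at t)"
      by (rule has_vector_derivative_real_field)
  next
    show "continuous_on {0<..} (\<lambda>t. w * (of_real t powr (w - 1) * g (of_real t)) + of_real t powr w * g' (of_real t))"
      by (intro continuous_intros continuous_on_compose2[OF cg] continuous_on_compose2[OF g']) auto
  next
    have "((\<lambda>t. C * (t powr (\<sigma> + 1) / (1 + t))) \<longlongrightarrow> 0) (at_right 0)"
      using \<sigma> by real_asymp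
    thus "((\<lambda>t. of_real t powr w * g (of_real t)) \<longlongrightarrow> 0) (at_right 0)"
      by (rule Lim_null_comparison[rotated]) (use b in \<open>auto simp: eventually_at_filter\<close>)
    have "((\<lambda>t. C * (t powr (\<sigma> + 1) / (1 + t))) \<longlongrightarrow> 0) at_top"
      using \<sigma> by real_asymp
    thus "((\<lambda>t. of_real t powr w * g (of_real t)) \<longlongrightarrow> 0) at_top"
      by (rule Lim_null_comparison[rotated]) (rule eventually_mono[OF eventually_gt_at_top[of 0] b])
  qed (intro Bochner_Integration.integrable_add integrable_mult_right i i')
  also have "pos_integral (\<lambda>t. w * (of_real t powr (w - 1) * g (of_real t)) + of_real t powr w * g' (of_real t)) =
      w * pos_integral (\<lambda>t. of_real t powr (w - 1) * g (of_real t)) +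
      pos_integral (\<lambda>t. of_real t powr w * g' (of_real t))"
    using i i' by simp
  finally show ?thesis by (simp add: add_eq_0_iff2)
qed

text \<open>Both estimates rest on 1 + y <= exp y, at y = -x and at y = x; their shape is the one
  that \<open>integrable_mellin_strip\<close> takes.\<close>

lemma exp_neg_bounds:
  assumes "x > (0::real)"
  shows "\<bar>exp (- x) - 1\<bar> \<le> 2 * (x / (1 + x))" "\<bar>exp (- x) - 1 + x\<bar> \<le> x * (x / (1 + x))"
proof -
  have e: "1 - x \<le> exp (- x)" using exp_ge_add_one_self[of "-x"] by simp
  have "1 - x \<le> (1 + x) * exp (- x)"
  proof (cases "x \<le> 1")
    case True
    have "1 * exp (- x) \<le> (1 + x) * exp (- x)" using assms by (intro mult_right_mono) auto
    with e show ?thesis by linarith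
  next
    case False
    hence "1 - x \<le> 0" "0 \<le> (1 + x) * exp (- x)" by auto
    thus ?thesis by linarith
  qed
  hence "1 - exp (- x) \<le> 2 * (x / (1 + x))" using assms by (simp add: field_simps)
  thus "\<bar>exp (- x) - 1\<bar> \<le> 2 * (x / (1 + x))" using assms by (simp add: abs_if)
  have "exp (- x) \<le> 1 / (1 + x)"
    using exp_ge_add_one_self[of x] assms by (simp add: exp_minus inverse_eq_divide frac_le)
  hence "exp (- x) - 1 + x \<le> 1 / (1 + x) - 1 + x" by simp
  also have "\<dots> = x * (x / (1 + x))" using assms by (simp add: field_simps)
  finally show "\<bar>exp (- x) - 1 + x\<bar> \<le> x * (x / (1 + x))" using e by simp
qed

lemma exp_neg_bounds_complex:
  assumes "x > (0::real)"
  shows "norm (exp (- complex_of_real x) - 1) \<le> 2 * (x / (1 + x))"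
    and "norm (exp (- complex_of_real x) - 1 + of_real x) \<le> x * (x / (1 + x))"
proof -
  have "exp (- complex_of_real x) - 1 = of_real (exp (- x) - 1)"
       "exp (- complex_of_real x) - 1 + of_real x = of_real (exp (- x) - 1 + x)"
    by (simp_all flip: exp_of_real)
  thus "norm (exp (- complex_of_real x) - 1) \<le> 2 * (x / (1 + x))"
    and "norm (exp (- complex_of_real x) - 1 + of_real x) \<le> x * (x / (1 + x))"
    using exp_neg_bounds[OF assms] by (simp_all only: norm_of_real)
qed

lemma not_nonpos_Int_strip:
  assumes "-1 < Re z" "Re z < 0"
  shows "z \<notin> \<int>\<^sub>\<le>\<^sub>0" "z - 1 \<notin> \<int>\<^sub>\<le>\<^sub>0"
proof -
  have "z \<noteq> of_int n" for n
  proof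
    assume "z = of_int n"
    hence "-1 < n" "n < 0" using assms by auto
    thus False by simp
  qed
  moreover from this have "z - 1 \<noteq> of_int n" for n
    by (metis diff_add_cancel of_int_1 of_int_add)
  ultimately show "z \<notin> \<int>\<^sub>\<le>\<^sub>0" "z - 1 \<notin> \<int>\<^sub>\<le>\<^sub>0" by (auto elim!: nonpos_Ints_cases)
qed

text \<open>The Gamma integral in the form of Cauchy and Saalschuetz: to the left of 0 a Taylor
  polynomial of exp (-t) is subtracted. One integration by parts passes from Gamma (z + 1) to Gamma
  z, another from Gamma z to Gamma (z - 1).\<close>

lemma Gamma_mellin_strip:
  assumes z: "-1 < Re z" "Re z < 0" and a: "a > 0"
  shows "integrable pos_lborel (\<lambda>t. of_real t powr (z - 1) * (exp (- of_real (a * t)) - 1))"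
    and "pos_integral (\<lambda>t. of_real t powr (z - 1) * (exp (- of_real (a * t)) - 1)) =
           Gamma z * of_real a powr (- z)"
    and "integrable pos_lborel (\<lambda>t. of_real t powr (z - 1) *
           ((exp (- of_real (a * t)) - 1 + of_real (a * t)) / of_real (a * t)))"
    and "pos_integral (\<lambda>t. of_real t powr (z - 1) *
           ((exp (- of_real (a * t)) - 1 + of_real (a * t)) / of_real (a * t))) =
           Gamma (z - 1) * of_real a powr (- z)"
proof -
  let ?f1 = "\<lambda>t::real. exp (- complex_of_real t) - 1"
  let ?f2 = "\<lambda>t::real. (exp (- complex_of_real t) - 1 + of_real t) / of_real t"
  have nz: "z \<notin> \<int>\<^sub>\<le>\<^sub>0" "z - 1 \<notin> \<int>\<^sub>\<le>\<^sub>0" "z \<noteq> 0" "z - 1 \<noteq> 0"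
    using not_nonpos_Int_strip[OF z] z by auto
  have i1: "integrable pos_lborel (\<lambda>t. of_real t powr (z - 1) * ?f1 t)"
    by (rule integrable_mellin_strip[OF z, where C = 2])
       (use exp_neg_bounds_complex in \<open>auto intro!: continuous_intros\<close>)
  have i2: "integrable pos_lborel (\<lambda>t. of_real t powr (z - 1) * ?f2 t)"
  proof (rule integrable_mellin_strip[OF z])
    fix t :: real assume t: "t > 0"
    thus "norm (?f2 t) \<le> 1 * (t / (1 + t))"
      using exp_neg_bounds_complex(2)[OF t] by (simp add: norm_divide field_simps)
  qed (auto intro!: continuous_intros)
  have v1: "pos_integral (\<lambda>t. of_real t powr (z - 1) * ?f1 t) = Gamma z"
  proof -
    have G: "integrable pos_lborel (\<lambda>t. of_real t powr z * exp (- of_real t))"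
      "pos_integral (\<lambda>t. of_real t powr z * exp (- of_real t)) = z * Gamma z"
      using Gamma_mellin_1[of "z + 1"] z Gamma_plus1[OF nz(1)] by auto
    have "z * pos_integral (\<lambda>t. of_real t powr (z - 1) * (exp (- complex_of_real t) - 1)) =
         - pos_integral (\<lambda>t. of_real t powr z * (- exp (- complex_of_real t)))"
    proof (rule mellin_by_parts[OF z, where C = 2])
      fix t :: real assume t: "t > 0"
      have "norm (of_real t powr z * ?f1 t) \<le> t powr Re z * (2 * (t / (1 + t)))"
        unfolding norm_mult using t exp_neg_bounds_complex(1)[OF t]
        by (intro mult_mono) (auto simp: norm_pos_powr)
      also have "\<dots> = 2 * (t powr (Re z + 1) / (1 + t))" using t by (simp add: powr_add)
      finally show "norm (of_real t powr z * ?f1 t) \<le> 2 * (t powr (Re z + 1) / (1 + t))" .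
    qed (use G i1 in \<open>auto intro!: derivative_eq_intros continuous_intros\<close>)
    thus ?thesis using G nz by simp
  qed
  have v2: "pos_integral (\<lambda>t. of_real t powr (z - 1) * ?f2 t) = Gamma (z - 1)"
  proof -
    have eq: "of_real t powr (z - 1) * ?f2 t = of_real t powr (z - 1 - 1) * (exp (- complex_of_real t) - 1 + of_real t)"
      if "t > 0" for t
      using that powr_diff[of "complex_of_real t" "z - 1" 1] by simp
    have eq': "of_real t powr (z - 1) * (1 - exp (- complex_of_real t)) = - (of_real t powr (z - 1) * ?f1 t)" for t
      by (simp add: algebra_simps)
    have "(z - 1) * pos_integral (\<lambda>t. of_real t powr (z - 1 - 1) * (exp (- complex_of_real t) - 1 + of_real t)) =
         - pos_integral (\<lambda>t. of_real t powr (z - 1) * (1 - exp (- complex_of_real t)))"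
    proof (rule mellin_by_parts[OF z, where C = 1])
      fix t :: real assume t: "t > 0"
      have "norm (of_real t powr (z - 1) * (exp (- complex_of_real t) - 1 + of_real t)) \<le> t powr Re (z - 1) * (t * (t / (1 + t)))"
        unfolding norm_mult using t exp_neg_bounds_complex(2)[OF t]
        by (intro mult_mono) (auto simp: norm_pos_powr)
      also have "\<dots> = 1 * (t powr (Re z + 1) / (1 + t))" using t by (simp add: powr_add powr_diff)
      finally show "norm (of_real t powr (z - 1) * (exp (- complex_of_real t) - 1 + of_real t)) \<le> 1 * (t powr (Re z + 1) / (1 + t))" .
    next
      show "integrable pos_lborel (\<lambda>t. of_real t powr (z - 1 - 1) * (exp (- complex_of_real t) - 1 + of_real t))"
        using i2 pos_lborel_cong(1)[OF eq] by simp
      show "integrable pos_lborel (\<lambda>t. of_real t powr (z - 1) * (1 - exp (- complex_of_real t)))"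
        unfolding eq' using i1 by simp
    qed (auto intro!: derivative_eq_intros continuous_intros)
    hence "(z - 1) * pos_integral (\<lambda>t. of_real t powr (z - 1) * ?f2 t) = Gamma z"
      unfolding eq' using v1 by (subst pos_lborel_cong(2)[OF eq]) auto
    also have "\<dots> = (z - 1) * Gamma (z - 1)" using Gamma_plus1[OF nz(2)] by simp
    finally show ?thesis using nz by simp
  qed
  show "integrable pos_lborel (\<lambda>t. of_real t powr (z - 1) * (exp (- of_real (a * t)) - 1))"
    "pos_integral (\<lambda>t. of_real t powr (z - 1) * (exp (- of_real (a * t)) - 1)) =
           Gamma z * of_real a powr (- z)"
    using mellin_scale[OF a i1] v1 by simp_all
  show "integrable pos_lborel (\<lambda>t. of_real t powr (z - 1) *
           ((exp (- of_real (a * t)) - 1 + of_real (a * t)) / of_real (a * t)))"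
    "pos_integral (\<lambda>t. of_real t powr (z - 1) *
           ((exp (- of_real (a * t)) - 1 + of_real (a * t)) / of_real (a * t))) =
           Gamma (z - 1) * of_real a powr (- z)"
    using mellin_scale[OF a i2] v2 by simp_all
qed

text \<open>At 0 the kernel is 1 / t + (1/2 - v) + O(t), and removing both terms gives convergence
  in the strip. The result splits into the integrand of \<open>binet_integral\<close> and the two of
  \<open>Gamma_mellin_strip\<close>, matching the three terms of
  \<open>hurwitz_zeta_binet\<close>.\<close>

lemma hurwitz_zeta_mellin_strip:
  assumes z: "-1 < Re z" "Re z < 0" and v: "v > 0"
  shows "integrable pos_lborel (\<lambda>t. of_real t powr (z - 1) *
           (exp (- of_real (v * t)) / (1 - exp (- of_real t)) - 1 / of_real t - (1 / 2 - of_real v)))"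
    and "Gamma z * hurwitz_zeta z (of_real v) =
         pos_integral (\<lambda>t. of_real t powr (z - 1) *
           (exp (- of_real (v * t)) / (1 - exp (- of_real t)) - 1 / of_real t - (1 / 2 - of_real v)))"
proof -
  have nz: "z \<notin> \<int>\<^sub>\<le>\<^sub>0" "z - 1 \<notin> \<int>\<^sub>\<le>\<^sub>0" "z - 1 \<noteq> 0"
    using not_nonpos_Int_strip[OF z] z by auto
  let ?p = "\<lambda>t::real. complex_of_real t powr (z - 1)"
  define A where "A = (\<lambda>t. ?p t * (exp (- of_real (v * t)) * (binet_kernel (of_real t) - 1 / 2)))"
  define B where "B = (\<lambda>t. ?p t * (exp (- of_real (v * t)) - 1))"
  define D where "D = (\<lambda>t. ?p t * ((exp (- of_real (v * t)) - 1 + of_real (v * t)) / of_real (v * t)))"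
  have iA: "integrable pos_lborel A" "pos_integral A = binet_integral v z"
    using integrable_binet[OF v, of z] z by (auto simp: A_def binet_integral_def)
  have iB: "integrable pos_lborel B" "pos_integral B = Gamma z * of_real v powr (- z)"
    unfolding B_def using Gamma_mellin_strip[OF z v] by simp_all
  have iD: "integrable pos_lborel D" "pos_integral D = Gamma (z - 1) * of_real v powr (- z)"
    unfolding D_def using Gamma_mellin_strip[OF z v] by simp_all
  have eq: "?p t * (exp (- of_real (v * t)) / (1 - exp (- of_real t)) - 1 / of_real t - (1 / 2 - of_real v)) =
      A t + B t / 2 + of_real v * D t" if t: "t > 0" for t
  proof -
    \<comment> \<open>Here \<open>E\<close> is exp (-v t), \<open>K\<close> the value of
      \<open>binet_kernel\<close>, \<open>u\<close> is t and \<open>w\<close> is v.\<close>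
    have alg: "p * (E * (K + 1 / u) - 1 / u - (1 / 2 - w)) =
        p * (E * (K - 1 / 2)) + p * (E - 1) / 2 + p * ((E - 1 + w * u) / u)"
      if "u \<noteq> 0" for p E K u w :: complex
      using that by (simp add: field_simps)
    have 1: "exp (- complex_of_real (v * t)) / (1 - exp (- of_real t)) =
          exp (- of_real (v * t)) * (binet_kernel (of_real t) + 1 / of_real t)"
      by (simp add: binet_kernel_def)
    have 2: "of_real v * D t = ?p t * ((exp (- of_real (v * t)) - 1 + of_real (v * t)) / of_real t)"
      using v t by (simp add: D_def)
    show ?thesis
      unfolding 1 2 A_def B_def using t alg[of "of_real t"] by simp
  qed
  show "integrable pos_lborel (\<lambda>t. ?p t *
           (exp (- of_real (v * t)) / (1 - exp (- of_real t)) - 1 / of_real t - (1 / 2 - of_real v)))"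
    by (subst pos_lborel_cong(1)[OF eq]) (use iA iB iD in auto)
  have "pos_integral (\<lambda>t. ?p t *
           (exp (- of_real (v * t)) / (1 - exp (- of_real t)) - 1 / of_real t - (1 / 2 - of_real v))) =
        binet_integral v z + Gamma z * of_real v powr (- z) / 2 + of_real v * (Gamma (z - 1) * of_real v powr (- z))"
    by (subst pos_lborel_cong(2)[OF eq]) (use iA iB iD in auto)
  also have "\<dots> = Gamma z * (of_real v powr (1 - z) / (z - 1) + of_real v powr (- z) / 2 + rGamma z * binet_integral v z)"
  proof -
    have "Gamma z * rGamma z = 1" using nz by (simp add: rGamma_inverse_Gamma Gamma_eq_zero_iff)
    hence "Gamma z * (rGamma z * x) = x" for x by (simp flip: mult.assoc)
    moreover have "Gamma z = (z - 1) * Gamma (z - 1)" using Gamma_plus1[OF nz(2)] by simp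
    hence "Gamma z * (x / (z - 1)) = Gamma (z - 1) * x" for x using nz(3) by simp
    moreover have "of_real v powr (1 - z) = of_real v * of_real v powr (- z)"
      using v by (simp add: powr_diff powr_minus field_simps)
    ultimately show ?thesis by (simp add: distrib_left)
  qed
  also have "\<dots> = Gamma z * hurwitz_zeta z (of_real v)"
    using z by (subst hurwitz_zeta_binet[OF v]) auto
  finally show "Gamma z * hurwitz_zeta z (of_real v) =
         pos_integral (\<lambda>t. ?p t *
           (exp (- of_real (v * t)) / (1 - exp (- of_real t)) - 1 / of_real t - (1 / 2 - of_real v)))" ..
qed

section \<open>The functional equation at rational arguments\<close>

lemma geometric_sums_from_1:
  fixes q :: complex
  shows "(1 - q) * (\<Sum>k=1..n. q ^ k) = q - q ^ Suc n"
    and "(1 - q) * (\<Sum>k=1..n. of_nat k * q ^ k) = (\<Sum>k=1..n. q ^ k) - of_nat n * q ^ Suc n"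
proof -
  show 1: "(1 - q) * (\<Sum>k=1..n. q ^ k) = q - q ^ Suc n" for n
  proof (induction n)
    case (Suc n)
    have "(1 - q) * (\<Sum>k=1..Suc n. q ^ k) = (1 - q) * (\<Sum>k=1..n. q ^ k) + (1 - q) * q ^ Suc n"
      by (simp add: distrib_left)
    also have "\<dots> = q - q ^ Suc (Suc n)" unfolding Suc by (simp add: algebra_simps)
    finally show ?case .
  qed auto
  show "(1 - q) * (\<Sum>k=1..n. of_nat k * q ^ k) = (\<Sum>k=1..n. q ^ k) - of_nat n * q ^ Suc n"
  proof (induction n)
    case (Suc n)
    have "(1 - q) * (\<Sum>k=1..Suc n. of_nat k * q ^ k) =
        (1 - q) * (\<Sum>k=1..n. of_nat k * q ^ k) + (1 - q) * (of_nat (Suc n) * q ^ Suc n)"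
      by (simp add: distrib_left)
    also have "\<dots> = (\<Sum>k=1..Suc n. q ^ k) - of_nat (Suc n) * q ^ Suc (Suc n)"
      unfolding Suc by (simp add: algebra_simps)
    finally show ?case .
  qed auto
qed

lemma cis_2pi_neq_1:
  assumes "0 < x" "x < 1"
  shows "cis (2 * pi * x) \<noteq> 1"
proof
  assume "cis (2 * pi * x) = 1"
  hence "cos (2 * pi * x) = 1" by (simp add: complex_eq_iff)
  then obtain n :: int where "2 * pi * x = of_int n * 2 * pi" using cos_one_2pi_int by blast
  hence "x = of_int n" by simp
  thus False using assms by auto
qed

text \<open>For Re s > 0 this is the sum of cis (2 pi x)^n exp (-n s) over n >= 1, the generating
  function behind the periodic zeta function; equivalently 1 / (exp (s - 2 pi i x) - 1).\<close>

definition fourier_kernel :: "real \<Rightarrow> complex \<Rightarrow> complex" where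
  "fourier_kernel x s = cis (2 * pi * x) / (exp s - cis (2 * pi * x))"

lemma exp_neq_cis:
  assumes "t > 0"
  shows "exp (complex_of_real t) \<noteq> cis y"
proof
  assume "exp (complex_of_real t) = cis y"
  hence "norm (exp (complex_of_real t)) = norm (cis y)" by simp
  thus False using assms by simp
qed

text \<open>The powers of the root sum to 0, which removes 1 / t and 1/2; weighted with k / m they
  sum to minus the value of the kernel at 0; and since q ^ m = exp (-t), the geometric sum cancels
  the denominator 1 - exp (-t).\<close>

lemma sum_roots_hurwitz_kernel:
  assumes x: "0 < x" "x < 1" and m: "m > 0" and root: "cis (2 * pi * x) ^ m = 1" and t: "t > 0"
  shows "(\<Sum>k=1..m. cis (2 * pi * x) ^ k *
            (exp (- of_real (real k / real m * t)) / (1 - exp (- of_real t)) - 1 / of_real t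
              - (1 / 2 - of_real (real k / real m)))) =
         fourier_kernel x (of_real (t / real m)) - fourier_kernel x 0"
proof -
  define \<omega> where "\<omega> = cis (2 * pi * x)"
  have \<omega>1: "\<omega> \<noteq> 1" unfolding \<omega>_def by (rule cis_2pi_neq_1[OF x])
  have \<omega>m: "\<omega> ^ m = 1" using root by (simp add: \<omega>_def)
  have S0: "(\<Sum>k=1..m. \<omega> ^ k) = 0"
    using geometric_sums_from_1(1)[of \<omega> m] \<omega>1 \<omega>m by simp
  have S1: "(\<Sum>k=1..m. of_nat k * \<omega> ^ k) = - of_nat m * \<omega> / (1 - \<omega>)"
  proof -
    have "(1 - \<omega>) * (\<Sum>k=1..m. of_nat k * \<omega> ^ k) = - (of_nat m * \<omega>)"
      using geometric_sums_from_1(2)[of \<omega> m] \<omega>m S0 by simp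
    thus ?thesis using \<omega>1 by (simp add: field_simps)
  qed
  define q where "q = exp (- complex_of_real (t / real m))"
  have qm: "q ^ m = exp (- of_real t)"
    using m unfolding q_def exp_of_nat_mult[symmetric] by simp
  have qk: "exp (- complex_of_real (real k / real m * t)) = q ^ k" for k
    unfolding q_def exp_of_nat_mult[symmetric] by (simp add: field_simps)
  have ne: "1 - exp (- complex_of_real t) \<noteq> 0"
  proof -
    have "complex_of_real (1 - exp (- t)) \<noteq> 0" using t by (simp only: of_real_eq_0_iff) simp
    thus ?thesis by (simp flip: exp_of_real)
  qed
  have Q: "exp (complex_of_real (t / real m)) * q = 1" unfolding q_def by (simp flip: exp_add)
  have q0: "q \<noteq> 0" by (simp add: q_def)
  have ne2: "exp (complex_of_real (t / real m)) \<noteq> \<omega>"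
    unfolding \<omega>_def by (rule exp_neq_cis) (use t m in auto)
  have ne3: "1 - \<omega> * q \<noteq> 0" using ne2 Q q0 by (metis mult_right_cancel right_minus_eq)
  have "(1 - \<omega> * q) * (\<Sum>k=1..m. (\<omega> * q) ^ k) = \<omega> * q * (1 - exp (- of_real t))"
    using geometric_sums_from_1(1)[of "\<omega> * q" m] \<omega>m qm by (simp add: power_mult_distrib algebra_simps)
  hence "(\<Sum>k=1..m. (\<omega> * q) ^ k) = \<omega> * q / (1 - \<omega> * q) * (1 - exp (- of_real t))"
    using ne3 by (simp add: field_simps)
  hence S2: "(\<Sum>k=1..m. \<omega> ^ k * q ^ k) / (1 - exp (- of_real t)) = \<omega> * q / (1 - \<omega> * q)"
    using ne by (simp add: power_mult_distrib)
  have S3: "\<omega> * q / (1 - \<omega> * q) = fourier_kernel x (of_real (t / real m))"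
  proof -
    have "fourier_kernel x (of_real (t / real m)) = \<omega> * q / ((exp (complex_of_real (t / real m)) - \<omega>) * q)"
      using q0 by (simp add: fourier_kernel_def \<omega>_def)
    also have "(exp (complex_of_real (t / real m)) - \<omega>) * q = 1 - \<omega> * q"
      using Q by (simp add: left_diff_distrib)
    finally show ?thesis ..
  qed
  have "(\<Sum>k=1..m. \<omega> ^ k * (exp (- of_real (real k / real m * t)) / (1 - exp (- of_real t)) - 1 / of_real t
              - (1 / 2 - of_real (real k / real m)))) =
        (\<Sum>k=1..m. \<omega> ^ k * q ^ k / (1 - exp (- of_real t)) - \<omega> ^ k * (1 / of_real t + 1 / 2)
              + of_nat k * \<omega> ^ k / of_nat m)"
    unfolding qk by (intro sum.cong refl) (simp add: algebra_simps)
  also have "\<dots> = (\<Sum>k=1..m. \<omega> ^ k * q ^ k) / (1 - exp (- of_real t)) - (\<Sum>k=1..m. \<omega> ^ k) * (1 / of_real t + 1 / 2)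
              + (\<Sum>k=1..m. of_nat k * \<omega> ^ k) / of_nat m"
    by (simp only: sum.distrib sum_subtractf sum_divide_distrib sum_distrib_right)
  also have "\<dots> = fourier_kernel x (of_real (t / real m)) - \<omega> / (1 - \<omega>)"
    unfolding S0 S1 S2 S3 using m by simp
  also have "\<omega> / (1 - \<omega>) = fourier_kernel x 0" by (simp add: fourier_kernel_def \<omega>_def)
  finally show ?thesis by (simp only: \<omega>_def)
qed

lemma sum_roots_hurwitz_zeta_mellin:
  assumes x: "0 < x" "x < 1" and m: "m > 0" and root: "cis (2 * pi * x) ^ m = 1"
    and z: "-1 < Re z" "Re z < 0"
  shows "Gamma z * (\<Sum>k=1..m. cis (2 * pi * x) ^ k * hurwitz_zeta z (of_real (real k / real m))) =
         of_nat m powr z * pos_integral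
           (\<lambda>t. of_real t powr (z - 1) * (fourier_kernel x (of_real t) - fourier_kernel x 0))"
proof -
  let ?\<omega> = "cis (2 * pi * x)"
  let ?p = "\<lambda>t::real. complex_of_real t powr (z - 1)"
  define f where "f = (\<lambda>k t. ?p t * (exp (- of_real (real k / real m * t)) / (1 - exp (- of_real t))
     - 1 / of_real t - (1 / 2 - of_real (real k / real m))))"
  define h where "h = (\<lambda>t. fourier_kernel x (of_real (t / real m)) - fourier_kernel x 0)"
  have f: "integrable pos_lborel (f k)" "Gamma z * hurwitz_zeta z (of_real (real k / real m)) = pos_integral (f k)"
    if "k \<in> {1..m}" for k
    unfolding f_def using hurwitz_zeta_mellin_strip[OF z, of "real k / real m"] that m by auto
  have eq: "?p t * h t = (\<Sum>k=1..m. ?\<omega> ^ k * f k t)" if "t > 0" for t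
    unfolding h_def f_def sum_roots_hurwitz_kernel[OF x m root that, symmetric] sum_distrib_left
    by (intro sum.cong refl) (simp add: mult_ac)
  have i: "integrable pos_lborel (\<lambda>t. ?p t * h t)"
    by (subst pos_lborel_cong(1)[OF eq]) (use f in auto)
  have "pos_integral (\<lambda>t. ?p t * h t) = (\<Sum>k=1..m. ?\<omega> ^ k * pos_integral (f k))"
    by (subst pos_lborel_cong(2)[OF eq], assumption, subst Bochner_Integration.integral_sum) (use f in auto)
  also have "\<dots> = (\<Sum>k=1..m. ?\<omega> ^ k * (Gamma z * hurwitz_zeta z (of_real (real k / real m))))"
    by (intro sum.cong refl) (simp only: f)
  finally have 1: "Gamma z * (\<Sum>k=1..m. ?\<omega> ^ k * hurwitz_zeta z (of_real (real k / real m))) =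
      pos_integral (\<lambda>t. ?p t * h t)"
    by (simp add: sum_distrib_left mult_ac)
  \<comment> \<open>Rescaling t by m trades the argument t / m for the factor m^z.\<close>
  have "pos_integral (\<lambda>t. ?p t * h (real m * t)) = of_real (real m) powr (- z) * pos_integral (\<lambda>t. ?p t * h t)"
    by (rule mellin_scale(2)[OF _ i]) (use m in auto)
  also have "(\<lambda>t. ?p t * h (real m * t)) = (\<lambda>t. ?p t * (fourier_kernel x (of_real t) - fourier_kernel x 0))"
    using m by (simp add: h_def)
  finally show ?thesis unfolding 1 using m by (simp add: powr_minus)
qed

section \<open>Partial fractions of the cotangent\<close>

lemma Digamma_reflection:
  fixes z :: complex
  assumes z: "z \<notin> \<int>"
  shows "Digamma (1 - z) - Digamma z = of_real pi * cot (of_real pi * z)"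
proof -
  have z': "z \<notin> \<int>\<^sub>\<le>\<^sub>0" "1 - z \<notin> \<int>\<^sub>\<le>\<^sub>0" "1 - z \<notin> \<int>"
    using z by (auto dest: nonpos_Ints_Int)
  \<comment> \<open>The reflection formula rGamma z * rGamma (1 - z) = sin (pi z) / pi is
    differentiated on both sides and then divided by itself.\<close>
  have "((\<lambda>z. rGamma z * rGamma (1 - z)) has_field_derivative
          (- rGamma z * Digamma z) * rGamma (1 - z) + rGamma z * (rGamma (1 - z) * Digamma (1 - z))) (at z)"
  proof -
    have 1: "(rGamma has_field_derivative - rGamma z * Digamma z) (at z)"
      by (rule has_field_derivative_rGamma_no_nonpos_int) fact
    have 2: "(rGamma has_field_derivative - rGamma (1 - z) * Digamma (1 - z)) (at (1 - z))"
      by (rule has_field_derivative_rGamma_no_nonpos_int) fact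
    have 3: "((\<lambda>z. rGamma (1 - z)) has_field_derivative (- rGamma (1 - z) * Digamma (1 - z)) * (- 1)) (at z)"
      by (rule DERIV_chain2[where f = rGamma and g = "\<lambda>z. 1 - z", OF 2]) (auto intro!: derivative_eq_intros)
    show ?thesis using DERIV_mult[OF 1 3] by (simp add: mult_ac)
  qed
  moreover have "((\<lambda>z. sin (of_real pi * z) / of_real pi) has_field_derivative cos (of_real pi * z)) (at z)"
    by (auto intro!: derivative_eq_intros)
  ultimately have "(- rGamma z * Digamma z) * rGamma (1 - z) + rGamma z * (rGamma (1 - z) * Digamma (1 - z))
      = cos (of_real pi * z)"
    using DERIV_unique by (simp add: rGamma_reflection_complex) blast
  hence "rGamma z * rGamma (1 - z) * (Digamma (1 - z) - Digamma z) = cos (of_real pi * z)"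
    by (simp add: algebra_simps)
  hence "sin (of_real pi * z) * (Digamma (1 - z) - Digamma z) = of_real pi * cos (of_real pi * z)"
    by (simp add: rGamma_reflection_complex field_simps)
  moreover have "rGamma z * rGamma (1 - z) \<noteq> 0" using z' by (simp add: rGamma_eq_zero_iff)
  hence "sin (of_real pi * z) \<noteq> 0" by (simp add: rGamma_reflection_complex)
  ultimately show ?thesis by (simp add: cot_def field_simps)
qed

text \<open>In the difference of the digamma series at 1 - z and at z the harmonic terms cancel,
  which leaves a convergent pairing of the two families of poles.\<close>

lemma cot_partial_fractions:
  fixes z :: complex
  assumes z: "z \<notin> \<int>"
  shows "(\<lambda>n. inverse (z + of_nat n) - inverse (1 - z + of_nat n)) sums (of_real pi * cot (of_real pi * z))"
proof -
  have "z \<noteq> 0" "1 - z \<noteq> 0" using z by auto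
  have "(\<lambda>n. (inverse (of_nat (Suc n)) - inverse (1 - z + of_nat n)) - (inverse (of_nat (Suc n)) - inverse (z + of_nat n)))
        sums ((Digamma (1 - z) + euler_mascheroni) - (Digamma z + euler_mascheroni))"
    using summable_sums[OF summable_Digamma[OF \<open>z \<noteq> 0\<close>]] summable_sums[OF summable_Digamma[OF \<open>1 - z \<noteq> 0\<close>]]
    by (intro sums_diff) (simp_all add: Digamma_def)
  thus ?thesis by (simp add: Digamma_reflection[OF z])
qed

lemma cot_exp:
  assumes "exp (2 * \<i> * \<theta>) \<noteq> 1"
  shows "\<i> / 2 * cot \<theta> - 1 / 2 = exp (2 * \<i> * \<theta>) / (1 - exp (2 * \<i> * \<theta>))"
proof -
  define E where "E = exp (\<i> * \<theta>)"
  have E: "E \<noteq> 0" "exp (2 * \<i> * \<theta>) = E * E" "exp (- (\<i> * \<theta>)) = 1 / E"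
    by (simp_all add: E_def exp_minus inverse_eq_divide mult.assoc flip: exp_add)
  have EE: "E * E \<noteq> 1" using assms E by simp
  have "cos \<theta> = (E + 1 / E) / 2" "sin \<theta> = (E - 1 / E) / (2 * \<i>)"
    unfolding cos_exp_eq sin_exp_eq E(3) by (simp_all add: E_def)
  hence cs: "cos \<theta> = (E * E + 1) / (2 * E)" "sin \<theta> = (E * E - 1) / (2 * \<i> * E)"
    using E(1) by (simp_all add: field_simps)
  have "A / (2 * E) / (B / (2 * \<i> * E)) = \<i> * A / B" if "B \<noteq> 0" for A B
    using that E(1) by simp
  hence "cot \<theta> = \<i> * (E * E + 1) / (E * E - 1)"
    unfolding cot_def cs using E(1) EE by simp
  moreover have "\<i> / 2 * (\<i> * (A + 1) / (A - 1)) - 1 / 2 = A / (1 - A)" if "A \<noteq> 1" for A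
  proof -
    have "\<i> / 2 * (\<i> * (A + 1) / (A - 1)) = (\<i> * \<i>) * (A + 1) / (2 * (A - 1))"
      by (simp only: times_divide_times_eq mult.assoc)
    also have "\<dots> = - (A + 1) / (2 * (A - 1))" by simp
    also have "\<dots> - 1 / 2 = A / (1 - A)" using that by (simp add: divide_simps) (simp add: algebra_simps)
    finally show ?thesis .
  qed
  ultimately show ?thesis unfolding E(2) using EE by simp
qed

text \<open>At w = x + i t / (2 pi) one has exp (2 pi i w) = cis (2 pi x) exp (-t), so the kernel is
  a multiple of cot (pi w) shifted by 1/2. The case t = 0 is included because that value is
  subtracted next.\<close>

lemma fourier_kernel_partial_fractions:
  assumes x: "0 < x" "x < 1" and t: "t \<ge> 0"
  shows "(\<lambda>n. \<i> / (2 * of_real pi) * (inverse (of_real (real n + x) + \<i> * of_real (t / (2 * pi))) -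
                                inverse (of_real (real n + (1 - x)) - \<i> * of_real (t / (2 * pi)))))
           sums (fourier_kernel x (of_real t) + 1 / 2)"
proof -
  define w where "w = of_real x + \<i> * of_real (t / (2 * pi))"
  have w: "w \<notin> \<int>"
  proof
    assume "w \<in> \<int>"
    then obtain n where "w = of_int n" by (elim Ints_cases)
    hence "x = of_int n" by (auto simp: w_def complex_eq_iff)
    thus False using x by auto
  qed
  have e: "exp (2 * \<i> * (of_real pi * w)) = cis (2 * pi * x) * exp (- of_real t)"
    by (simp add: w_def cis_conv_exp algebra_simps flip: exp_add)
  have ne: "exp (of_real t) \<noteq> cis (2 * pi * x)"
    using exp_neq_cis[of t] cis_2pi_neq_1[OF x] t by (cases "t = 0") auto
  have "exp (2 * \<i> * (of_real pi * w)) \<noteq> 1" unfolding e using ne by (simp add: exp_minus field_simps)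
  hence "\<i> / 2 * cot (of_real pi * w) - 1 / 2 = cis (2 * pi * x) * exp (- of_real t) / (1 - cis (2 * pi * x) * exp (- of_real t))"
    using cot_exp[of "of_real pi * w"] e by simp
  also have "\<dots> = fourier_kernel x (of_real t)"
    using ne by (simp add: fourier_kernel_def exp_minus field_simps)
  finally have "\<i> / (2 * of_real pi) * (of_real pi * cot (of_real pi * w)) = fourier_kernel x (of_real t) + 1 / 2"
    by (simp add: field_simps)
  moreover have "(\<lambda>n. \<i> / (2 * of_real pi) * (inverse (w + of_nat n) - inverse (1 - w + of_nat n)))
      sums (\<i> / (2 * of_real pi) * (of_real pi * cot (of_real pi * w)))"
    by (intro sums_mult cot_partial_fractions w)
  ultimately have "(\<lambda>n. \<i> / (2 * of_real pi) * (inverse (w + of_nat n) - inverse (1 - w + of_nat n)))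
      sums (fourier_kernel x (of_real t) + 1 / 2)" by (simp only:)
  moreover have "w + of_nat n = of_real (real n + x) + \<i> * of_real (t / (2 * pi))"
    "1 - w + of_nat n = of_real (real n + (1 - x)) - \<i> * of_real (t / (2 * pi))" for n
    by (simp_all add: w_def)
  ultimately show ?thesis by (simp only:)
qed

text \<open>Subtracting the value at 0 turns the pole term i / (a + i y) into 1 / a times a fixed
  function of y / a: all terms become rescalings of two functions, and the shift 1/2 drops
  out.\<close>

lemma fourier_kernel_diff_sums:
  assumes x: "0 < x" "x < 1" and t: "t > 0"
  defines "\<phi> \<equiv> \<lambda>c u. complex_of_real u / (1 + c * of_real u)"
  shows "(\<lambda>n. (\<phi> \<i> (t / (2 * pi * (real n + x))) / of_real (real n + x) +
              \<phi> (-\<i>) (t / (2 * pi * (real n + (1 - x)))) / of_real (real n + (1 - x))) / of_real (2 * pi))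
           sums (fourier_kernel x (of_real t) - fourier_kernel x 0)"
proof -
  let ?F = "\<lambda>t n. \<i> / (2 * of_real pi) * (inverse (of_real (real n + x) + \<i> * of_real (t / (2 * pi))) -
                                inverse (of_real (real n + (1 - x)) - \<i> * of_real (t / (2 * pi))))"
  have "(\<lambda>n. ?F t n - ?F 0 n) sums ((fourier_kernel x (of_real t) + 1 / 2) - (fourier_kernel x (of_real 0) + 1 / 2))"
    by (intro sums_diff fourier_kernel_partial_fractions x) (use t in auto)
  also have "(\<lambda>n. ?F t n - ?F 0 n) = (\<lambda>n. (\<phi> \<i> (t / (2 * pi * (real n + x))) / of_real (real n + x) +
              \<phi> (-\<i>) (t / (2 * pi * (real n + (1 - x)))) / of_real (real n + (1 - x))) / of_real (2 * pi))"
  proof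
    fix n
    have key: "\<i> * (inverse (a + \<i> * y) - inverse a) = y / a / (1 + \<i> * (y / a)) / a"
      "- \<i> * (inverse (a - \<i> * y) - inverse a) = y / a / (1 - \<i> * (y / a)) / a"
      if "a \<noteq> 0" "a + \<i> * y \<noteq> 0" "a - \<i> * y \<noteq> 0" for a y :: complex
    proof -
      have "1 + \<i> * (y / a) = (a + \<i> * y) / a" "1 - \<i> * (y / a) = (a - \<i> * y) / a"
        using that by (simp_all add: field_simps)
      moreover have "\<i> * (inverse (a + \<i> * y) - inverse a) = y / (a * (a + \<i> * y))"
        "- \<i> * (inverse (a - \<i> * y) - inverse a) = y / (a * (a - \<i> * y))"
        using that by (simp_all add: field_simps)
      ultimately show "\<i> * (inverse (a + \<i> * y) - inverse a) = y / a / (1 + \<i> * (y / a)) / a"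
      "- \<i> * (inverse (a - \<i> * y) - inverse a) = y / a / (1 - \<i> * (y / a)) / a" using that by simp_all
    qed
    have nz: "complex_of_real a \<noteq> 0" "complex_of_real a + \<i> * of_real y \<noteq> 0" "complex_of_real a - \<i> * of_real y \<noteq> 0"
      if "a > 0" for a y using that by (auto simp: complex_eq_iff)
    define a b y where "a = real n + x" and "b = real n + (1 - x)" and "y = t / (2 * pi)"
    have ab: "a > 0" "b > 0" using x by (auto simp: a_def b_def)
    have 1: "t / (2 * pi * a) = y / a" "t / (2 * pi * b) = y / b" by (simp_all add: y_def)
    have "?F t n - ?F 0 n = (\<i> * (inverse (of_real a + \<i> * of_real y) - inverse (of_real a)) +
        (- \<i>) * (inverse (of_real b - \<i> * of_real y) - inverse (of_real b))) / of_real (2 * pi)"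
      unfolding a_def[symmetric] b_def[symmetric] y_def[symmetric] by (simp add: field_simps)
    also have "\<dots> = (\<phi> \<i> (y / a) / of_real a + \<phi> (-\<i>) (y / b) / of_real b) / of_real (2 * pi)"
      unfolding key(1)[OF nz[OF ab(1)]] key(2)[OF nz[OF ab(2)]] by (simp add: \<phi>_def)
    finally show "?F t n - ?F 0 n = (\<phi> \<i> (t / (2 * pi * (real n + x))) / of_real (real n + x) +
              \<phi> (-\<i>) (t / (2 * pi * (real n + (1 - x)))) / of_real (real n + (1 - x))) / of_real (2 * pi)"
      unfolding a_def[symmetric] b_def[symmetric] 1 .
  qed
  finally show ?thesis by simp
qed

section \<open>Termwise Mellin transform of the partial fractions\<close>

definition cauchy_kernel :: "complex \<Rightarrow> real \<Rightarrow> complex" where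
  "cauchy_kernel c u = of_real u / (1 + c * of_real u)"

lemma norm_one_plus_i_times:
  assumes "c = \<i> \<or> c = - \<i>"
  shows "norm (1 + c * of_real u) = sqrt (1 + u ^ 2)"
  using assms by (auto simp: cmod_def)

lemma
  assumes c: "c = \<i> \<or> c = - \<i>"
  shows continuous_on_cauchy_kernel: "continuous_on {0<..} (cauchy_kernel c)"
    and norm_cauchy_kernel_le: "u > 0 \<Longrightarrow> norm (cauchy_kernel c u) \<le> 2 * (u / (1 + u))"
proof -
  have nz: "1 + c * of_real u \<noteq> 0" for u using c by (auto simp: complex_eq_iff)
  show "continuous_on {0<..} (cauchy_kernel c)"
    unfolding cauchy_kernel_def by (intro continuous_intros) (use nz in auto)
  assume u: "u > 0"
  have "((1 + u) / 2) ^ 2 \<le> 1 + u ^ 2"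
    using sum_squares_ge_zero[of "1 - u" 0] u by (simp add: power2_eq_square field_simps)
  hence "(1 + u) / 2 \<le> sqrt (1 + u ^ 2)" using real_le_rsqrt by blast
  hence "u / sqrt (1 + u ^ 2) \<le> u / ((1 + u) / 2)" using u by (intro divide_left_mono mult_pos_pos) (auto intro!: add_pos_pos)
  thus "norm (cauchy_kernel c u) \<le> 2 * (u / (1 + u))"
    using u by (simp add: cauchy_kernel_def norm_divide norm_one_plus_i_times[OF c] mult.commute)
qed

text \<open>Termwise integration rests on this: the L1 norms of the rescaled terms are summed like a
  real Hurwitz series.\<close>

lemma mellin_norm_scale:
  fixes f :: "real \<Rightarrow> complex"
  assumes a: "a > 0"
  shows "pos_integral (\<lambda>t. norm (of_real t powr (z - 1) * f (a * t))) =
           a powr (- Re z) * pos_integral (\<lambda>t. norm (of_real t powr (z - 1) * f t))"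
proof -
  let ?f = "\<lambda>t. norm (complex_of_real t powr (z - 1) * f t)"
  have eq: "norm (of_real t powr (z - 1) * f (a * t)) = a powr (1 - Re z) * ?f (a * t)"
    if "t > 0" for t
  proof -
    have "a powr (1 - Re z) * a powr (Re z - 1) = 1"
      using a by (simp flip: powr_add)
    moreover have "norm (complex_of_real (a * t) powr (z - 1)) = a powr (Re z - 1) * t powr (Re z - 1)"
      using a that norm_pos_powr[of "a * t" "z - 1"] by (simp add: powr_mult del: of_real_mult)
    ultimately show ?thesis using that by (simp add: norm_mult norm_pos_powr del: of_real_mult)
  qed
  have "pos_integral (\<lambda>t. norm (of_real t powr (z - 1) * f (a * t))) =
         a powr (1 - Re z) * pos_integral (\<lambda>t. ?f (a * t))"
    by (subst pos_lborel_cong(2)[OF eq]) auto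
  also have "\<dots> = a powr (1 - Re z) * ((1 / a) * pos_integral ?f)"
    using pos_lborel_scale(2)[OF a, of ?f] by simp
  also have "\<dots> = a powr (- Re z) * pos_integral ?f"
    using a by (simp add: powr_diff powr_minus field_simps)
  finally show ?thesis .
qed

text \<open>With A = 2 pi (n + y) each term is the fixed kernel at t / A, divided by A, so it
  integrates to A^(z-1) times a constant. Summing over n gives the Hurwitz series at 1 - z,
  absolutely convergent because Re z < 0.\<close>

lemma mellin_fourier_kernel:
  assumes x: "0 < x" "x < 1" and z: "-1 < Re z" "Re z < 0"
  defines "K \<equiv> \<lambda>c. pos_integral (\<lambda>t. of_real t powr (z - 1) * cauchy_kernel c t)"
  shows "pos_integral
           (\<lambda>t. of_real t powr (z - 1) * (fourier_kernel x (of_real t) - fourier_kernel x 0)) =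
         of_real (2 * pi) powr (z - 1) *
           (K \<i> * hurwitz_zeta (1 - z) (of_real x) + K (- \<i>) * hurwitz_zeta (1 - z) (of_real (1 - x)))"
proof -
  let ?p = "\<lambda>t::real. complex_of_real t powr (z - 1)"
  define T where "T = (\<lambda>c y n t. ?p t * cauchy_kernel c (1 / (2 * pi * (real n + y)) * t) / of_real (2 * pi * (real n + y)))"
  define f where "f = (\<lambda>n t. T \<i> x n t + T (- \<i>) (1 - x) n t)"
  have iK: "integrable pos_lborel (\<lambda>t. ?p t * cauchy_kernel c t)" if "c = \<i> \<or> c = - \<i>" for c
    by (rule integrable_mellin_strip[OF z, where C = 2])
       (use continuous_on_cauchy_kernel[OF that] norm_cauchy_kernel_le[OF that] in auto)
  have iT: "integrable pos_lborel (T c y n)"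
    and vT: "pos_integral (T c y n) = of_real (2 * pi) powr (z - 1) * (K c * (of_nat n + of_real y) powr (- (1 - z)))"
    and nT: "pos_integral (\<lambda>t. norm (T c y n t)) =
        (2 * pi) powr (Re z - 1) * pos_integral (\<lambda>t. norm (?p t * cauchy_kernel c t)) * (real n + y) powr (- (1 - Re z))"
    if c: "c = \<i> \<or> c = - \<i>" and y: "y > 0" for c y n
  proof -
    define A where "A = 2 * pi * (real n + y)"
    have A: "A > 0" using y by (simp add: A_def add_nonneg_pos)
    have ny: "real n + y > 0" using y by simp
    have *: "T c y n = (\<lambda>t. ?p t * cauchy_kernel c (1 / A * t) / of_real A)"
      by (simp add: T_def A_def)
    have "integrable pos_lborel (\<lambda>t. ?p t * cauchy_kernel c (1 / A * t))"
      by (rule mellin_scale(1)[OF _ iK[OF c]]) (use A in auto)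
    thus "integrable pos_lborel (T c y n)" unfolding * by (rule integrable_divide_zero[rotated]) 
    have "pos_integral (T c y n) = of_real (1 / A) powr (- z) * K c / of_real A"
      unfolding * K_def integral_divide_zero
      by (subst mellin_scale(2)[OF _ iK[OF c]]) (use A in auto)
    also have "of_real (1 / A) powr (- z) = complex_of_real A powr z"
      using A by (simp add: powr_def Ln_of_real ln_div flip: of_real_divide)
    also have "complex_of_real A powr z * K c / of_real A = of_real A powr (z - 1) * K c"
      using A by (simp add: powr_diff)
    also have "complex_of_real A powr (z - 1) = of_real (2 * pi) powr (z - 1) * of_real (real n + y) powr (z - 1)"
      unfolding A_def by (rule powr_mult_pos_real) (use ny in auto)
    finally show "pos_integral (T c y n) = of_real (2 * pi) powr (z - 1) * (K c * (of_nat n + of_real y) powr (- (1 - z)))"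
      by (simp add: mult_ac)
    have "pos_integral (\<lambda>t. norm (T c y n t)) = pos_integral (\<lambda>t. norm (?p t * cauchy_kernel c (1 / A * t))) / A"
      unfolding * norm_divide integral_divide_zero[symmetric] using A by simp
    also have "\<dots> = (1 / A) powr (- Re z) * pos_integral (\<lambda>t. norm (?p t * cauchy_kernel c t)) / A"
      by (subst mellin_norm_scale) (use A in auto)
    also have "(1 / A) powr (- Re z) = A powr Re z"
      using A by (simp add: powr_divide powr_minus)
    also have "A powr Re z * pos_integral (\<lambda>t. norm (?p t * cauchy_kernel c t)) / A =
        A powr (Re z - 1) * pos_integral (\<lambda>t. norm (?p t * cauchy_kernel c t))"
      using A by (simp add: powr_diff)
    also have "A powr (Re z - 1) = (2 * pi) powr (Re z - 1) * (real n + y) powr (Re z - 1)"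
      unfolding A_def using ny by (intro powr_mult) 
    finally show "pos_integral (\<lambda>t. norm (T c y n t)) =
        (2 * pi) powr (Re z - 1) * pos_integral (\<lambda>t. norm (?p t * cauchy_kernel c t)) * (real n + y) powr (- (1 - Re z))"
      by (simp add: mult_ac)
  qed
  have x': "1 - x > 0" using x by simp
  have if': "integrable pos_lborel (f n)" for n
    unfolding f_def using iT[of "\<i>" x n] iT[of "- \<i>" "1 - x" n] x by auto
  have fs: "(\<lambda>n. f n t) sums (?p t * (fourier_kernel x (of_real t) - fourier_kernel x 0))" if t: "t > 0" for t
  proof -
    have "(\<lambda>n. ?p t * ((cauchy_kernel \<i> (t / (2 * pi * (real n + x))) / of_real (real n + x) +
              cauchy_kernel (-\<i>) (t / (2 * pi * (real n + (1 - x)))) / of_real (real n + (1 - x))) / of_real (2 * pi)))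
           sums (?p t * (fourier_kernel x (of_real t) - fourier_kernel x 0))"
      unfolding cauchy_kernel_def by (intro sums_mult fourier_kernel_diff_sums x t)
    also have "(\<lambda>n. ?p t * ((cauchy_kernel \<i> (t / (2 * pi * (real n + x))) / of_real (real n + x) +
              cauchy_kernel (-\<i>) (t / (2 * pi * (real n + (1 - x)))) / of_real (real n + (1 - x))) / of_real (2 * pi))) = (\<lambda>n. f n t)"
      by (simp add: f_def T_def distrib_left add_divide_distrib mult_ac)
    finally show ?thesis .
  qed
  have nsum: "summable (\<lambda>n. norm (f n t))" and nle: "norm (f n t) \<le> norm (T \<i> x n t) + norm (T (- \<i>) (1 - x) n t)"
    if t: "t > 0" for n t
  proof -
    show "norm (f n t) \<le> norm (T \<i> x n t) + norm (T (- \<i>) (1 - x) n t)" for n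
      unfolding f_def by (rule norm_triangle_ineq)
    \<comment> \<open>For fixed t the kernel at t / A is at most 2 t / A, and the further division
      by A gives terms of order n^(-2).\<close>
    have T: "summable (\<lambda>n. norm (T c y n t))" if c: "c = \<i> \<or> c = - \<i>" and y: "y > 0" for c y
    proof (rule summable_comparison_test')
      show "summable (\<lambda>n. norm (?p t) * (2 * t) * (real n + y) powr (- 2))"
        by (intro summable_mult summable_shifted_powr y) auto
      fix n :: nat
      define A where "A = 2 * pi * (real n + y)"
      have A: "A > 0" "A \<ge> real n + y" "real n + y > 0"
        using y pi_gt3 by (auto simp: A_def add_nonneg_pos)
      have "norm (cauchy_kernel c (t / A)) \<le> 2 * ((t / A) / (1 + t / A))"
        using norm_cauchy_kernel_le[OF c, of "t / A"] t A by simp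
      also have "\<dots> \<le> 2 * (t / A)" using t A by (simp add: field_simps)
      finally have le: "norm (cauchy_kernel c (t / A)) \<le> 2 * (t / A)" .
      have "norm (T c y n t) \<le> norm (?p t) * (2 * (t / A)) / A"
      proof -
        have "T c y n t = ?p t * cauchy_kernel c (t / A) / of_real A"
          by (simp add: T_def A_def)
        hence eq: "norm (T c y n t) = norm (?p t) * norm (cauchy_kernel c (t / A)) / A"
          using A by (simp add: norm_mult norm_divide)
        show ?thesis unfolding eq using A by (intro divide_right_mono mult_left_mono le) auto
      qed
      also have "\<dots> = norm (?p t) * (2 * t) * (1 / A ^ 2)" by (simp add: power2_eq_square)
      also have "\<dots> \<le> norm (?p t) * (2 * t) * (1 / (real n + y) ^ 2)"
        using A t by (intro mult_left_mono divide_left_mono power_mono mult_pos_pos zero_less_power) auto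
      also have "1 / (real n + y) ^ 2 = (real n + y) powr (- 2)"
        using A by (simp add: powr_minus inverse_eq_divide powr_numeral)
      finally show "norm (norm (T c y n t)) \<le> norm (?p t) * (2 * t) * (real n + y) powr (- 2)" by simp
    qed
    show "summable (\<lambda>n. norm (f n t))"
    proof (rule summable_comparison_test')
      show "summable (\<lambda>n. norm (T \<i> x n t) + norm (T (- \<i>) (1 - x) n t))"
        by (intro summable_add T) (use x in auto)
      show "norm (norm (f n t)) \<le> norm (T \<i> x n t) + norm (T (- \<i>) (1 - x) n t)" for n
        unfolding f_def by (simp add: norm_triangle_ineq)
    qed
  qed
  have AE: "AE t in pos_lborel. summable (\<lambda>n. norm (f n t))"
    by (rule AE_I2) (auto simp: space_restrict_space nsum)
  have sm: "summable (\<lambda>n. pos_integral (\<lambda>t. norm (f n t)))"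
  proof (rule summable_comparison_test')
    show "summable (\<lambda>n. pos_integral (\<lambda>t. norm (T \<i> x n t)) + pos_integral (\<lambda>t. norm (T (- \<i>) (1 - x) n t)))"
    proof (rule summable_add)
      have S: "summable (\<lambda>n. (real n + y) powr (- (1 - Re z)))" if "y > 0" for y
        by (rule summable_shifted_powr) (use z that in auto)
      show "summable (\<lambda>n. pos_integral (\<lambda>t. norm (T \<i> x n t)))"
        by (subst nT) (use x S[of x] in \<open>auto intro!: summable_mult\<close>)
      show "summable (\<lambda>n. pos_integral (\<lambda>t. norm (T (- \<i>) (1 - x) n t)))"
        by (subst nT) (use x S[of "1 - x"] in \<open>auto intro!: summable_mult\<close>)
    qed
    fix n :: nat
    have "pos_integral (\<lambda>t. norm (f n t)) \<le> pos_integral (\<lambda>t. norm (T \<i> x n t) + norm (T (- \<i>) (1 - x) n t))"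
      by (rule integral_mono)
         (use if' iT x nle in \<open>auto simp: space_restrict_space intro!: integrable_norm Bochner_Integration.integrable_add\<close>)
    also have "\<dots> = pos_integral (\<lambda>t. norm (T \<i> x n t)) + pos_integral (\<lambda>t. norm (T (- \<i>) (1 - x) n t))"
      by (rule Bochner_Integration.integral_add) (use iT x in \<open>auto intro!: integrable_norm\<close>)
    finally show "norm (pos_integral (\<lambda>t. norm (f n t))) \<le>
        pos_integral (\<lambda>t. norm (T \<i> x n t)) + pos_integral (\<lambda>t. norm (T (- \<i>) (1 - x) n t))"
      by simp
  qed
  have "(\<lambda>n. pos_integral (f n)) sums pos_integral (\<lambda>t. \<Sum>n. f n t)"
    by (rule sums_integral[OF if' AE sm])
  also have "pos_integral (\<lambda>t. \<Sum>n. f n t) = pos_integral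
           (\<lambda>t. ?p t * (fourier_kernel x (of_real t) - fourier_kernel x 0))"
    by (rule pos_lborel_cong) (use fs sums_iff in blast)
  also have "(\<lambda>n. pos_integral (f n)) = (\<lambda>n. of_real (2 * pi) powr (z - 1) *
      (K \<i> * (of_nat n + of_real x) powr (- (1 - z)) + K (- \<i>) * (of_nat n + of_real (1 - x)) powr (- (1 - z))))"
    unfolding f_def
    by (subst Bochner_Integration.integral_add) (use iT x x' in \<open>auto simp: vT distrib_left\<close>)
  finally have 1: "(\<lambda>n. of_real (2 * pi) powr (z - 1) *
      (K \<i> * (of_nat n + of_real x) powr (- (1 - z)) + K (- \<i>) * (of_nat n + of_real (1 - x)) powr (- (1 - z)))) sums
      pos_integral (\<lambda>t. ?p t * (fourier_kernel x (of_real t) - fourier_kernel x 0))" .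
  have hz: "(\<lambda>n. (of_nat n + complex_of_real y) powr (- (1 - z))) sums hurwitz_zeta (1 - z) (of_real y)" if "y > 0" for y
  proof -
    have "Re (1 - z) > 1" "1 - z \<noteq> 1" using z by auto
    thus ?thesis using summable_sums[OF summable_hurwitz[of "1 - z" y]] that hurwitz_entire_Re_gt_1[OF that, of "1 - z"]
      by (simp add: hurwitz_zeta_conv_entire)
  qed
  have 2: "(\<lambda>n. of_real (2 * pi) powr (z - 1) *
      (K \<i> * (of_nat n + of_real x) powr (- (1 - z)) + K (- \<i>) * (of_nat n + of_real (1 - x)) powr (- (1 - z)))) sums
      (of_real (2 * pi) powr (z - 1) *
           (K \<i> * hurwitz_zeta (1 - z) (of_real x) + K (- \<i>) * hurwitz_zeta (1 - z) (of_real (1 - x))))"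
    by (intro sums_mult sums_add hz x x')
  show ?thesis by (rule sums_unique2[OF 1 2])
qed

text \<open>Rationalising with c * c = -1 splits the kernel into t / (1 + t^2) and -c t^2 / (1 +
  t^2), two Beta integrals with p = s + 1 and p = s + 2; both exponents lie in (0, 2) for s in the
  strip.\<close>

lemma mellin_cauchy_kernel:
  fixes s :: real
  assumes s: "-1 < s" "s < 0"
  shows "pos_integral (\<lambda>t. of_real t powr (of_real s - 1) * cauchy_kernel \<i> t) =
           of_real (pi / (2 * cos (pi * s / 2))) + \<i> * of_real (pi / (2 * sin (pi * s / 2)))"
    and "pos_integral (\<lambda>t. of_real t powr (of_real s - 1) * cauchy_kernel (- \<i>) t) =
           of_real (pi / (2 * cos (pi * s / 2))) - \<i> * of_real (pi / (2 * sin (pi * s / 2)))"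
proof -
  define a b where "a = (\<lambda>u::real. u powr (s + 1 - 1) / (1 + u ^ 2))" and "b = (\<lambda>u::real. u powr (s + 2 - 1) / (1 + u ^ 2))"
  have a: "integrable pos_lborel a" "pos_integral a = pi / (2 * cos (pi * s / 2))"
  proof -
    have "sin (pi * (s + 1) / 2) = cos (pi * s / 2)"
      by (simp add: distrib_left add_divide_distrib sin_add)
    thus "integrable pos_lborel a" "pos_integral a = pi / (2 * cos (pi * s / 2))"
      using beta_pos_integral_square[of "s + 1"] s by (simp_all add: a_def)
  qed
  have b: "integrable pos_lborel b" "pos_integral b = - (pi / (2 * sin (pi * s / 2)))"
  proof -
    have "sin (pi * (s + 2) / 2) = - sin (pi * s / 2)"
      by (simp add: distrib_left add_divide_distrib)
    thus "integrable pos_lborel b" "pos_integral b = - (pi / (2 * sin (pi * s / 2)))"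
      using beta_pos_integral_square[of "s + 2"] s by (simp_all add: b_def)
  qed
  have eq: "of_real t powr (of_real s - 1) * cauchy_kernel c t = of_real (a t) - c * of_real (b t)"
    if "t > 0" "c = \<i> \<or> c = - \<i>" for t c
  proof -
    have cc: "c * c = - 1" using that by auto
    have nz: "1 + c * of_real t \<noteq> 0" using that by (auto simp: complex_eq_iff)
    have nz2: "complex_of_real (1 + t ^ 2) \<noteq> 0"
      using add_pos_nonneg[of 1 "t ^ 2"] by (simp only: of_real_eq_0_iff) simp
    have p: "(1 + c * of_real t) * (1 - c * of_real t) = of_real (1 + t ^ 2)"
    proof -
      have "(1 + c * of_real t) * (1 - c * of_real t) = 1 - (c * c) * of_real t ^ 2"
        by (simp add: power2_eq_square algebra_simps)
      thus ?thesis by (simp add: cc)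
    qed
    have ck: "cauchy_kernel c t = of_real t * (1 - c * of_real t) / of_real (1 + t ^ 2)"
      unfolding cauchy_kernel_def using nz nz2 p by (simp add: divide_eq_eq eq_divide_eq mult_ac)
    have pw: "complex_of_real t powr (of_real s - 1) = of_real (t powr (s - 1))"
      using that powr_of_real[of t "s - 1"] by simp
    have t1: "t powr (s - 1) * t = t powr s" and t2: "t powr s * t = t powr (s + 1)"
      using that by (simp_all add: powr_diff powr_add)
    have "of_real t powr (of_real s - 1) * cauchy_kernel c t =
        of_real (t powr (s - 1) * t) / of_real (1 + t ^ 2) - c * (of_real (t powr (s - 1) * t * t) / of_real (1 + t ^ 2))"
      unfolding ck pw by (simp add: right_diff_distrib diff_divide_distrib mult_ac)
    also have "\<dots> = of_real (a t) - c * of_real (b t)"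
    proof -
      have "a t = t powr s / (1 + t ^ 2)" "b t = t powr (s + 1) / (1 + t ^ 2)"
        by (simp_all add: a_def b_def add_ac)
      thus ?thesis by (simp only: t1 t2 of_real_divide)
    qed
    finally show ?thesis .
  qed
  have *: "pos_integral (\<lambda>t. of_real t powr (of_real s - 1) * cauchy_kernel c t) =
      of_real (pos_integral a) - c * of_real (pos_integral b)"
    if c: "c = \<i> \<or> c = - \<i>" for c
  proof -
    have "pos_integral (\<lambda>t. of_real t powr (of_real s - 1) * cauchy_kernel c t) =
        pos_integral (\<lambda>t. of_real (a t) - c * of_real (b t))"
      by (rule pos_lborel_cong(2)) (use eq c in blast)
    also have "\<dots> = of_real (pos_integral a) - c * of_real (pos_integral b)"
      using a b by (subst Bochner_Integration.integral_diff) (auto intro!: integrable_of_real)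
    finally show ?thesis .
  qed
  show "pos_integral (\<lambda>t. of_real t powr (of_real s - 1) * cauchy_kernel \<i> t) =
           of_real (pi / (2 * cos (pi * s / 2))) + \<i> * of_real (pi / (2 * sin (pi * s / 2)))"
    "pos_integral (\<lambda>t. of_real t powr (of_real s - 1) * cauchy_kernel (- \<i>) t) =
           of_real (pi / (2 * cos (pi * s / 2))) - \<i> * of_real (pi / (2 * sin (pi * s / 2)))"
    using *[of \<i>] *[of "- \<i>"] a b by simp_all
qed

text \<open>With h = pi s / 2 both transforms contain the factor pi / (2 sin h cos h) = pi / sin (pi
  s) = Gamma s * Gamma (1 - s), so Gamma s cancels against the left-hand side.\<close>

lemma hurwitz_functional_equation_real:
  fixes s :: real
  assumes x: "0 < x" "x < 1" and m: "m > 0" and root: "cis (2 * pi * x) ^ m = 1"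
    and s: "-1 < s" "s < 0"
  shows "(\<Sum>k=1..m. cis (2 * pi * x) ^ k * hurwitz_zeta (of_real s) (of_real (real k / real m))) =
         of_nat m powr of_real s * (of_real (2 * pi) powr (of_real s - 1) * (Gamma (1 - of_real s) *
           (\<i> * exp (- \<i> * of_real (pi * s / 2)) * hurwitz_zeta (1 - of_real s) (of_real x) -
            \<i> * exp (\<i> * of_real (pi * s / 2)) * hurwitz_zeta (1 - of_real s) (of_real (1 - x)))))"
proof -
  define z where "z = complex_of_real s"
  have z: "-1 < Re z" "Re z < 0" using s by (auto simp: z_def)
  define S where "S = (\<Sum>k=1..m. cis (2 * pi * x) ^ k * hurwitz_zeta z (of_real (real k / real m)))"
  define h where "h = pi * s / 2"
  have h: "cos h > 0" "sin h < 0"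
  proof -
    have "pi * (-1) < pi * s" using s by (intro mult_strict_left_mono) auto
    hence hb: "- pi / 2 < h" "h < 0" using s pi_gt_zero unfolding h_def
      by (simp_all add: mult_less_0_iff)
    show "cos h > 0" by (rule cos_gt_zero_pi) (use hb in auto)
    show "sin h < 0" using sin_gt_zero[of "- h"] hb by simp
  qed
  have Kalg: "of_real (pi / (2 * cos h)) + \<i> * of_real (pi / (2 * sin h)) =
      of_real (pi / (2 * sin h * cos h)) * (\<i> * exp (- \<i> * of_real h))"
    "of_real (pi / (2 * cos h)) - \<i> * of_real (pi / (2 * sin h)) =
      of_real (pi / (2 * sin h * cos h)) * (- \<i> * exp (\<i> * of_real h))"
  proof -
    have e: "exp (\<i> * of_real h) = cis h" "exp (- \<i> * of_real h) = cis (- h)"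
      by (simp_all add: cis_conv_exp)
    show "of_real (pi / (2 * cos h)) + \<i> * of_real (pi / (2 * sin h)) =
      of_real (pi / (2 * sin h * cos h)) * (\<i> * exp (- \<i> * of_real h))"
      "of_real (pi / (2 * cos h)) - \<i> * of_real (pi / (2 * sin h)) =
      of_real (pi / (2 * sin h * cos h)) * (- \<i> * exp (\<i> * of_real h))"
      unfolding e using h by (simp_all add: complex_eq_iff)
  qed
  have G: "Gamma z * Gamma (1 - z) = of_real (pi / (2 * sin h * cos h))"
  proof -
    have "sin (of_real pi * z) = complex_of_real (sin (2 * h))"
      unfolding z_def h_def sin_of_real[symmetric] by simp
    thus ?thesis using Gamma_reflection_complex[of z] by (simp add: sin_double)
  qed
  have Gz: "Gamma z \<noteq> 0" using not_nonpos_Int_strip(1)[OF z] by (simp add: Gamma_eq_zero_iff)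
  have "Gamma z * S = of_nat m powr z * (of_real (2 * pi) powr (z - 1) *
      (Gamma z * Gamma (1 - z) * (\<i> * exp (- \<i> * of_real h)) * hurwitz_zeta (1 - z) (of_real x) +
       Gamma z * Gamma (1 - z) * (- \<i> * exp (\<i> * of_real h)) * hurwitz_zeta (1 - z) (of_real (1 - x))))"
    unfolding S_def sum_roots_hurwitz_zeta_mellin[OF x m root z] mellin_fourier_kernel[OF x z] G
    unfolding z_def mellin_cauchy_kernel[OF s] h_def[symmetric] Kalg ..
  also have "\<dots> = Gamma z * (of_nat m powr z * (of_real (2 * pi) powr (z - 1) * (Gamma (1 - z) *
           (\<i> * exp (- \<i> * of_real h) * hurwitz_zeta (1 - z) (of_real x) -
            \<i> * exp (\<i> * of_real h) * hurwitz_zeta (1 - z) (of_real (1 - x))))))"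
    by (simp add: algebra_simps)
  finally have "S = of_nat m powr z * (of_real (2 * pi) powr (z - 1) * (Gamma (1 - z) *
           (\<i> * exp (- \<i> * of_real h) * hurwitz_zeta (1 - z) (of_real x) -
            \<i> * exp (\<i> * of_real h) * hurwitz_zeta (1 - z) (of_real (1 - x)))))"
    using Gz by (simp only: mult_cancel_left simp_thms)
  thus ?thesis by (simp only: S_def h_def z_def)
qed

text \<open>The real equation times s * (s - 1): these factors are absorbed into
  \<open>hurwitz_entire\<close> at s and at 1 - s and into \<open>Gamma (2 - s)\<close>, so both
  sides are holomorphic on Re s < 2 and s = 1 becomes an interior point.\<close>

theorem hurwitz_functional_equation:
  assumes x: "0 < x" "x < 1" and m: "m > 0" and root: "cis (2 * pi * x) ^ m = 1" and s: "Re s < 2"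
  shows "s * (\<Sum>k=1..m. cis (2 * pi * x) ^ k * hurwitz_entire (real k / real m) s) =
         of_nat m powr s * of_real (2 * pi) powr (s - 1) * Gamma (2 - s) *
           (\<i> * exp (- \<i> * of_real (pi / 2) * s) * hurwitz_entire x (1 - s) -
            \<i> * exp (\<i> * of_real (pi / 2) * s) * hurwitz_entire (1 - x) (1 - s))"
    (is "?L s = ?R s")
proof -
  have "?L s - ?R s = 0"
  \<comment> \<open>Agreement is known on the real segment (-1, 0), which has the limit point
    -1/2.\<close>
  proof (rule analytic_continuation[where f = "\<lambda>s. ?L s - ?R s" and S = "{s. Re s < 2}"
        and U = "complex_of_real ` {-1<..<0}" and \<xi> = "of_real (-1/2)"])
    have "2 - s \<notin> \<int>\<^sub>\<le>\<^sub>0" if "Re s < 2" for s using that by (intro Re_gt_not_nonpos_Int) auto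
    thus "(\<lambda>s. ?L s - ?R s) holomorphic_on {s. Re s < 2}"
      using x m by (intro holomorphic_intros) auto
    show "connected {s. Re s < 2}" by (rule convex_connected[OF convex_halfspace_Re_lt])
    have "(-1/2 :: real) islimpt {-1<..<0}" by (rule open_imp_islimpt) auto
    hence "complex_of_real (-1/2) islimpt complex_of_real ` {-1<..<0}"
      unfolding islimpt_sequential
    proof (elim exE conjE)
      fix f assume f: "\<forall>n. f n \<in> {-1<..<0} - {-1/2::real}" "f \<longlonglongrightarrow> -1/2"
      have 1: "(\<lambda>n. complex_of_real (f n)) \<longlonglongrightarrow> of_real (-1/2)"
        by (intro tendsto_of_real f)
      have 2: "complex_of_real (f n) \<in> complex_of_real ` {-1<..<0} - {complex_of_real (-1/2)}" for n
      proof (rule DiffI)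
        show "complex_of_real (f n) \<in> complex_of_real ` {-1<..<0}"
          using f(1) by (intro imageI) auto
        have "f n \<noteq> -1/2" using f(1) by auto
        thus "complex_of_real (f n) \<notin> {complex_of_real (-1/2)}" by (simp only: singleton_iff of_real_eq_iff not_False_eq_True)
      qed
      show "\<exists>f. (\<forall>n. f n \<in> complex_of_real ` {-1<..<0} - {complex_of_real (-1/2)}) \<and> f \<longlonglongrightarrow> complex_of_real (-1/2)"
        by (intro exI[of _ "\<lambda>n. complex_of_real (f n)"] conjI allI 1 2)
    qed
    thus "complex_of_real (-1/2) islimpt complex_of_real ` {-1<..<0}" .
  next
    fix w assume "w \<in> complex_of_real ` {-1<..<0}"
    then obtain t where t: "w = of_real t" "-1 < t" "t < 0" by auto
    have w: "w \<noteq> 0" "w - 1 \<noteq> 0" "1 - w \<notin> \<int>\<^sub>\<le>\<^sub>0"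
    proof -
      show "1 - w \<notin> \<int>\<^sub>\<le>\<^sub>0" by (rule Re_gt_not_nonpos_Int) (use t in auto)
    qed (use t in \<open>auto simp: complex_eq_iff\<close>)
    define A where "A = of_nat m powr w"
    define B where "B = of_real (2 * pi) powr (w - 1)"
    define e1 where "e1 = \<i> * exp (- \<i> * of_real (pi / 2) * w)"
    define e2 where "e2 = \<i> * exp (\<i> * of_real (pi / 2) * w)"
    have E1: "hurwitz_entire v w = (w - 1) * hurwitz_zeta w (of_real v)" if "v > 0" for v
      using w by (simp add: hurwitz_zeta_conv_entire[OF that])
    have E2: "hurwitz_entire v (1 - w) = - w * hurwitz_zeta (1 - w) (of_real v)" if "v > 0" for v
      using w by (simp add: hurwitz_zeta_conv_entire[OF that])
    have G: "Gamma (2 - w) = (1 - w) * Gamma (1 - w)"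
      using Gamma_plus1[OF w(3)] by simp
    have "?L w = w * ((w - 1) * (\<Sum>k=1..m. cis (2 * pi * x) ^ k * hurwitz_zeta w (of_real (real k / real m))))"
      unfolding sum_distrib_left by (intro sum.cong refl) (use m E1 in auto)
    also have "(\<Sum>k=1..m. cis (2 * pi * x) ^ k * hurwitz_zeta w (of_real (real k / real m))) =
        A * (B * (Gamma (1 - w) * (e1 * hurwitz_zeta (1 - w) (of_real x) - e2 * hurwitz_zeta (1 - w) (of_real (1 - x)))))"
      unfolding t(1) A_def B_def e1_def e2_def
      by (subst hurwitz_functional_equation_real[OF x m root t(2,3)]) (simp add: mult.assoc)
    also have "w * ((w - 1) * \<dots>) = A * B * ((1 - w) * Gamma (1 - w)) *
        (e1 * (- w * hurwitz_zeta (1 - w) (of_real x)) - e2 * (- w * hurwitz_zeta (1 - w) (of_real (1 - x))))"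
      by (simp add: algebra_simps)
    also have "\<dots> = ?R w"
      unfolding A_def[symmetric] B_def[symmetric] e1_def[symmetric] e2_def[symmetric] G
      using x by (simp add: E2)
    finally show "?L w - ?R w = 0" by simp
  qed (use s in \<open>auto simp: open_halfspace_Re_lt\<close>)
  thus ?thesis by simp
qed

text \<open>This is zeta(1 + u, v) - 1 / u, filled in at u = 0; its Taylor coefficients are the
  Stieltjes constants up to the factors (-1)^n / n!.\<close>

definition zeta_regular :: "real \<Rightarrow> complex \<Rightarrow> complex" where
  "zeta_regular v u = (if u = 0 then deriv (hurwitz_entire v) 1 else (hurwitz_entire v (1 + u) - 1) / u)"

lemma
  assumes v: "v > 0"
  shows hurwitz_entire_zeta_regular: "hurwitz_entire v (1 + u) = 1 + u * zeta_regular v u"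
    and holomorphic_zeta_regular: "zeta_regular v holomorphic_on A"
    and zeta_regular_0: "zeta_regular v 0 = - Digamma (of_real v)"
proof -
  show "hurwitz_entire v (1 + u) = 1 + u * zeta_regular v u"
    using v by (simp add: zeta_regular_def)
  show "zeta_regular v 0 = - Digamma (of_real v)"
    using hurwitz_entire_deriv_1[OF v] by (simp add: zeta_regular_def DERIV_imp_deriv)
  have h: "(\<lambda>u. hurwitz_entire v (1 + u)) holomorphic_on UNIV"
    using v by (intro holomorphic_intros)
  have d: "deriv (\<lambda>u. hurwitz_entire v (1 + u)) 0 = deriv (hurwitz_entire v) 1"
  proof -
    have "(hurwitz_entire v has_field_derivative deriv (hurwitz_entire v) 1) (at (0 + 1))"
      using holomorphic_derivI[OF holomorphic_hurwitz_entire_UNIV[OF v], of 1 UNIV] by simp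
    hence "((\<lambda>u. hurwitz_entire v (u + 1)) has_field_derivative deriv (hurwitz_entire v) 1) (at 0)"
      by (subst (asm) DERIV_shift)
    hence "((\<lambda>u. hurwitz_entire v (1 + u)) has_field_derivative deriv (hurwitz_entire v) 1) (at 0)"
      by (simp only: add.commute)
    thus ?thesis by (rule DERIV_imp_deriv)
  qed
  have "(\<lambda>u. if u = 0 then deriv (\<lambda>u. hurwitz_entire v (1 + u)) 0
           else (hurwitz_entire v (1 + u) - hurwitz_entire v (1 + 0)) / (u - 0)) holomorphic_on UNIV"
    by (rule pole_lemma_open[OF h]) auto
  also have "(\<lambda>u. if u = 0 then deriv (\<lambda>u. hurwitz_entire v (1 + u)) 0
           else (hurwitz_entire v (1 + u) - hurwitz_entire v (1 + 0)) / (u - 0)) = zeta_regular v"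
    using v by (auto simp: zeta_regular_def d fun_eq_iff)
  finally show "zeta_regular v holomorphic_on A" by (rule holomorphic_on_subset) auto
qed

lemma stieltjes_1_eq:
  assumes v: "v > 0"
  shows "stieltjes 1 (of_real v) = - deriv (zeta_regular v) 0"
proof -
  have "zeta_regular v has_fps_expansion fps_expansion (zeta_regular v) 0"
    by (rule has_fps_expansion_fps_expansion[of UNIV]) (auto simp: holomorphic_zeta_regular[OF v])
  hence "(\<lambda>u. inverse u + zeta_regular v u) has_laurent_expansion
           (fls_X_inv + fps_to_fls (fps_expansion (zeta_regular v) 0))"
    by (intro laurent_expansion_intros has_laurent_expansion_fps)
  also have "?this \<longleftrightarrow> (\<lambda>u. hurwitz_zeta (1 + u) (of_real v)) has_laurent_expansion
           (fls_X_inv + fps_to_fls (fps_expansion (zeta_regular v) 0))"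
  proof (rule has_laurent_expansion_cong)
    show "eventually (\<lambda>u. inverse u + zeta_regular v u = hurwitz_zeta (1 + u) (of_real v)) (at 0)"
      using eventually_neq_at_within[of 0]
      by eventually_elim (simp add: hurwitz_zeta_conv_entire[OF v] hurwitz_entire_zeta_regular[OF v] add_divide_distrib inverse_eq_divide)
  qed auto
  finally have "laurent_expansion (\<lambda>s. hurwitz_zeta s (of_real v)) 1 =
      fls_X_inv + fps_to_fls (fps_expansion (zeta_regular v) 0)"
    by (rule laurent_expansion_eqI)
  thus ?thesis by (simp add: stieltjes_def fps_expansion_def)
qed

text \<open>Differentiate the identity once and twice at 0. The factor u makes L of order k depend
  on B of order k + 1, and B 0 = 0 drops the highest derivative of A.\<close>

lemma derivs_from_product:
  fixes A B L :: "complex \<Rightarrow> complex"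
  assumes S: "open S" "0 \<in> S"
    and hol: "A holomorphic_on S" "B holomorphic_on S" "L holomorphic_on S"
    and eq: "\<And>u. u \<in> S \<Longrightarrow> u * L u = A u * B u" and B0: "B 0 = 0"
  shows "L 0 = A 0 * deriv B 0"
    and "2 * deriv L 0 = 2 * deriv A 0 * deriv B 0 + A 0 * deriv (deriv B) 0"
proof -
  have d: "(f has_field_derivative deriv f u) (at u)" if "f holomorphic_on S" "u \<in> S" for f u
    by (rule holomorphic_derivI[OF that(1) S(1) that(2)])
  have dd: "deriv f holomorphic_on S" if "f holomorphic_on S" for f
    by (rule holomorphic_deriv[OF that S(1)])
  have 1: "L u + u * deriv L u = deriv A u * B u + A u * deriv B u" if u: "u \<in> S" for u
  proof -
    have "((\<lambda>u. u * L u) has_field_derivative L u + u * deriv L u) (at u)"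
      by (rule derivative_eq_intros d[OF hol(3) u] refl | simp)+
    hence "((\<lambda>u. A u * B u) has_field_derivative L u + u * deriv L u) (at u)"
      by (rule has_field_derivative_transform_within_open[OF _ S(1) u]) (use eq in auto)
    moreover have "((\<lambda>u. A u * B u) has_field_derivative deriv A u * B u + A u * deriv B u) (at u)"
      using DERIV_mult[OF d[OF hol(1) u] d[OF hol(2) u]] by (simp add: algebra_simps)
    ultimately show ?thesis by (rule DERIV_unique)
  qed
  show "L 0 = A 0 * deriv B 0" using 1[OF S(2)] B0 by simp
  have "((\<lambda>u. L u + u * deriv L u) has_field_derivative deriv L 0 + deriv L 0) (at 0)"
    by (rule derivative_eq_intros d[OF hol(3) S(2)] d[OF dd[OF hol(3)] S(2)] refl | simp)+
  hence "((\<lambda>u. deriv A u * B u + A u * deriv B u) has_field_derivative deriv L 0 + deriv L 0) (at 0)"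
    by (rule has_field_derivative_transform_within_open[OF _ S]) (use 1 in auto)
  moreover have "((\<lambda>u. deriv A u * B u + A u * deriv B u) has_field_derivative
      (deriv (deriv A) 0 * B 0 + deriv B 0 * deriv A 0) + (deriv A 0 * deriv B 0 + deriv (deriv B) 0 * A 0)) (at 0)"
    by (intro DERIV_add DERIV_mult d dd hol S)
  ultimately have "deriv L 0 + deriv L 0 =
      (deriv (deriv A) 0 * B 0 + deriv B 0 * deriv A 0) + (deriv A 0 * deriv B 0 + deriv (deriv B) 0 * A 0)"
    by (rule DERIV_unique)
  thus "2 * deriv L 0 = 2 * deriv A 0 * deriv B 0 + A 0 * deriv (deriv B) 0"
    using B0 by (simp add: algebra_simps)
qed

section \<open>The Fourier modes of the digamma function and of the first Stieltjes constant\<close>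

lemma deriv_deriv_eqI:
  fixes f :: "complex \<Rightarrow> complex"
  assumes S: "open S" "z \<in> S"
    and 1: "\<And>u. u \<in> S \<Longrightarrow> (f has_field_derivative f' u) (at u)"
    and 2: "(f' has_field_derivative D) (at z)"
  shows "deriv f z = f' z" "deriv (deriv f) z = D"
proof -
  have d: "deriv f u = f' u" if "u \<in> S" for u using 1[OF that] by (rule DERIV_imp_deriv)
  thus "deriv f z = f' z" using S by blast
  have "(deriv f has_field_derivative D) (at z)"
    by (rule has_field_derivative_transform_within_open[OF 2 S]) (use d in auto)
  thus "deriv (deriv f) z = D" by (rule DERIV_imp_deriv)
qed

lemma hurwitz_zeta_derivs:
  assumes v: "v > 0"
  defines "Z \<equiv> \<lambda>s. hurwitz_zeta s (of_real v)"
  shows "s \<noteq> 1 \<Longrightarrow> (Z has_field_derivative deriv Z s) (at s)"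
    and "s \<noteq> 1 \<Longrightarrow> (deriv Z has_field_derivative deriv (deriv Z) s) (at s)"
    and "deriv Z 0 = of_real (ln (Gamma v) - ln (2 * pi) / 2)"
    and "deriv (deriv Z) 0 = hurwitz_zeta_deriv2 0 (of_real v)"
proof -
  have h: "Z holomorphic_on - {1}" unfolding Z_def using v by (auto intro!: holomorphic_intros)
  have o: "open (- {1 :: complex})" by auto
  show "(Z has_field_derivative deriv Z s) (at s)" if "s \<noteq> 1"
    by (rule holomorphic_derivI[OF h o]) (use that in auto)
  show "(deriv Z has_field_derivative deriv (deriv Z) s) (at s)" if "s \<noteq> 1"
    by (rule holomorphic_derivI[OF holomorphic_deriv[OF h o] o]) (use that in auto)
  show "deriv Z 0 = of_real (ln (Gamma v) - ln (2 * pi) / 2)"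
    unfolding Z_def by (rule DERIV_imp_deriv[OF lerch_formula[OF v]])
  show "deriv (deriv Z) 0 = hurwitz_zeta_deriv2 0 (of_real v)"
    by (simp add: hurwitz_zeta_deriv2_def Z_def numeral_2_eq_2)
qed

lemma ln_Gamma_reflection:
  assumes "0 < x" "x < (1::real)"
  shows "ln (Gamma x) + ln (Gamma (1 - x)) = ln pi - ln (sin (pi * x))"
proof -
  have "pi * x < pi" using assms by simp
  hence s: "sin (pi * x) > 0" using assms by (intro sin_gt_zero) auto
  have "complex_of_real (Gamma x * Gamma (1 - x)) = of_real (pi / sin (pi * x))"
    using Gamma_reflection_complex[of "of_real x"]
      Gamma_complex_of_real[of x] Gamma_complex_of_real[of "1 - x"]
    by (simp add: sin_of_real flip: of_real_mult)
  hence "Gamma x * Gamma (1 - x) = pi / sin (pi * x)" by (simp only: of_real_eq_iff)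
  hence "ln (Gamma x * Gamma (1 - x)) = ln (pi / sin (pi * x))" by simp
  moreover have "Gamma x > 0" "Gamma (1 - x) > 0" using assms by simp_all
  hence "Gamma x \<noteq> 0" "Gamma (1 - x) \<noteq> 0" by linarith+
  ultimately show ?thesis using s by (simp add: ln_mult ln_div)
qed

text \<open>For 0 < x < 1 this is the principal logarithm of 1 - cis (2 pi x), the quantity in
  Gauss' digamma theorem.\<close>

definition psi_mode :: "real \<Rightarrow> complex" where
  "psi_mode x = of_real (ln 2 + ln (sin (pi * x))) - \<i> * of_real (pi * (1 / 2 - x))"

context
  fixes m :: nat and x :: real
  assumes x: "0 < x" "x < 1" and m: "m > 0" and root: "cis (2 * pi * x) ^ m = 1"
begin

text \<open>The functional equation at s = 1 + u. The poles 1 / u disappear because the powers of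
  the root sum to 0, the factor i is absorbed as exp (-i pi / 2) = -i, and the common factor 1 + u
  cancels.\<close>

lemma sum_roots_zeta_regular:
  fixes u :: complex
  assumes u: "norm u < 1"
  defines "B \<equiv> \<lambda>u. exp (- (\<i> * of_real (pi / 2)) * u) * hurwitz_zeta (- u) (of_real x) +
                  exp (\<i> * of_real (pi / 2) * u) * hurwitz_zeta (- u) (of_real (1 - x))"
  shows "u * (\<Sum>k=1..m. cis (2 * pi * x) ^ k * zeta_regular (real k / real m) u) =
         - (of_nat m powr (1 + u) * of_real (2 * pi) powr u * Gamma (1 - u)) * B u"
proof -
  let ?\<omega> = "cis (2 * pi * x)"
  have S0: "(\<Sum>k=1..m. ?\<omega> ^ k) = 0"
    using geometric_sums_from_1(1)[of ?\<omega> m] cis_2pi_neq_1[OF x] root by simp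
  have u1: "1 + u \<noteq> 0" using u by (metis add_eq_0_iff2 norm_minus_cancel norm_one order_less_irrefl)
  have "Re u < 1" using u complex_Re_le_cmod[of u] by linarith
  hence Re: "Re (1 + u) < 2" by simp
  have E: "hurwitz_entire v (- u) = - (1 + u) * hurwitz_zeta (- u) (of_real v)" if "v > 0" for v
  proof -
    have "- u - 1 = - (1 + u)" by simp
    moreover have "- a * (w / - a) = w" if "a \<noteq> 0" for a w :: complex using that by simp
    from this[OF u1] have "- (1 + u) * (w / (- (1 + u))) = w" for w .
    ultimately show ?thesis by (simp only: hurwitz_zeta_conv_entire[OF that])
  qed
  have e: "\<i> * exp (- \<i> * of_real (pi / 2) * (1 + u)) = exp (- (\<i> * of_real (pi / 2)) * u)"
    "\<i> * exp (\<i> * of_real (pi / 2) * (1 + u)) = - exp (\<i> * of_real (pi / 2) * u)"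
  proof -
    have 1: "exp (\<i> * of_real (pi / 2)) = \<i>" "exp (- (\<i> * of_real (pi / 2))) = - \<i>"
      using exp_eq_polar[of "\<i> * of_real (pi / 2)"] by (simp_all add: exp_minus cis_conv_exp[symmetric])
    have "exp (- \<i> * of_real (pi / 2) * (1 + u)) = exp (- (\<i> * of_real (pi / 2))) * exp (- (\<i> * of_real (pi / 2)) * u)"
      unfolding exp_add[symmetric] by (rule arg_cong[where f = exp]) (simp only: distrib_left mult_1_right mult_minus_left)
    moreover have "exp (\<i> * of_real (pi / 2) * (1 + u)) = exp (\<i> * of_real (pi / 2)) * exp (\<i> * of_real (pi / 2) * u)"
      unfolding exp_add[symmetric] by (rule arg_cong[where f = exp]) (simp only: distrib_left mult_1_right mult_minus_left)
    ultimately show "\<i> * exp (- \<i> * of_real (pi / 2) * (1 + u)) = exp (- (\<i> * of_real (pi / 2)) * u)"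
      "\<i> * exp (\<i> * of_real (pi / 2) * (1 + u)) = - exp (\<i> * of_real (pi / 2) * u)"
      unfolding 1 by (simp_all flip: mult.assoc)
  qed
  have "(\<Sum>k=1..m. ?\<omega> ^ k * hurwitz_entire (real k / real m) (1 + u)) =
        (\<Sum>k=1..m. ?\<omega> ^ k + u * (?\<omega> ^ k * zeta_regular (real k / real m) u))"
    by (intro sum.cong refl, subst hurwitz_entire_zeta_regular) (use m in \<open>auto simp: algebra_simps\<close>)
  also have "\<dots> = u * (\<Sum>k=1..m. ?\<omega> ^ k * zeta_regular (real k / real m) u)"
    using S0 by (simp add: sum.distrib sum_distrib_left)
  finally have "(1 + u) * (u * (\<Sum>k=1..m. ?\<omega> ^ k * zeta_regular (real k / real m) u)) =
      of_nat m powr (1 + u) * of_real (2 * pi) powr u * Gamma (1 - u) *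
           (exp (- (\<i> * of_real (pi / 2)) * u) * hurwitz_entire x (- u) +
            exp (\<i> * of_real (pi / 2) * u) * hurwitz_entire (1 - x) (- u))"
    using hurwitz_functional_equation[OF x m root Re] unfolding e by simp
  also have "\<dots> = (1 + u) * (- (of_nat m powr (1 + u) * of_real (2 * pi) powr u * Gamma (1 - u)) * B u)"
    using x by (simp add: E B_def) (simp add: algebra_simps)
  finally show ?thesis using u1 by (simp only: mult_cancel_left simp_thms)
qed

text \<open>\<open>L 0\<close> and \<open>deriv L 0\<close> are minus the two sums, and
  \<open>derivs_from_product\<close> applies because zeta(0, x) + zeta(0, 1 - x) = 0.\<close>

lemma sum_roots_Digamma_stieltjes:
  shows "(\<Sum>k=1..m. cis (2 * pi * x) ^ k * Digamma (of_real (real k / real m))) = of_nat m * psi_mode x"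
    and "(\<Sum>k=1..m. cis (2 * pi * x) ^ k * stieltjes 1 (of_real (real k / real m))) =
           of_nat m * (of_real (euler_mascheroni + ln (2 * pi * real m)) * psi_mode x +
             (\<i> * of_real (pi * (ln (Gamma x) - ln (Gamma (1 - x)))) +
              hurwitz_zeta_deriv2 0 (of_real x) + hurwitz_zeta_deriv2 0 (of_real (1 - x))) / 2)"
proof -
  let ?\<omega> = "cis (2 * pi * x)"
  let ?S = "ball (0::complex) 1"
  define c where "c = \<i> * complex_of_real (pi / 2)"
  define Z1 where "Z1 = (\<lambda>s. hurwitz_zeta s (of_real x))"
  define Z2 where "Z2 = (\<lambda>s. hurwitz_zeta s (of_real (1 - x)))"
  have x': "1 - x > 0" using x by simp
  define A where "A = (\<lambda>u::complex. - (of_nat m powr (1 + u) * of_real (2 * pi) powr u * Gamma (1 - u)))"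
  define B where "B = (\<lambda>u. exp (- c * u) * Z1 (- u) + exp (c * u) * Z2 (- u))"
  define L where "L = (\<lambda>u. \<Sum>k=1..m. ?\<omega> ^ k * zeta_regular (real k / real m) u)"
  have uneq: "- u \<noteq> 1" if "u \<in> ?S" for u
  proof
    assume "- u = 1"
    hence "norm u = 1" by (metis norm_minus_cancel norm_one)
    thus False using that by simp
  qed
  have holA: "A holomorphic_on ?S"
  proof -
    have "1 - u \<notin> \<int>\<^sub>\<le>\<^sub>0" if "u \<in> ?S" for u
      using that complex_Re_le_cmod[of u] by (intro Re_gt_not_nonpos_Int) auto
    thus ?thesis unfolding A_def using m by (intro holomorphic_intros) auto
  qed
  have holB: "B holomorphic_on ?S"
    unfolding B_def Z1_def Z2_def using x x' uneq by (intro holomorphic_intros) auto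
  have holL: "L holomorphic_on ?S"
    unfolding L_def using m by (intro holomorphic_intros holomorphic_zeta_regular) auto
  have eq: "u * L u = A u * B u" if "u \<in> ?S" for u
    using sum_roots_zeta_regular[of u] that by (simp add: L_def A_def B_def c_def Z1_def Z2_def)
  have B0: "B 0 = 0"
    using x x' hurwitz_zeta_0[of x] hurwitz_zeta_0[of "1 - x"] by (simp add: B_def Z1_def Z2_def)
  define B' where "B' = (\<lambda>u. exp (- c * u) * (- c * Z1 (- u) - deriv Z1 (- u)) + exp (c * u) * (c * Z2 (- u) - deriv Z2 (- u)))"
  define B2 where "B2 = c\<^sup>2 * Z1 0 + 2 * c * deriv Z1 0 + deriv (deriv Z1) 0 + (c\<^sup>2 * Z2 0 - 2 * c * deriv Z2 0 + deriv (deriv Z2) 0)"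
  have dneg: "((\<lambda>u. f (- u)) has_field_derivative - D) (at u)" if "(f has_field_derivative D) (at (- u))"
    for f :: "complex \<Rightarrow> complex" and D u
    using DERIV_chain2[where f = f and g = uminus, OF that DERIV_minus[OF DERIV_ident]] by simp
  note Z1d = hurwitz_zeta_derivs[OF x(1), folded Z1_def]
  note Z2d = hurwitz_zeta_derivs[OF x', folded Z2_def]
  have dB1: "(B has_field_derivative B' u) (at u)" if u: "u \<in> ?S" for u
  proof -
    note d = dneg[OF Z1d(1)[OF uneq[OF u]]] dneg[OF Z2d(1)[OF uneq[OF u]]]
    show ?thesis unfolding B_def B'_def
      by (rule derivative_eq_intros d refl | simp add: algebra_simps)+
  qed
  have dB2: "(B' has_field_derivative B2) (at 0)"
  proof -
    have d: "((\<lambda>u. Z1 (- u)) has_field_derivative - deriv Z1 0) (at 0)"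
      "((\<lambda>u. Z2 (- u)) has_field_derivative - deriv Z2 0) (at 0)"
      "((\<lambda>u. deriv Z1 (- u)) has_field_derivative - deriv (deriv Z1) 0) (at 0)"
      "((\<lambda>u. deriv Z2 (- u)) has_field_derivative - deriv (deriv Z2) 0) (at 0)"
      using dneg[of Z1 _ 0] dneg[of Z2 _ 0] dneg[of "deriv Z1" _ 0] dneg[of "deriv Z2" _ 0]
        Z1d(1,2)[of 0] Z2d(1,2)[of 0] by simp_all
    show ?thesis unfolding B'_def B2_def
      by (rule derivative_eq_intros d refl | simp add: algebra_simps power2_eq_square)+
  qed
  have derB: "deriv B 0 = B' 0" "deriv (deriv B) 0 = B2"
    by (rule deriv_deriv_eqI[of ?S, OF _ _ dB1 dB2]; simp)+
  \<comment> \<open>Lerch's formula and the reflection formula combine to ln (2 sin (pi x)); zeta(0,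
    x) - zeta(0, 1 - x) = 1 - 2 x supplies the imaginary part.\<close>
  have B'0: "B' 0 = psi_mode x"
  proof -
    have "B' 0 = - c * of_real (1 - 2 * x) - of_real (ln (Gamma x) + ln (Gamma (1 - x)) - ln (2 * pi))"
    proof -
      have Z: "Z1 0 = 1 / 2 - of_real x" "Z2 0 = of_real x - 1 / 2"
        using x hurwitz_zeta_0[of x] hurwitz_zeta_0[of "1 - x"] by (simp_all add: Z1_def Z2_def)
      show ?thesis unfolding B'_def Z1d(3) Z2d(3) minus_zero Z by (simp add: algebra_simps)
    qed
    also have "\<dots> = psi_mode x"
      unfolding ln_Gamma_reflection[OF x] by (simp add: psi_mode_def c_def ln_mult complex_eq_iff field_simps)
    finally show ?thesis .
  qed
  have B2: "B2 = \<i> * of_real (pi * (ln (Gamma x) - ln (Gamma (1 - x)))) +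
              hurwitz_zeta_deriv2 0 (of_real x) + hurwitz_zeta_deriv2 0 (of_real (1 - x))"
  proof -
    \<comment> \<open>This cancels the terms with the square of c; the terms linear in c leave the
      difference of the two values of ln Gamma.\<close>
    have "Z1 0 + Z2 0 = 0" using B0 by (simp add: B_def)
    hence "c\<^sup>2 * Z1 0 + c\<^sup>2 * Z2 0 = 0" by (metis distrib_left mult_zero_right)
    hence "B2 = 2 * c * (deriv Z1 0 - deriv Z2 0) + deriv (deriv Z1) 0 + deriv (deriv Z2) 0"
      by (simp add: B2_def algebra_simps)
    thus ?thesis by (simp add: Z1d(3,4) Z2d(3,4) c_def)
  qed
  have A0: "A 0 = - of_nat m" using m by (simp add: A_def)
  \<comment> \<open>The constant is the logarithmic derivative of \<open>A\<close> at 0: m^(1+u), (2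
    pi)^u and Gamma (1 - u) contribute ln m, ln (2 pi) and Euler's constant.\<close>
  have A': "deriv A 0 = - of_nat m * of_real (euler_mascheroni + ln (2 * pi * real m))"
  proof (rule DERIV_imp_deriv)
    have G: "((\<lambda>u. Gamma (1 - u)) has_field_derivative euler_mascheroni) (at (0 :: complex))"
    proof -
      have "(Gamma has_field_derivative Gamma 1 * Digamma 1) (at (1 - 0 :: complex))"
        using has_field_derivative_Gamma[of "1 :: complex"] by simp
      from DERIV_chain2[where f = Gamma and g = "\<lambda>u. 1 - u", OF this DERIV_diff[OF DERIV_const DERIV_ident]]
      show ?thesis by simp
    qed
    have P1: "((\<lambda>u. complex_of_real (real m) powr (1 + u)) has_field_derivative of_real (ln (real m)) * of_nat m) (at 0)"
      by (rule derivative_eq_intros refl | (use m in simp))+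
    have P2: "((\<lambda>u. complex_of_real (2 * pi) powr u) has_field_derivative of_real (ln (2 * pi))) (at 0)"
      by (rule derivative_eq_intros refl | simp)+
    have "((\<lambda>u. - (complex_of_real (real m) powr (1 + u) * of_real (2 * pi) powr u * Gamma (1 - u))) has_field_derivative
       - ((of_real (ln (real m)) * of_nat m * of_real (2 * pi) powr 0 + of_real (ln (2 * pi)) * of_real (real m) powr (1 + 0)) * Gamma (1 - 0) +
          euler_mascheroni * (of_real (real m) powr (1 + 0) * of_real (2 * pi) powr 0))) (at 0)"
      by (intro DERIV_minus DERIV_mult P1 P2 G)
    also have "(\<lambda>u. - (of_real (real m) powr (1 + u) * of_real (2 * pi) powr u * Gamma (1 - u))) = A"
      by (simp add: A_def)
    also have "- ((of_real (ln (real m)) * of_nat m * of_real (2 * pi) powr 0 + of_real (ln (2 * pi)) * of_real (real m) powr (1 + 0)) * Gamma (1 - 0) +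
          euler_mascheroni * (of_real (real m) powr (1 + 0) * of_real (2 * pi) powr 0)) =
        - of_nat m * complex_of_real (euler_mascheroni + ln (2 * pi * real m))"
      using m by (simp add: ln_mult algebra_simps)
    finally show "(A has_field_derivative - of_nat m * of_real (euler_mascheroni + ln (2 * pi * real m))) (at 0)" .
  qed
  note main = derivs_from_product[OF open_ball _ holA holB holL eq B0, simplified derB A0 A' B'0]
  have L0: "L 0 = - of_nat m * psi_mode x" by (rule main(1)) auto
  have L1: "deriv L 0 = - of_nat m * of_real (euler_mascheroni + ln (2 * pi * real m)) * psi_mode x - of_nat m * B2 / 2"
  proof -
    have "2 * deriv L 0 = 2 * (- of_nat m * of_real (euler_mascheroni + ln (2 * pi * real m))) * psi_mode x + - of_nat m * B2"
      by (rule main(2)) auto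
    hence eq: "2 * deriv L 0 = 2 * (- of_nat m * of_real (euler_mascheroni + ln (2 * pi * real m)) * psi_mode x) + - (of_nat m * B2)"
      by (simp only: mult.assoc mult_minus_left)
    have "d = a - e / 2" if "2 * d = 2 * a + - e" for a d e :: complex
      using that by (simp add: field_simps)
    from this[OF eq] show ?thesis .
  qed
  have "L 0 = - (\<Sum>k=1..m. ?\<omega> ^ k * Digamma (of_real (real k / real m)))"
    unfolding L_def sum_negf[symmetric] using m by (intro sum.cong refl) (auto simp: zeta_regular_0)
  thus "(\<Sum>k=1..m. ?\<omega> ^ k * Digamma (of_real (real k / real m))) = of_nat m * psi_mode x"
    using L0 by simp
  have "deriv L 0 = (\<Sum>k=1..m. ?\<omega> ^ k * deriv (zeta_regular (real k / real m)) 0)"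
    unfolding L_def
    by (intro DERIV_imp_deriv DERIV_sum DERIV_cmult holomorphic_derivI[OF holomorphic_zeta_regular[where A = UNIV]]) (use m in auto)
  also have "\<dots> = - (\<Sum>k=1..m. ?\<omega> ^ k * stieltjes 1 (of_real (real k / real m)))"
    unfolding sum_negf[symmetric] by (intro sum.cong refl, subst stieltjes_1_eq) (use m in auto)
  finally show "(\<Sum>k=1..m. ?\<omega> ^ k * stieltjes 1 (of_real (real k / real m))) =
           of_nat m * (of_real (euler_mascheroni + ln (2 * pi * real m)) * psi_mode x +
             (\<i> * of_real (pi * (ln (Gamma x) - ln (Gamma (1 - x)))) +
              hurwitz_zeta_deriv2 0 (of_real x) + hurwitz_zeta_deriv2 0 (of_real (1 - x))) / 2)"
    using L1 unfolding B2 by (simp add: algebra_simps)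
qed

end

section \<open>Summation over the modes\<close>

text \<open>The mode l = 0: at s = 1 + u the multiplication formula, freed of its poles, reads u * L
  u = m * (m^u (1 + u g u) - 1), where g 0 is Euler's constant and g' 0 is minus
  \<open>stieltjes 1 1\<close>.\<close>

lemma sum_Digamma_stieltjes:
  assumes m: "m > 0"
  shows "(\<Sum>k=1..m. Digamma (of_real (real k / real m))) =
           - of_nat m * complex_of_real (euler_mascheroni + ln (real m))"
    and "(\<Sum>k=1..m. stieltjes 1 (of_real (real k / real m))) =
           of_nat m * (stieltjes 1 1 - of_real (euler_mascheroni * ln (real m) + ln (real m) ^ 2 / 2))"
proof -
  define g where "g = zeta_regular 1"
  define q where "q = complex_of_real (ln (real m))"
  define L where "L = (\<lambda>u. \<Sum>k=1..m. zeta_regular (real k / real m) u)"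
  define B where "B = (\<lambda>u. of_real (real m) powr u * (1 + u * g u) - 1)"
  define B' where "B' = (\<lambda>u. q * of_real (real m) powr u * (1 + u * g u) + of_real (real m) powr u * (g u + u * deriv g u))"
  have holg: "g holomorphic_on UNIV" unfolding g_def by (rule holomorphic_zeta_regular) auto
  have dg: "(g has_field_derivative deriv g u) (at u)" for u by (rule holomorphic_derivI[OF holg]) auto
  have ddg: "(deriv g has_field_derivative deriv (deriv g) u) (at u)" for u
    by (rule holomorphic_derivI[OF holomorphic_deriv[OF holg]]) auto
  have eq: "u * L u = of_nat m * B u" for u
  proof -
    have "(\<Sum>k=1..m. hurwitz_entire (real k / real m) (1 + u)) = (\<Sum>k=1..m. 1 + u * zeta_regular (real k / real m) u)"
      by (intro sum.cong refl hurwitz_entire_zeta_regular) (use m in auto)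
    also have "\<dots> = of_nat m + u * L u" by (simp add: L_def sum.distrib sum_distrib_left)
    finally have "of_nat m + u * L u = of_nat m powr (1 + u) * hurwitz_entire 1 (1 + u)"
      unfolding sum_hurwitz_entire[OF m] ..
    also have "\<dots> = of_nat m * (of_nat m powr u * (1 + u * g u))"
      using m hurwitz_entire_zeta_regular[of 1 u] by (simp add: g_def powr_add)
    finally show ?thesis by (simp add: B_def algebra_simps)
  qed
  have g0: "g 0 = euler_mascheroni" using zeta_regular_0[of 1] by (simp add: g_def)
  have g1: "deriv g 0 = - stieltjes 1 1" using stieltjes_1_eq[of 1] by (simp add: g_def)
  have dB: "(B has_field_derivative B' u) (at u)" for u
    unfolding B_def B'_def q_def
    by (rule derivative_eq_intros dg refl | (use m in \<open>simp add: algebra_simps\<close>))+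
  have dB': "(B' has_field_derivative q * (q + 2 * g 0) + 2 * deriv g 0) (at 0)"
    unfolding B'_def q_def
    by (rule derivative_eq_intros dg ddg refl | (use m in \<open>simp add: algebra_simps\<close>))+
  have derB: "deriv B 0 = q + g 0" "deriv (deriv B) 0 = q * (q + 2 * g 0) + 2 * deriv g 0"
    using deriv_deriv_eqI[of UNIV 0 B B', OF _ _ dB dB'] m by (simp_all add: B'_def)
  have holB: "B holomorphic_on UNIV" using dB by (auto simp: holomorphic_on_def field_differentiable_def)
  have holL: "L holomorphic_on UNIV"
    unfolding L_def using m by (intro holomorphic_intros holomorphic_zeta_regular) auto
  have B0: "B 0 = 0" using m by (simp add: B_def)
  note main = derivs_from_product[of UNIV "\<lambda>_. of_nat m" B L, OF _ _ _ holB holL eq B0, unfolded derB]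
  have L0: "L 0 = of_nat m * (q + g 0)" by (rule main(1)) auto
  have "2 * deriv L 0 = 2 * deriv (\<lambda>_. of_nat m) 0 * (q + g 0) + of_nat m * (q * (q + 2 * g 0) + 2 * deriv g 0)"
    by (rule main(2)) auto
  hence "2 * deriv L 0 = of_nat m * (q * (q + 2 * g 0) + 2 * deriv g 0)" by simp
  moreover have "d = e / 2" if "2 * d = e" for d e :: complex using that by auto
  ultimately have L1: "deriv L 0 = of_nat m * (q * (q + 2 * g 0) + 2 * deriv g 0) / 2" by blast
  have "L 0 = - (\<Sum>k=1..m. Digamma (of_real (real k / real m)))"
    unfolding L_def sum_negf[symmetric] using m by (intro sum.cong refl) (auto simp: zeta_regular_0)
  hence "(\<Sum>k=1..m. Digamma (of_real (real k / real m))) = - L 0" by simp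
  thus "(\<Sum>k=1..m. Digamma (of_real (real k / real m))) =
           - of_nat m * complex_of_real (euler_mascheroni + ln (real m))"
    unfolding L0 g0 q_def by (simp add: algebra_simps)
  have "deriv L 0 = (\<Sum>k=1..m. deriv (zeta_regular (real k / real m)) 0)"
    unfolding L_def
    by (intro DERIV_imp_deriv DERIV_sum holomorphic_derivI[OF holomorphic_zeta_regular[where A = UNIV]]) (use m in auto)
  also have "\<dots> = - (\<Sum>k=1..m. stieltjes 1 (of_real (real k / real m)))"
    unfolding sum_negf[symmetric] by (intro sum.cong refl, subst stieltjes_1_eq) (use m in auto)
  finally have "(\<Sum>k=1..m. stieltjes 1 (of_real (real k / real m))) = - (of_nat m * (q * (q + 2 * g 0) + 2 * deriv g 0) / 2)"
    unfolding L1 by simp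
  also have "\<dots> = of_nat m * (stieltjes 1 1 - of_real (euler_mascheroni * ln (real m) + ln (real m) ^ 2 / 2))"
    unfolding g0 g1 q_def by (simp add: field_simps power2_eq_square)
  finally show "(\<Sum>k=1..m. stieltjes 1 (of_real (real k / real m))) =
           of_nat m * (stieltjes 1 1 - of_real (euler_mascheroni * ln (real m) + ln (real m) ^ 2 / 2))" .
qed

lemma sum_upto_pred:
  fixes f :: "nat \<Rightarrow> 'a :: ab_group_add"
  assumes "m > 0"
  shows "(\<Sum>k=1..m-1. f k) = (\<Sum>k=1..m. f k) - f m"
  using assms by (cases m) auto

text \<open>The multiplication formula is differentiated once and twice at s = 0; the term k = m is
  zeta itself and cancels the highest derivative on the right. The first part is Gauss'
  multiplication formula for Gamma.\<close>

lemma sum_ln_Gamma_zeta_deriv2: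
  assumes m: "m > 0"
  shows "(\<Sum>l=1..m-1. ln (Gamma (real l / real m))) = (real m - 1) / 2 * ln (2 * pi) - ln (real m) / 2"
    and "(\<Sum>l=1..m-1. hurwitz_zeta_deriv2 0 (of_real (real l / real m))) =
           - complex_of_real (ln (real m) ^ 2 / 2 + ln (real m) * ln (2 * pi))"
proof -
  define Z where "Z = (\<lambda>k s. hurwitz_zeta s (of_real (real k / real m)))"
  define Z1 where "Z1 = (\<lambda>s. hurwitz_zeta s (of_real 1))"
  define q where "q = complex_of_real (ln (real m))"
  have "(\<lambda>s. hurwitz_zeta s (of_real (real k / real m))) = Z k" for k
    by (simp add: Z_def)
  note Zd = hurwitz_zeta_derivs[of "real k / real m" for k, unfolded this]
  note Z1d = hurwitz_zeta_derivs[OF zero_less_one, folded Z1_def]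
  define F where "F = (\<lambda>s. of_real (real m) powr s * Z1 s)"
  define F' where "F' = (\<lambda>s. q * of_real (real m) powr s * Z1 s + of_real (real m) powr s * deriv Z1 s)"
  have FZ: "F s = (\<Sum>k=1..m. Z k s)" for s
    using sum_hurwitz_zeta[OF m, of s] by (simp add: F_def Z1_def Z_def)
  have 1: "(F has_field_derivative F' s) (at s)" if "s \<in> - {1}" for s
    unfolding F_def F'_def q_def
    by (rule derivative_eq_intros Z1d(1) refl | (use m that in \<open>simp add: algebra_simps\<close>))+
  have 2: "(F' has_field_derivative q * q * Z1 0 + 2 * q * deriv Z1 0 + deriv (deriv Z1) 0) (at 0)"
    unfolding F'_def q_def
    by (rule derivative_eq_intros Z1d(1)[of 0] Z1d(2)[of 0] refl | (use m in \<open>simp add: algebra_simps\<close>))+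
  have op: "open (- {1 :: complex})" by auto
  have k: "real k / real m > 0" if "k \<in> {1..m}" for k using that m by auto
  have 1: "deriv F 0 = q * Z1 0 + deriv Z1 0"
    "deriv (deriv F) 0 = q * q * Z1 0 + 2 * q * deriv Z1 0 + deriv (deriv Z1) 0"
    using deriv_deriv_eqI[OF op _ 1 2] m by (simp_all add: F'_def)
  have 3: "(F has_field_derivative (\<Sum>k=1..m. deriv (Z k) s)) (at s)" if "s \<in> - {1}" for s
    unfolding FZ[abs_def]
    by (rule DERIV_sum, rule Zd(1)) (use k that in auto)
  have 4: "((\<lambda>s. \<Sum>k=1..m. deriv (Z k) s) has_field_derivative (\<Sum>k=1..m. deriv (deriv (Z k)) 0)) (at 0)"
    by (intro DERIV_sum Zd(2) k) auto
  have 2: "deriv F 0 = (\<Sum>k=1..m. deriv (Z k) 0)" "deriv (deriv F) 0 = (\<Sum>k=1..m. deriv (deriv (Z k)) 0)"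
    using deriv_deriv_eqI[OF op _ 3 4] by simp_all
  have Z10: "Z1 0 = - 1 / 2" using hurwitz_zeta_0[of 1] by (simp add: Z1_def)
  have Zm: "Z m = Z1" using m by (simp add: Z_def Z1_def)
  have d1: "deriv Z1 0 = of_real (- ln (2 * pi) / 2)" using Z1d(3) by simp
  have "(\<Sum>k=1..m-1. deriv (Z k) 0) = q * Z1 0"
    using 1 2 Zm by (subst sum_upto_pred[OF m]) simp
  also have "(\<Sum>k=1..m-1. deriv (Z k) 0) = of_real (\<Sum>k=1..m-1. ln (Gamma (real k / real m)) - ln (2 * pi) / 2)"
    unfolding of_real_sum by (intro sum.cong refl Zd(3) k) auto
  also have "q * Z1 0 = of_real (- ln (real m) / 2)" by (simp add: Z10 q_def)
  finally have "(\<Sum>k=1..m-1. ln (Gamma (real k / real m)) - ln (2 * pi) / 2) = - ln (real m) / 2"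
    by (simp only: of_real_eq_iff)
  thus "(\<Sum>l=1..m-1. ln (Gamma (real l / real m))) = (real m - 1) / 2 * ln (2 * pi) - ln (real m) / 2"
    using m by (simp add: sum_subtractf of_nat_diff algebra_simps)
  have "(\<Sum>k=1..m-1. deriv (deriv (Z k)) 0) = q * q * Z1 0 + 2 * q * deriv Z1 0"
    using 1 2 Zm by (subst sum_upto_pred[OF m]) simp
  also have "(\<Sum>k=1..m-1. deriv (deriv (Z k)) 0) = (\<Sum>l=1..m-1. hurwitz_zeta_deriv2 0 (of_real (real l / real m)))"
    by (intro sum.cong refl Zd(4) k) auto
  also have "q * q * Z1 0 + 2 * q * deriv Z1 0 = - complex_of_real (ln (real m) ^ 2 / 2 + ln (real m) * ln (2 * pi))"
    unfolding Z10 d1 q_def by (simp add: power2_eq_square)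
  finally show "(\<Sum>l=1..m-1. hurwitz_zeta_deriv2 0 (of_real (real l / real m))) =
           - complex_of_real (ln (real m) ^ 2 / 2 + ln (real m) * ln (2 * pi))" .
qed

lemma cis_rational_power:
  assumes "m > 0"
  shows "cis (2 * pi * (real l / real m)) ^ m = 1"
proof -
  have "cis (2 * pi * (real l / real m)) ^ m = cis (2 * pi * real l)"
    using assms by (simp add: Complex.DeMoivre)
  also have "\<dots> = 1" by (rule cis_multiple_2pi) auto
  finally show ?thesis .
qed

text \<open>The conjugate root is written with the argument 1 - l / m, which lies in (0, 1) again
  for 0 < l < m, so that both factors are covered by the same mode formulas.\<close>

lemma discrete_fourier_parseval:
  fixes a b :: "nat \<Rightarrow> complex"
  assumes m: "m > 0"
  shows "of_nat m * (\<Sum>k=1..m. a k * b k) =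
         (\<Sum>l<m. (\<Sum>k=1..m. cis (2 * pi * (1 - real l / real m)) ^ k * a k) *
                (\<Sum>j=1..m. cis (2 * pi * (real l / real m)) ^ j * b j))"
proof -
  have orth: "(\<Sum>l<m. cis (2 * pi * (1 - real l / real m)) ^ k * cis (2 * pi * (real l / real m)) ^ j) =
        (if j = k then of_nat m else 0)" if kj: "k \<in> {1..m}" "j \<in> {1..m}" for k j
  proof -
    define y where "y = (real j - real k) / real m"
    define q where "q = cis (2 * pi * y)"
    have "cis (2 * pi * (1 - real l / real m)) ^ k * cis (2 * pi * (real l / real m)) ^ j = q ^ l" for l
    proof -
      have "cis (2 * pi * (1 - real l / real m)) ^ k * cis (2 * pi * (real l / real m)) ^ j =
          cis (2 * pi * real k + real l * (2 * pi * y))"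
        unfolding Complex.DeMoivre cis_mult y_def by (rule arg_cong[where f = cis]) (use m in \<open>simp add: field_simps\<close>)
      also have "\<dots> = cis (2 * pi * real k) * cis (real l * (2 * pi * y))" by (rule cis_mult[symmetric])
      also have "cis (2 * pi * real k) = 1" by (rule cis_multiple_2pi) auto
      finally show ?thesis by (simp add: q_def Complex.DeMoivre)
    qed
    hence "(\<Sum>l<m. cis (2 * pi * (1 - real l / real m)) ^ k * cis (2 * pi * (real l / real m)) ^ j) = (\<Sum>l<m. q ^ l)"
      by simp
    also have "\<dots> = (if q = 1 then of_nat m else (1 - q ^ m) / (1 - q))" by (rule sum_gp_strict)
    also have "q ^ m = 1"
    proof -
      have "q ^ m = cis (2 * pi * (real j - real k))" using m by (simp add: q_def Complex.DeMoivre y_def)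
      also have "\<dots> = 1" by (rule cis_multiple_2pi) auto
      finally show ?thesis .
    qed
    also have "q = 1 \<longleftrightarrow> j = k"
    proof
      assume q: "q = 1"
      show "j = k"
      proof (rule ccontr)
        assume "j \<noteq> k"
        hence y: "y \<noteq> 0" "-1 < y" "y < 1" using m kj by (auto simp: y_def field_simps)
        show False
        proof (cases "y > 0")
          case True
          thus ?thesis using cis_2pi_neq_1[of y] y q by (simp add: q_def)
        next
          case False
          \<comment> \<open>A negative y is shifted by one period into (0, 1), where
            \<open>cis_2pi_neq_1\<close> applies.\<close>
          have "cis (2 * pi * (y + 1)) = cis (2 * pi * y) * cis (2 * pi)"
            by (simp only: cis_mult distrib_left mult_1_right)
          also have "\<dots> = 1" using q by (simp add: q_def)
          finally show ?thesis using cis_2pi_neq_1[of "y + 1"] y False by simp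
        qed
      qed
    qed (auto simp: q_def y_def)
    finally show ?thesis by simp
  qed
  have "(\<Sum>l<m. (\<Sum>k=1..m. cis (2 * pi * (1 - real l / real m)) ^ k * a k) *
                (\<Sum>j=1..m. cis (2 * pi * (real l / real m)) ^ j * b j)) =
        (\<Sum>l<m. \<Sum>k=1..m. \<Sum>j=1..m. a k * b j *
           (cis (2 * pi * (1 - real l / real m)) ^ k * cis (2 * pi * (real l / real m)) ^ j))"
    unfolding sum_product by (intro sum.cong refl) (simp add: mult_ac)
  also have "\<dots> = (\<Sum>k=1..m. \<Sum>l<m. \<Sum>j=1..m. a k * b j *
           (cis (2 * pi * (1 - real l / real m)) ^ k * cis (2 * pi * (real l / real m)) ^ j))"
    by (rule sum.swap)
  also have "\<dots> = (\<Sum>k=1..m. \<Sum>j=1..m. \<Sum>l<m. a k * b j *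
           (cis (2 * pi * (1 - real l / real m)) ^ k * cis (2 * pi * (real l / real m)) ^ j))"
    by (intro sum.cong refl sum.swap)
  also have "\<dots> = (\<Sum>k=1..m. \<Sum>j=1..m. a k * b j * (if j = k then of_nat m else 0))"
    unfolding sum_distrib_left[symmetric] by (intro sum.cong refl, subst orth) auto
  also have "\<dots> = (\<Sum>k=1..m. a k * b k * of_nat m)"
    by (intro sum.cong refl) (simp add: if_distrib[of "\<lambda>x. _ * x"] cong: if_cong)
  finally show ?thesis by (simp add: sum_distrib_left mult_ac)
qed

lemma sum_reflect:
  fixes f :: "nat \<Rightarrow> 'a :: comm_monoid_add"
  shows "(\<Sum>l=1..m-1. f (m - l)) = (\<Sum>l=1..m-1. f l)"
  by (rule sum.reindex_bij_witness[of _ "\<lambda>l. m - l" "\<lambda>l. m - l"]) auto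

lemma sum_antisymmetric:
  fixes f :: "nat \<Rightarrow> complex"
  assumes "\<And>l. l \<in> {1..m-1} \<Longrightarrow> f (m - l) = - f l"
  shows "(\<Sum>l=1..m-1. f l) = 0"
proof -
  have "(\<Sum>l=1..m-1. f l) = (\<Sum>l=1..m-1. - f l)"
    unfolding sum_reflect[of f m, symmetric] by (intro sum.cong refl assms)
  thus ?thesis by (simp add: sum_negf)
qed

text \<open>Sum the reflection formula for ln Gamma and use Gauss' multiplication formula; this is
  the logarithm of the classical product of the sin (pi l / m), which is m / 2^(m-1).\<close>

lemma sum_ln_sin:
  assumes m: "m > 0"
  shows "(\<Sum>l=1..m-1. ln (sin (pi * (real l / real m)))) = ln (real m) - (real m - 1) * ln 2"
proof -
  let ?G = "\<lambda>l. ln (Gamma (real l / real m))"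
  have "(\<Sum>l=1..m-1. ln (sin (pi * (real l / real m)))) = (\<Sum>l=1..m-1. ln pi - ?G l - ?G (m - l))"
  proof (rule sum.cong[OF refl])
    fix l assume "l \<in> {1..m-1}"
    hence l: "0 < real l / real m" "real l / real m < 1" "1 - real l / real m = real (m - l) / real m"
      by (auto simp: of_nat_diff field_simps)
    show "ln (sin (pi * (real l / real m))) = ln pi - ?G l - ?G (m - l)"
      using ln_Gamma_reflection[OF l(1,2)] unfolding l(3) by simp
  qed
  also have "\<dots> = (real m - 1) * ln pi - 2 * (\<Sum>l=1..m-1. ?G l)"
    using m sum_reflect[of ?G m] by (simp add: sum_subtractf of_nat_diff)
  also have "\<dots> = ln (real m) - (real m - 1) * ln 2"
    unfolding sum_ln_Gamma_zeta_deriv2(1)[OF m] by (simp add: ln_mult field_simps)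
  finally show ?thesis .
qed

lemma sum_half_minus_fraction_squared:
  assumes m: "m > 0"
  shows "(\<Sum>l=1..m-1. (1 / 2 - real l / real m) ^ 2) = (real m - 1) * (real m - 2) / (12 * real m)"
proof -
  have 1: "(\<Sum>l=1..n. real l) = real n * (real n + 1) / 2" for n
    by (induction n) (simp_all add: field_simps)
  have 2: "(\<Sum>l=1..n. real l ^ 2) = real n * (real n + 1) * (2 * real n + 1) / 6" for n
    by (induction n) (simp_all add: field_simps power2_eq_square)
  have "(\<Sum>l=1..m-1. (1 / 2 - real l / real m) ^ 2) =
        (\<Sum>l=1..m-1. 1 / 4 - real l * (1 / real m) + real l ^ 2 * (1 / real m ^ 2))"
    by (intro sum.cong refl) (simp add: power2_diff power_divide)
  also have "\<dots> = (real m - 1) / 4 - (\<Sum>l=1..m-1. real l) * (1 / real m) + (\<Sum>l=1..m-1. real l ^ 2) * (1 / real m ^ 2)"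
    using m by (simp only: sum.distrib sum_subtractf sum_distrib_right) (simp add: of_nat_diff)
  also have "\<dots> = (real m - 1) * (real m - 2) / (12 * real m)"
    unfolding 1 2 using m by (simp add: of_nat_diff field_simps power2_eq_square)
  finally show ?thesis .
qed

text \<open>Both factors are odd under l -> m - l, so the sum folds to twice a single one. This is
  the origin of the sum of l * ln Gamma (l / m) in the theorem.\<close>

lemma sum_half_minus_fraction_ln_Gamma:
  assumes m: "m > 0"
  defines "G \<equiv> \<lambda>l. ln (Gamma (real l / real m))"
  shows "(\<Sum>l=1..m-1. (1 / 2 - real l / real m) * (G l - G (m - l))) =
         (\<Sum>l=1..m-1. G l) - 2 / real m * (\<Sum>l=1..m-1. real l * G l)"
proof -
  let ?f = "\<lambda>l. (1 / 2 - real l / real m) * G l"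
  have "(\<Sum>l=1..m-1. (1 / 2 - real l / real m) * (G l - G (m - l))) = (\<Sum>l=1..m-1. ?f l + ?f (m - l))"
    by (intro sum.cong refl) (use m in \<open>auto simp: of_nat_diff field_simps\<close>)
  also have "\<dots> = 2 * (\<Sum>l=1..m-1. ?f l)"
    using sum_reflect[of ?f m] by (simp add: sum.distrib)
  also have "\<dots> = (\<Sum>l=1..m-1. G l - 2 / real m * (real l * G l))"
    unfolding sum_distrib_left by (intro sum.cong refl) (simp add: algebra_simps)
  finally show ?thesis by (simp only: sum_subtractf sum_distrib_left)
qed

text \<open>The digamma mode m - l is paired with the Stieltjes mode l. The product splits into
  \<open>R\<close> and two terms in \<open>W\<close>, all even under l -> m - l, and an odd part
  \<open>A\<close>.\<close>

lemma sum_Digamma_stieltjes_product: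
  assumes m: "m > 0"
  defines "g \<equiv> euler_mascheroni + ln (2 * pi * real m)"
    and "s \<equiv> \<lambda>l. ln (sin (pi * (real l / real m)))"
    and "G \<equiv> \<lambda>l. ln (Gamma (real l / real m))"
    and "W \<equiv> \<lambda>l. hurwitz_zeta_deriv2 0 (of_real (real l / real m)) +
                hurwitz_zeta_deriv2 0 (of_real (1 - real l / real m))"
  shows "(\<Sum>r=1..m-1. Digamma (of_real (real r / real m)) * stieltjes 1 (of_real (real r / real m))) =
         of_real euler_mascheroni * stieltjes 1 1 -
         of_nat m * of_real (euler_mascheroni + ln (real m)) *
           (stieltjes 1 1 - of_real (euler_mascheroni * ln (real m) + ln (real m) ^ 2 / 2)) +
         of_nat m * (of_real (g * (\<Sum>l=1..m-1. (ln 2 + s l) ^ 2 + pi ^ 2 * (1 / 2 - real l / real m) ^ 2) -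
             pi ^ 2 / 2 * (\<Sum>l=1..m-1. (1 / 2 - real l / real m) * (G l - G (m - l)))) +
           of_real (ln 2) * (\<Sum>l=1..m-1. hurwitz_zeta_deriv2 0 (of_real (real l / real m))) +
           (\<Sum>l=1..m-1. W l * of_real (s l)) / 2)"
proof -
  define x where "x = (\<lambda>l. real l / real m)"
  define D where "D = (\<lambda>k. Digamma (complex_of_real (x k)))"
  define S where "S = (\<lambda>k. stieltjes 1 (complex_of_real (x k)))"
  define Z where "Z = (\<lambda>l. hurwitz_zeta_deriv2 0 (complex_of_real (x l)))"
  define R where "R = (\<lambda>l. g * ((ln 2 + s l) ^ 2 + pi ^ 2 * (1 / 2 - x l) ^ 2) -
      pi ^ 2 / 2 * ((1 / 2 - x l) * (G l - G (m - l))))"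
  define A where "A = (\<lambda>l. \<i> * of_real (pi / 2) * (of_real ((ln 2 + s l) * (G l - G (m - l))) + of_real (1 / 2 - x l) * W l))"
  have m0: "complex_of_nat m \<noteq> 0" using m by simp
  have xl: "0 < x l" "x l < 1" "1 - x l = x (m - l)" if "l \<in> {1..m-1}" for l
    using that by (auto simp: x_def of_nat_diff field_simps)
  have Wl: "W l = Z l + Z (m - l)" if "l \<in> {1..m-1}" for l
    by (simp only: W_def Z_def x_def xl(3)[OF that, unfolded x_def])
  have sl: "s (m - l) = s l" if "l \<in> {1..m-1}" for l
  proof -
    have "sin (pi * x (m - l)) = sin (pi * x l)"
      unfolding xl(3)[OF that, symmetric] by (simp add: right_diff_distrib sin_diff)
    thus ?thesis by (simp add: s_def x_def)
  qed
  have mode: "(\<Sum>k=1..m. cis (2 * pi * (1 - x l)) ^ k * D k) * (\<Sum>j=1..m. cis (2 * pi * x l) ^ j * S j) =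
      of_nat m * of_nat m * (of_real (R l) + of_real (ln 2) / 2 * W l + W l * of_real (s l) / 2 + A l)"
    if l: "l \<in> {1..m-1}" for l
  proof -
    have l': "m - l \<in> {1..m-1}" using l by auto
    have "(\<Sum>k=1..m. cis (2 * pi * (1 - x l)) ^ k * D k) = of_nat m * psi_mode (x (m - l))"
      using sum_roots_Digamma_stieltjes(1)[OF xl(1,2)[OF l'] m] cis_rational_power[OF m, of "m - l"]
      unfolding xl(3)[OF l] by (simp only: D_def x_def)
    moreover have "psi_mode (x (m - l)) = of_real (ln 2 + s l) + \<i> * of_real (pi * (1 / 2 - x l))"
    proof -
      have "psi_mode (x (m - l)) = of_real (ln 2 + s (m - l)) - \<i> * of_real (pi * (1 / 2 - x (m - l)))"
        by (simp only: psi_mode_def s_def x_def)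
      also have "1 / 2 - x (m - l) = - (1 / 2 - x l)" using xl(3)[OF l] by simp
      also have "\<i> * of_real (pi * - (1 / 2 - x l)) = - (\<i> * of_real (pi * (1 / 2 - x l)))"
        by (simp only: mult_minus_right of_real_minus)
      finally show ?thesis unfolding sl[OF l] by (simp only: diff_minus_eq_add)
    qed
    moreover have "(\<Sum>j=1..m. cis (2 * pi * x l) ^ j * S j) =
        of_nat m * (of_real g * psi_mode (x l) + (\<i> * of_real (pi * (G l - G (m - l))) + Z l + Z (m - l)) / 2)"
      using sum_roots_Digamma_stieltjes(2)[OF xl(1,2)[OF l] m] cis_rational_power[OF m, of l] xl(3)[OF l]
      by (simp only: S_def x_def g_def G_def Z_def)
    moreover have "psi_mode (x l) = of_real (ln 2 + s l) - \<i> * of_real (pi * (1 / 2 - x l))"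
      by (simp add: psi_mode_def s_def x_def)
    \<comment> \<open>\<open>a\<close> is ln 2 + s l, \<open>p\<close> is pi, \<open>h\<close> is
      1/2 - x l, \<open>c\<close> is g, \<open>d\<close> the difference of the ln Gamma and
      \<open>w\<close> is W l; the last summand becomes \<open>A l\<close>.\<close>
    moreover have "(a + \<i> * (p * h)) * (c * (a - \<i> * (p * h)) + (\<i> * (p * d) + w) / 2) =
        (c * (a ^ 2 + p ^ 2 * h ^ 2) - p ^ 2 / 2 * (h * d)) + a * w / 2 + \<i> * (p / 2) * (a * d + h * w)"
      for a p h c d w :: complex
    proof -
      have "\<i> * (\<i> * z) = - z" for z by (simp flip: mult.assoc)
      thus ?thesis by (simp add: field_simps power2_eq_square)
    qed
    from this[of "of_real (ln 2 + s l)" "of_real pi" "of_real (1 / 2 - x l)" "of_real g" "of_real (G l - G (m - l))" "W l"]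
    have "(of_real (ln 2 + s l) + \<i> * of_real (pi * (1 / 2 - x l))) *
          (of_real g * (of_real (ln 2 + s l) - \<i> * of_real (pi * (1 / 2 - x l))) + (\<i> * of_real (pi * (G l - G (m - l))) + W l) / 2) =
          of_real (R l) + of_real (ln 2) / 2 * W l + W l * of_real (s l) / 2 + A l"
      by (simp add: R_def A_def algebra_simps)
    ultimately show ?thesis by (simp add: Wl[OF l] add.assoc mult_ac)
  qed
  have "of_nat m * (\<Sum>k=1..m. D k * S k) =
      (\<Sum>l<m. (\<Sum>k=1..m. cis (2 * pi * (1 - x l)) ^ k * D k) * (\<Sum>j=1..m. cis (2 * pi * x l) ^ j * S j))"
    unfolding x_def by (rule discrete_fourier_parseval[OF m])
  also have "{..<m} = insert 0 {1..m-1}" using m by auto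
  also have "(\<Sum>l\<in>insert 0 {1..m-1}. (\<Sum>k=1..m. cis (2 * pi * (1 - x l)) ^ k * D k) * (\<Sum>j=1..m. cis (2 * pi * x l) ^ j * S j)) =
      (\<Sum>k=1..m. D k) * (\<Sum>j=1..m. S j) +
      (\<Sum>l=1..m-1. of_nat m * of_nat m * (of_real (R l) + of_real (ln 2) / 2 * W l + W l * of_real (s l) / 2 + A l))"
    using mode by (subst sum.insert) (auto simp: x_def)
  also have "(\<Sum>k=1..m. D k) = - of_nat m * complex_of_real (euler_mascheroni + ln (real m))"
    unfolding D_def x_def by (rule sum_Digamma_stieltjes(1)[OF m])
  also have "(\<Sum>k=1..m. S k) = of_nat m * (stieltjes 1 1 - of_real (euler_mascheroni * ln (real m) + ln (real m) ^ 2 / 2))"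
    unfolding S_def x_def by (rule sum_Digamma_stieltjes(2)[OF m])
  also have "(\<Sum>l=1..m-1. of_nat m * of_nat m * (of_real (R l) + of_real (ln 2) / 2 * W l + W l * of_real (s l) / 2 + A l)) =
      of_nat m * of_nat m * (of_real (\<Sum>l=1..m-1. R l) + of_real (ln 2) / 2 * (\<Sum>l=1..m-1. W l) + (\<Sum>l=1..m-1. W l * of_real (s l)) / 2 + (\<Sum>l=1..m-1. A l))"
    by (simp only: of_real_sum sum_distrib_left sum.distrib sum_divide_distrib distrib_left)
  \<comment> \<open>The difference \<open>G l - G (m - l)\<close> and 1/2 - x l change sign under
    reflection, while \<open>s\<close> and \<open>W\<close> do not.\<close>
  also have "(\<Sum>l=1..m-1. A l) = 0"
  proof (rule sum_antisymmetric)
    fix l assume l: "l \<in> {1..m-1}"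
    hence l': "m - l \<in> {1..m-1}" "m - (m - l) = l" by auto
    have W': "W (m - l) = W l" using Wl[OF l] Wl[OF l'(1)] l'(2) by (simp add: add.commute)
    have h': "1 / 2 - x (m - l) = - (1 / 2 - x l)" using xl(3)[OF l] by simp
    show "A (m - l) = - A l"
      unfolding A_def sl[OF l] l'(2) W' h' by (simp add: algebra_simps)
  qed
  also have "(\<Sum>l=1..m-1. W l) = 2 * (\<Sum>l=1..m-1. Z l)"
  proof -
    have "(\<Sum>l=1..m-1. W l) = (\<Sum>l=1..m-1. Z l + Z (m - l))" by (intro sum.cong refl Wl)
    thus ?thesis using sum_reflect[of Z m] by (simp add: sum.distrib)
  qed
  finally have 0: "of_nat m * (\<Sum>k=1..m. D k * S k) =
      - of_nat m * of_real (euler_mascheroni + ln (real m)) *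
        (of_nat m * (stieltjes 1 1 - of_real (euler_mascheroni * ln (real m) + ln (real m) ^ 2 / 2))) +
      of_nat m * of_nat m * (of_real (\<Sum>l=1..m-1. R l) + of_real (ln 2) / 2 * (2 * (\<Sum>l=1..m-1. Z l)) +
        (\<Sum>l=1..m-1. W l * of_real (s l)) / 2 + 0)" .
  have "- n * e * (n * t) + n * n * (r + q / 2 * (2 * z) + v / 2 + 0) = n * (- n * e * t + n * (r + q * z + v / 2))"
    for n e t r q z v :: complex by (simp add: algebra_simps)
  from 0[unfolded this] have 1: "of_nat m * (\<Sum>k=1..m. D k * S k) =
      of_nat m * (- of_nat m * of_real (euler_mascheroni + ln (real m)) *
           (stieltjes 1 1 - of_real (euler_mascheroni * ln (real m) + ln (real m) ^ 2 / 2)) +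
         of_nat m * (of_real (\<Sum>l=1..m-1. R l) + of_real (ln 2) * (\<Sum>l=1..m-1. Z l) + (\<Sum>l=1..m-1. W l * of_real (s l)) / 2))" .
  have 2: "(\<Sum>k=1..m. D k * S k) =
      (- of_nat m * of_real (euler_mascheroni + ln (real m)) *
           (stieltjes 1 1 - of_real (euler_mascheroni * ln (real m) + ln (real m) ^ 2 / 2)) +
         of_nat m * (of_real (\<Sum>l=1..m-1. R l) + of_real (ln 2) * (\<Sum>l=1..m-1. Z l) + (\<Sum>l=1..m-1. W l * of_real (s l)) / 2))"
    using 1 m0 by (simp only: mult_cancel_left simp_thms)
  \<comment> \<open>Parseval includes k = m, that is the argument 1, where the digamma function is
    minus Euler's constant; this term has to be taken off.\<close>
  have 3: "D m * S m = - of_real euler_mascheroni * stieltjes 1 1"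
    using m by (simp add: D_def S_def x_def)
  have R: "(\<Sum>l=1..m-1. R l) = g * (\<Sum>l=1..m-1. (ln 2 + s l) ^ 2 + pi ^ 2 * (1 / 2 - x l) ^ 2) -
             pi ^ 2 / 2 * (\<Sum>l=1..m-1. (1 / 2 - x l) * (G l - G (m - l)))"
    unfolding R_def by (simp only: sum_subtractf sum_distrib_left)
  have "(\<Sum>r=1..m-1. D r * S r) = (\<Sum>k=1..m. D k * S k) - D m * S m"
    by (rule sum_upto_pred[OF m])
  also have "\<dots> = of_real euler_mascheroni * stieltjes 1 1 -
         of_nat m * of_real (euler_mascheroni + ln (real m)) *
           (stieltjes 1 1 - of_real (euler_mascheroni * ln (real m) + ln (real m) ^ 2 / 2)) +
         of_nat m * (of_real (\<Sum>l=1..m-1. R l) + of_real (ln 2) * (\<Sum>l=1..m-1. Z l) + (\<Sum>l=1..m-1. W l * of_real (s l)) / 2)"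
    unfolding 2 3 by simp
  finally show ?thesis unfolding R by (simp only: D_def S_def Z_def x_def)
qed

theorem mainTheorem6:
  fixes m :: nat
  assumes "m \<ge> 2"
  shows "(\<Sum>r=1..m-1. Digamma (of_nat r / of_nat m) * stieltjes 1 (of_nat r / of_nat m)) =
      of_real (euler_mascheroni * (1 - real m) - real m * ln (real m)) * stieltjes 1 1
    + of_real (real m * euler_mascheroni ^ 2 * ln (real m))
    + of_real (((real m - 1) * (real m - 2) * pi ^ 2 / 12
               - real m * (real m - 1) * (ln 2) ^ 2
               + 2 * real m * ln 2 * ln (real m)
               + 3 * real m / 2 * (ln (real m)) ^ 2) * euler_mascheroni)
    + of_real (- (real m * (real m - 1) * (ln 2) ^ 3)
               + real m / 2 * (ln (real m)) ^ 3
               - (real m * (real m - 2) * ln (real m) + real m * (real m - 1) * ln pi) * (ln 2) ^ 2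
               + 3 * real m / 2 * ln 2 * (ln (real m)) ^ 2
               + real m * ln 2 * ln pi * ln (real m)
               - (real m ^ 2 - 1) * pi ^ 2 / 6 * ln (2 * pi)
               + (real m ^ 2 + 2) * pi ^ 2 / 12 * ln (real m))
    + of_real (real m * (euler_mascheroni + ln (2 * pi * real m)) *
               (\<Sum>l=1..m-1. (ln (sin (pi * real l / real m))) ^ 2))
    + of_nat m / 2 *
        (\<Sum>l=1..m-1. (hurwitz_zeta_deriv2 0 (of_nat l / of_nat m)
                     + hurwitz_zeta_deriv2 0 (1 - of_nat l / of_nat m))
                    * of_real (ln (sin (pi * real l / real m))))
    + of_real (pi ^ 2 * (\<Sum>l=1..m-1. real l * ln (Gamma (real l / real m))))"
proof -
  have m: "m > 0" using assms by simp
  define \<gamma> where "\<gamma> = (euler_mascheroni :: real)"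
  define M where "M = real m"
  \<comment> \<open>In these names, with \<open>M\<close>, \<gamma>, \<open>Q\<close> and
    \<open>H\<close>, the final comparison becomes a rational identity over the reals.\<close>
  define a b c where "a = ln (2 :: real)" and "b = ln pi" and "c = ln M"
  define s where "s = (\<lambda>l. ln (sin (pi * (real l / real m))))"
  define Q where "Q = (\<Sum>l=1..m-1. s l ^ 2)"
  define H where "H = (\<Sum>l=1..m-1. real l * ln (Gamma (real l / real m)))"
  define V where "V = (\<Sum>l=1..m-1. (hurwitz_zeta_deriv2 0 (of_real (real l / real m)) +
      hurwitz_zeta_deriv2 0 (of_real (1 - real l / real m))) * of_real (s l))"
  have M: "M > 0" using m by (simp add: M_def)
  have ln2pi: "ln (2 * pi) = a + b" "ln (2 * pi * real m) = a + b + c"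
    using m by (simp_all add: ln_mult a_def b_def c_def M_def)
  have card: "(\<Sum>l=1..m-1. k) = (M - 1) * k" for k :: real
    using m by (simp add: M_def of_nat_diff)
  have SS: "(\<Sum>l=1..m-1. (ln 2 + s l) ^ 2 + pi ^ 2 * (1 / 2 - real l / real m) ^ 2) =
      (M - 1) * a ^ 2 + 2 * a * (c - (M - 1) * a) + Q + pi ^ 2 * ((M - 1) * (M - 2) / (12 * M))"
  proof -
    have "(\<Sum>l=1..m-1. (ln 2 + s l) ^ 2 + pi ^ 2 * (1 / 2 - real l / real m) ^ 2) =
        (\<Sum>l=1..m-1. a ^ 2 + 2 * a * s l + s l ^ 2 + pi ^ 2 * (1 / 2 - real l / real m) ^ 2)"
      by (intro sum.cong refl) (simp add: power2_sum a_def)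
    also have "\<dots> = (\<Sum>l=1..m-1. a ^ 2) + 2 * a * (\<Sum>l=1..m-1. s l) + Q +
        pi ^ 2 * (\<Sum>l=1..m-1. (1 / 2 - real l / real m) ^ 2)"
      unfolding Q_def by (simp only: sum.distrib sum_distrib_left)
    finally show ?thesis
      unfolding card s_def sum_ln_sin[OF m] sum_half_minus_fraction_squared[OF m]
      by (simp only: a_def c_def M_def)
  qed
  \<comment> \<open>The coefficient -2 / M of \<open>H\<close>, multiplied by -M * pi^2 / 2, yields
    the last term of the theorem.\<close>
  have GG: "(\<Sum>l=1..m-1. (1 / 2 - real l / real m) * (ln (Gamma (real l / real m)) - ln (Gamma (real (m - l) / real m)))) =
      (M - 1) / 2 * (a + b) - c / 2 - 2 / M * H"
    unfolding sum_half_minus_fraction_ln_Gamma[OF m] sum_ln_Gamma_zeta_deriv2(1)[OF m] ln2pi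
    by (simp only: H_def M_def c_def)
  have ZZ: "(\<Sum>l=1..m-1. hurwitz_zeta_deriv2 0 (of_real (real l / real m))) = of_real (- (c ^ 2 / 2 + c * (a + b)))"
    unfolding sum_ln_Gamma_zeta_deriv2(2)[OF m] ln2pi by (simp add: M_def c_def)
  have "(\<Sum>r=1..m-1. Digamma (of_nat r / of_nat m) * stieltjes 1 (of_nat r / of_nat m)) =
      (\<Sum>r=1..m-1. Digamma (of_real (real r / real m)) * stieltjes 1 (complex_of_real (real r / real m)))"
    by simp
  also have "\<dots> = of_real \<gamma> * stieltjes 1 1 -
         of_nat m * of_real (\<gamma> + c) * (stieltjes 1 1 - of_real (\<gamma> * c + c ^ 2 / 2)) +
         of_nat m * (of_real ((\<gamma> + (a + b + c)) * ((M - 1) * a ^ 2 + 2 * a * (c - (M - 1) * a) + Q + pi ^ 2 * ((M - 1) * (M - 2) / (12 * M))) -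
             pi ^ 2 / 2 * ((M - 1) / 2 * (a + b) - c / 2 - 2 / M * H)) +
           of_real a * of_real (- (c ^ 2 / 2 + c * (a + b))) + V / 2)"
    using sum_Digamma_stieltjes_product[OF m]
    unfolding SS[unfolded s_def] GG ZZ V_def[unfolded s_def, symmetric] ln2pi(2) \<gamma>_def[symmetric]
    by (simp only: a_def[symmetric] c_def M_def)
  \<comment> \<open>Only \<open>stieltjes 1 1\<close> and \<open>V\<close> are kept as complex
    quantities; everything else is collected under a single \<open>of_real\<close>.\<close>
  also have "\<dots> = of_real (\<gamma> * (1 - M) - M * c) * stieltjes 1 1 +
      of_real (M * (\<gamma> + c) * (\<gamma> * c + c ^ 2 / 2) +
        M * ((\<gamma> + (a + b + c)) * ((M - 1) * a ^ 2 + 2 * a * (c - (M - 1) * a) + Q + pi ^ 2 * ((M - 1) * (M - 2) / (12 * M))) -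
             pi ^ 2 / 2 * ((M - 1) / 2 * (a + b) - c / 2 - 2 / M * H) + a * (- (c ^ 2 / 2 + c * (a + b))))) +
      of_nat m / 2 * V"
    unfolding M_def by (simp add: algebra_simps)
  also have "M * (\<gamma> + c) * (\<gamma> * c + c ^ 2 / 2) +
        M * ((\<gamma> + (a + b + c)) * ((M - 1) * a ^ 2 + 2 * a * (c - (M - 1) * a) + Q + pi ^ 2 * ((M - 1) * (M - 2) / (12 * M))) -
             pi ^ 2 / 2 * ((M - 1) / 2 * (a + b) - c / 2 - 2 / M * H) + a * (- (c ^ 2 / 2 + c * (a + b)))) =
      M * \<gamma> ^ 2 * c
    + ((M - 1) * (M - 2) * pi ^ 2 / 12 - M * (M - 1) * a ^ 2 + 2 * M * a * c + 3 * M / 2 * c ^ 2) * \<gamma>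
    + (- (M * (M - 1) * a ^ 3) + M / 2 * c ^ 3
               - (M * (M - 2) * c + M * (M - 1) * b) * a ^ 2
               + 3 * M / 2 * a * c ^ 2 + M * a * b * c
               - (M ^ 2 - 1) * pi ^ 2 / 6 * (a + b) + (M ^ 2 + 2) * pi ^ 2 / 12 * c)
    + M * (\<gamma> + (a + b + c)) * Q + pi ^ 2 * H"
    using M by (simp add: field_simps power2_eq_square power3_eq_cube)
  finally have "(\<Sum>r=1..m-1. Digamma (of_nat r / of_nat m) * stieltjes 1 (of_nat r / of_nat m)) =
      of_real (\<gamma> * (1 - M) - M * c) * stieltjes 1 1
    + of_real (M * \<gamma> ^ 2 * c)
    + of_real (((M - 1) * (M - 2) * pi ^ 2 / 12 - M * (M - 1) * a ^ 2 + 2 * M * a * c + 3 * M / 2 * c ^ 2) * \<gamma>)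
    + of_real (- (M * (M - 1) * a ^ 3) + M / 2 * c ^ 3
               - (M * (M - 2) * c + M * (M - 1) * b) * a ^ 2
               + 3 * M / 2 * a * c ^ 2 + M * a * b * c
               - (M ^ 2 - 1) * pi ^ 2 / 6 * (a + b) + (M ^ 2 + 2) * pi ^ 2 / 12 * c)
    + of_real (M * (\<gamma> + (a + b + c)) * Q) + of_nat m / 2 * V + of_real (pi ^ 2 * H)"
    by (simp only: of_real_add add_ac)
  moreover have "Q = (\<Sum>l=1..m-1. (ln (sin (pi * real l / real m))) ^ 2)"
    by (simp add: Q_def s_def)
  moreover have "V = (\<Sum>l=1..m-1. (hurwitz_zeta_deriv2 0 (of_nat l / of_nat m)
                     + hurwitz_zeta_deriv2 0 (1 - of_nat l / of_nat m))
                    * of_real (ln (sin (pi * real l / real m))))"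
    by (simp add: V_def s_def)
  ultimately show ?thesis
    by (simp only: H_def ln2pi(1) ln2pi(2)[folded M_def] M_def[symmetric] \<gamma>_def[symmetric] a_def[symmetric] b_def[symmetric] c_def[symmetric])
qed

end
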